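(* Let $(H,* )$ be a compact quantum group with comultiplication $\Delta$, counit $\varepsilon$, antipode $\mathcal S$, normal integral $\varphi\in H^\vee$ and associated inner product $\langle x,y\rangle=\varphi(y^*x)$. Let $\chi:H\otimes H\to\mathbb C$ be a $*$-cocycle, and let $\mathcal H_\chi$ be the corresponding twisted Hopf algebra, equipped with the same involution $*$. Define $\Phi:H\to H$ by $\Phi=(\kappa\circ\mathcal S^{-1})\star\operatorname{id}\star\kappa^{-1}$, that is, $$\Phi(x)=\sum \chi(\mathcal S^{-1}x_2,x_1)\,x_3\,\chi^{-1}(\mathcal S x_4,x_5),\qquad x\in H.$$ Then $\Phi$ is self-adjoint with respect to $\langle\ ,\ \rangle$, i.e. $\langle\Phi(x),y\rangle=\langle x,\Phi(y)\rangle$ for all $x,y\in H$. Moreover, $\mathcal H_\chi$ is a compact quantum group if and only if $\Phi$ is a positive operator, i.e. $\langle\Phi(x),x\rangle>0$ for all $x\in H$, $x\neq0$.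
   Context: All vector spaces are over $\mathbb C$; $H^\vee$ is the linear dual; Sweedler notation is used; $\star$ denotes the convolution product. A $*$-Hopf algebra is a Hopf algebra $H$ with a conjugate linear involution $*$ that is antimultiplicative, $(xy)^*=y^*x^*$, and comultiplicative, $\Delta(x^* )=\sum x_1^*\otimes x_2^*$; then $(\mathcal S* )^2=\operatorname{id}$, so $\mathcal S$ is bijective. A compact quantum group (CQG) is a $*$-Hopf algebra such that every right comodule $V$ admits an inner product (linear in the first variable) with $\sum\langle u_0,v\rangle\mathcal S(u_1)=\sum\langle u,v_0\rangle v_1^*$ for all $u,v\in V$. A normal integral is the (unique) $\varphi\in H^\vee$ with $\varphi(1)=1$ and $\sum\varphi(x_1)x_2=\varphi(x)1=\sum x_1\varphi(x_2)$ for all $x$; every CQG is cosemisimple and has one, and $\langle x,y\rangle=\varphi(y^*x)$ is then an inner product. A cocycle is a convolution invertible linear map $\chi:H\otimes H\to\mathbb C$ with $\sum\chi(x_1,y_1)\chi(x_2y_2,z)=\sum\chi(y_1,z_1)\chi(x,y_2z_2)$ and $\chi(1,x)=\chi(x,1)=\varepsilon(x)$ for all $x,y,z\in H$. It is a $*$-cocycle if moreover $\chi(x^*,y^* )=\overline{\chi(y,x)}$ for all $x,y\in H$. $\chi^{-1}$ is its convolution inverse. Put $\kappa(x)=\sum\chi(x_1,\mathcal Sx_2)$, with convolution inverse $\kappa^{-1}(x)=\sum\chi^{-1}(\mathcal Sx_1,x_2)$. The twisted Hopf algebra $\mathcal H_\chi$ is the vector space $H$ with the same coproduct, counit and unit,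 product $x\cdot_\chi y=\sum\chi(x_1,y_1)\,x_2y_2\,\chi^{-1}(x_3,y_3)$ and antipode $\mathcal S_\chi=\kappa\star\mathcal S\star\kappa^{-1}$. When $\chi$ is a $*$-cocycle, $\mathcal H_\chi$ with the involution $*$ of $H$ is a $*$-Hopf algebra. *)

theory Defs
  imports Complex_Main "HOL-Library.Complex_Order"
begin

section \<open>Complex vector spaces\<close>

class scaleC =
  fixes scaleC :: "complex \<Rightarrow> 'a \<Rightarrow> 'a" (infixr "*\<^sub>C" 75)

class complex_vector = scaleC + ab_group_add +
  assumes scaleC_add_right: "a *\<^sub>C (x + y) = a *\<^sub>C x + a *\<^sub>C y"
    and scaleC_add_left: "(a + b) *\<^sub>C x = a *\<^sub>C x + b *\<^sub>C x"
    and scaleC_scaleC: "a *\<^sub>C b *\<^sub>C x = (a * b) *\<^sub>C x"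
    and scaleC_one: "1 *\<^sub>C x = x"

global_interpretation complex_vector:
  vector_space "scaleC :: complex \<Rightarrow> 'a \<Rightarrow> 'a :: complex_vector"
  by unfold_locales (simp_all add: scaleC_add_right scaleC_add_left scaleC_scaleC scaleC_one)

instantiation complex :: complex_vector
begin

definition complex_scaleC_def [simp]: "scaleC a (x::complex) = a * x"

instance by standard (simp_all add: algebra_simps)

end

abbreviation clinear :: "('a::complex_vector \<Rightarrow> 'b::complex_vector) \<Rightarrow> bool"
  where "clinear \<equiv> Vector_Spaces.linear scaleC scaleC"

definition cbilinear ::
    "('a::complex_vector \<Rightarrow> 'b::complex_vector \<Rightarrow> 'c::complex_vector) \<Rightarrow> bool"
  where "cbilinear B \<longleftrightarrow> (\<forall>x. clinear (B x)) \<and> (\<forall>y. clinear (\<lambda>x. B x y))"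

definition conjugate_linear :: "('a::complex_vector \<Rightarrow> 'b::complex_vector) \<Rightarrow> bool"
  where "conjugate_linear f \<longleftrightarrow>
    (\<forall>x y. f (x + y) = f x + f y) \<and> (\<forall>c x. f (c *\<^sub>C x) = cnj c *\<^sub>C f x)"

lemma clinear_iff:
  "clinear f \<longleftrightarrow> (\<forall>x y. f (x + y) = f x + f y) \<and> (\<forall>c x. f (c *\<^sub>C x) = c *\<^sub>C f x)"
proof -
  have "module (scaleC :: complex \<Rightarrow> 'a \<Rightarrow> 'a)" "module (scaleC :: complex \<Rightarrow> 'b \<Rightarrow> 'b)"
    by unfold_locales
  then show ?thesis
    by (auto simp: module_hom_iff_linear[symmetric] module_hom_iff)
qed


section \<open>Tensor products\<close>

text \<open>
  The tensor product is presented by generators and relations: a list of pairs stands for a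
  finite formal sum of pure tensors (scalars are absorbed into the factors).
\<close>

inductive tensor_eq :: "('a::complex_vector \<times> 'b::complex_vector) list \<Rightarrow> ('a \<times> 'b) list \<Rightarrow> bool"
  where
    refl: "tensor_eq s s"
  | sym: "tensor_eq s t \<Longrightarrow> tensor_eq t s"
  | trans: "tensor_eq s t \<Longrightarrow> tensor_eq t u \<Longrightarrow> tensor_eq s u"
  | append: "tensor_eq s s' \<Longrightarrow> tensor_eq t t' \<Longrightarrow> tensor_eq (s @ t) (s' @ t')"
  | commute: "tensor_eq (s @ t) (t @ s)"
  | zero: "tensor_eq [(0, y)] []"
  | add_left: "tensor_eq [(x + x', y)] [(x, y), (x', y)]"
  | add_right: "tensor_eq [(x, y + y')] [(x, y), (x, y')]"
  | scale: "tensor_eq [(c *\<^sub>C x, y)] [(x, c *\<^sub>C y)]"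

quotient_type (overloaded) ('a, 'b) tensor =
    "('a::complex_vector \<times> 'b::complex_vector) list" / tensor_eq
  by (intro equivpI reflpI sympI transpI) (blast intro: tensor_eq.intros)+

lift_definition pure_tensor ::
    "'a::complex_vector \<Rightarrow> 'b::complex_vector \<Rightarrow> ('a, 'b) tensor" (infixr "\<otimes>" 76)
  is "\<lambda>x y. [(x, y)]" .

lemma tensor_eq_map_left:
  assumes add: "\<And>x x'. f (x + x') = f x + f x'" and scale: "\<And>c x. f (c *\<^sub>C x) = c *\<^sub>C f x"
    and "tensor_eq s t"
  shows "tensor_eq (map (\<lambda>(x, y). (f x, y)) s) (map (\<lambda>(x, y). (f x, y)) t)"
proof -
  have f0: "f 0 = 0"
    using add[of 0 0] by simp
  show ?thesis
    using assms(3)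
    by induction (auto simp: add scale f0 intro: tensor_eq.intros)
qed

lemma tensor_eq_cancel: "tensor_eq (map (\<lambda>(x, y). (- x, y)) s @ s) []"
proof (induction s)
  case (Cons p s)
  obtain x y where p: "p = (x, y)" by (cases p)
  let ?m = "map (\<lambda>(x, y). (- x, y)) s"
  have "tensor_eq ([(- x, y)] @ ((?m @ [(x, y)]) @ s)) ([(- x, y)] @ (([(x, y)] @ ?m) @ s))"
    by (intro tensor_eq.append tensor_eq.refl tensor_eq.commute)
  moreover have "tensor_eq ([(- x, y), (x, y)] @ (?m @ s)) ([(- x + x, y)] @ [])"
    by (intro tensor_eq.append tensor_eq.sym[OF tensor_eq.add_left] Cons.IH)
  moreover have "tensor_eq [(- x + x, y)] []"
    using tensor_eq.zero by simp
  ultimately show ?case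
    by (auto simp: p intro: tensor_eq.trans)
qed (auto intro: tensor_eq.refl)

lemma tensor_eq_scale_add:
  "tensor_eq (map (\<lambda>(x, y). ((a + b) *\<^sub>C x, y)) s)
    (map (\<lambda>(x, y). (a *\<^sub>C x, y)) s @ map (\<lambda>(x, y). (b *\<^sub>C x, y)) s)"
proof (induction s)
  case (Cons p s)
  obtain x y where p: "p = (x, y)" by (cases p)
  let ?A = "map (\<lambda>(x, y). (a *\<^sub>C x, y)) s" and ?B = "map (\<lambda>(x, y). (b *\<^sub>C x, y)) s"
  let ?AB = "map (\<lambda>(x, y). ((a + b) *\<^sub>C x, y)) s"
  have "tensor_eq ([((a + b) *\<^sub>C x, y)] @ ?AB) ([(a *\<^sub>C x, y), (b *\<^sub>C x, y)] @ (?A @ ?B))"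
    unfolding scaleC_add_left by (intro tensor_eq.append tensor_eq.add_left
        Cons.IH[unfolded scaleC_add_left])
  moreover have "tensor_eq ([(a *\<^sub>C x, y)] @ (([(b *\<^sub>C x, y)] @ ?A) @ ?B))
      ([(a *\<^sub>C x, y)] @ ((?A @ [(b *\<^sub>C x, y)]) @ ?B))"
    by (intro tensor_eq.append tensor_eq.refl tensor_eq.commute)
  ultimately show ?case
    by (auto simp: p intro: tensor_eq.trans)
qed (auto intro: tensor_eq.refl)

instantiation tensor :: (complex_vector, complex_vector) complex_vector
begin

lift_definition zero_tensor :: "('a, 'b) tensor" is "[]" .

lift_definition plus_tensor :: "('a, 'b) tensor \<Rightarrow> ('a, 'b) tensor \<Rightarrow> ('a, 'b) tensor"
  is "(@)" by (rule tensor_eq.append)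

lift_definition uminus_tensor :: "('a, 'b) tensor \<Rightarrow> ('a, 'b) tensor"
  is "map (\<lambda>(x, y). (- x, y))"
  by (rule tensor_eq_map_left) simp_all

lift_definition scaleC_tensor :: "complex \<Rightarrow> ('a, 'b) tensor \<Rightarrow> ('a, 'b) tensor"
  is "\<lambda>c. map (\<lambda>(x, y). (c *\<^sub>C x, y))"
  by (rule tensor_eq_map_left) (simp_all add: scaleC_add_right scaleC_scaleC mult.commute)

definition minus_tensor :: "('a, 'b) tensor \<Rightarrow> ('a, 'b) tensor \<Rightarrow> ('a, 'b) tensor"
  where "minus_tensor s t = s + (- t)"

instance
proof
  fix r s t :: "('a, 'b) tensor" and a b :: complex
  show "r + s + t = r + (s + t)"
    by transfer (simp add: tensor_eq.refl)
  show "s + t = t + s"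
    by transfer (rule tensor_eq.commute)
  show "0 + t = t"
    by transfer (simp add: tensor_eq.refl)
  show "- t + t = 0"
    by transfer (rule tensor_eq_cancel)
  show "s - t = s + - t"
    by (rule minus_tensor_def)
  show "a *\<^sub>C (s + t) = a *\<^sub>C s + a *\<^sub>C t"
    by transfer (simp add: tensor_eq.refl)
  show "(a + b) *\<^sub>C t = a *\<^sub>C t + b *\<^sub>C t"
    by transfer (rule tensor_eq_scale_add)
  show "a *\<^sub>C b *\<^sub>C t = (a * b) *\<^sub>C t"
    by transfer (simp add: case_prod_unfold o_def scaleC_scaleC tensor_eq.refl)
  show "1 *\<^sub>C t = t"
    by transfer (simp add: scaleC_one tensor_eq.refl)
qed

end

text \<open>
  For $t = \sum_i x_i \otimes y_i$ the value of \<open>tensor_sum B t\<close> is $\sum_i B(x_i, y_i)$. This is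
  independent of the chosen representation of $t$ as soon as $B$ is biadditive and balanced over
  the complex numbers, in particular when $B$ is bilinear or conjugate linear in both variables;
  it is only used for such $B$.
\<close>

definition tensor_sum ::
    "('a::complex_vector \<Rightarrow> 'b::complex_vector \<Rightarrow> 'c::ab_group_add) \<Rightarrow> ('a, 'b) tensor \<Rightarrow> 'c"
  where "tensor_sum B t = (\<Sum>(x, y)\<leftarrow>rep_tensor t. B x y)"

definition balanced ::
    "('a::complex_vector \<Rightarrow> 'b::complex_vector \<Rightarrow> 'c::ab_group_add) \<Rightarrow> bool"
  where "balanced B \<longleftrightarrow>
    (\<forall>x x' y. B (x + x') y = B x y + B x' y) \<and> (\<forall>x y y'. B x (y + y') = B x y + B x y') \<and>
    (\<forall>c x y. B (c *\<^sub>C x) y = B x (c *\<^sub>C y))"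

lemma abs_tensor_cases: obtains s where "t = abs_tensor s"
  by (metis Quotient3_abs_rep Quotient3_tensor)

lemma tensor_eq_imp_sum_eq:
  assumes "balanced B" and "tensor_eq s t"
  shows "(\<Sum>(x, y)\<leftarrow>s. B x y) = (\<Sum>(x, y)\<leftarrow>t. B x y)"
proof -
  have B0: "B 0 y = 0" for y
    using assms(1) unfolding balanced_def by (metis add_cancel_right_right add_0)
  show ?thesis
    using assms(2)
    by induction (use assms(1) in \<open>auto simp: balanced_def B0 add.commute\<close>)
qed

lemma tensor_sum_abs:
  assumes "balanced B"
  shows "tensor_sum B (abs_tensor s) = (\<Sum>(x, y)\<leftarrow>s. B x y)"
  unfolding tensor_sum_def
  by (rule tensor_eq_imp_sum_eq[OF assms])
    (metis Quotient3_abs_rep Quotient3_tensor tensor.abs_eq_iff)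

lemma tensor_sum_pure [simp]: "balanced B \<Longrightarrow> tensor_sum B (x \<otimes> y) = B x y"
  by (simp add: pure_tensor.abs_eq tensor_sum_abs)

lemma tensor_sum_add:
  assumes "balanced B"
  shows "tensor_sum B (s + t) = tensor_sum B s + tensor_sum B t"
proof -
  obtain u v where "s = abs_tensor u" "t = abs_tensor v"
    by (metis abs_tensor_cases)
  then show ?thesis
    by (simp add: plus_tensor.abs_eq tensor_sum_abs[OF assms])
qed

lemma tensor_sum_scaleC:
  assumes "balanced B"
  shows "tensor_sum B (c *\<^sub>C t) = tensor_sum (\<lambda>x y. B (c *\<^sub>C x) y) t"
proof -
  obtain u where u: "t = abs_tensor u"
    by (rule abs_tensor_cases)
  have "balanced (\<lambda>x y. B (c *\<^sub>C x) y)"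
    using assms by (auto simp: balanced_def scaleC_add_right scaleC_scaleC mult.commute)
  then show ?thesis
    by (simp add: u scaleC_tensor.abs_eq tensor_sum_abs assms case_prod_unfold o_def)
qed

lemma cbilinear_imp_balanced: "cbilinear B \<Longrightarrow> balanced B"
  by (simp add: cbilinear_def clinear_iff balanced_def)

lemma conjugate_bilinear_imp_balanced:
  "(\<And>x. conjugate_linear (B x)) \<Longrightarrow> (\<And>y. conjugate_linear (\<lambda>x. B x y)) \<Longrightarrow> balanced B"
  by (simp add: conjugate_linear_def balanced_def)

lemma tensor_induct [case_names zero add]:
  assumes "P 0" and "\<And>x y t. P t \<Longrightarrow> P (x \<otimes> y + t)"
  shows "P t"
proof -
  obtain u where u: "t = abs_tensor u"
    by (rule abs_tensor_cases)
  have "P (abs_tensor u)"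
  proof (induction u)
    case Nil
    then show ?case using assms(1) by (simp add: zero_tensor.abs_eq)
  next
    case (Cons p u)
    then show ?case
      using assms(2)[of "abs_tensor u" "fst p" "snd p"]
      by (simp add: pure_tensor.abs_eq plus_tensor.abs_eq)
  qed
  then show ?thesis by (simp add: u)
qed

lemma cbilinear_pure_tensor: "cbilinear (\<otimes>)"
proof -
  have "x \<otimes> (c *\<^sub>C y) = c *\<^sub>C (x \<otimes> y)" "(c *\<^sub>C x) \<otimes> y = c *\<^sub>C (x \<otimes> y)"
    "x \<otimes> (y + y') = x \<otimes> y + x \<otimes> y'" "(x + x') \<otimes> y = x \<otimes> y + x' \<otimes> y"
    for c and x x' :: 'a and y y' :: 'b
    by (transfer; auto intro: tensor_eq.intros)+
  then show ?thesis by (simp add: cbilinear_def clinear_iff)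
qed

theorem tensor_universal_property:
  fixes B :: "'a::complex_vector \<Rightarrow> 'b::complex_vector \<Rightarrow> 'c::complex_vector"
  assumes "cbilinear B"
  shows "clinear (tensor_sum B)" and "tensor_sum B (x \<otimes> y) = B x y"
    and "\<lbrakk>clinear f; \<And>x y. f (x \<otimes> y) = B x y\<rbrakk> \<Longrightarrow> f = tensor_sum B"
proof -
  note bal = cbilinear_imp_balanced[OF assms]
  show pure: "tensor_sum B (x \<otimes> y) = B x y" for x y
    by (simp add: bal)
  have sum0: "tensor_sum B 0 = 0"
    using tensor_sum_add[OF bal, of 0 0] by simp
  have "tensor_sum B (c *\<^sub>C t) = c *\<^sub>C tensor_sum B t" for c t
  proof (induction t rule: tensor_induct)
    case zero
    then show ?case
      by (simp add: sum0)
  next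
    case (add x y t)
    have "c *\<^sub>C (x \<otimes> y) = (c *\<^sub>C x) \<otimes> y"
      using cbilinear_pure_tensor[where 'a='a and 'b='b] by (simp add: cbilinear_def clinear_iff)
    then show ?case
      using add assms by (simp add: scaleC_add_right tensor_sum_add bal cbilinear_def clinear_iff)
  qed
  then show "clinear (tensor_sum B)"
    by (simp add: clinear_iff tensor_sum_add[OF bal])
  show "f = tensor_sum B" if f: "clinear f" "\<And>x y. f (x \<otimes> y) = B x y"
  proof
    have f0: "f 0 = 0"
      using f(1) unfolding clinear_iff by (metis add_cancel_right_right add_0)
    show "f t = tensor_sum B t" for t
      by (induction t rule: tensor_induct)
        (use f in \<open>simp_all add: f0 sum0 tensor_sum_add[OF bal] bal clinear_iff\<close>)
  qed
qed


section \<open>Hopf algebras\<close>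

record (overloaded) 'a star_hopf_data =
  hmult :: "'a \<Rightarrow> 'a \<Rightarrow> 'a"
  hunit :: 'a
  comult :: "'a \<Rightarrow> ('a, 'a) tensor"
  counit :: "'a \<Rightarrow> complex"
  antipode :: "'a \<Rightarrow> 'a"
  hstar :: "'a \<Rightarrow> 'a"

text \<open>
  Sweedler sums: \<open>sweedler2 H F x\<close> is $\sum F(x_1, x_2)$ and \<open>sweedler3 H F x\<close> is
  $\sum F(x_1, x_2, x_3)$.
\<close>

definition sweedler2 ::
    "'a::complex_vector star_hopf_data \<Rightarrow> ('a \<Rightarrow> 'a \<Rightarrow> 'c::ab_group_add) \<Rightarrow> 'a \<Rightarrow> 'c"
  where "sweedler2 H F x = tensor_sum F (comult H x)"

definition sweedler3 ::
    "'a::complex_vector star_hopf_data \<Rightarrow> ('a \<Rightarrow> 'a \<Rightarrow> 'a \<Rightarrow> 'c::ab_group_add) \<Rightarrow> 'a \<Rightarrow> 'c"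
  where "sweedler3 H F x = sweedler2 H (\<lambda>x\<^sub>1 y. sweedler2 H (\<lambda>x\<^sub>2 x\<^sub>3. F x\<^sub>1 x\<^sub>2 x\<^sub>3) y) x"

locale hopf_algebra =
  fixes H :: "'a::complex_vector star_hopf_data"
  assumes mult_bilinear: "cbilinear (hmult H)"
    and mult_assoc: "hmult H (hmult H x y) z = hmult H x (hmult H y z)"
    and unit_mult: "hmult H (hunit H) x = x"
    and mult_unit: "hmult H x (hunit H) = x"
    and comult_linear: "clinear (comult H)"
    and counit_linear: "clinear (counit H)"
    and coassoc:
      "sweedler2 H (\<lambda>x\<^sub>1 y. sweedler2 H (\<lambda>x\<^sub>2 x\<^sub>3. x\<^sub>1 \<otimes> x\<^sub>2 \<otimes> x\<^sub>3) y) x =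
       sweedler2 H (\<lambda>y x\<^sub>3. sweedler2 H (\<lambda>x\<^sub>1 x\<^sub>2. x\<^sub>1 \<otimes> x\<^sub>2 \<otimes> x\<^sub>3) y) x"
    and counit_left: "sweedler2 H (\<lambda>x\<^sub>1 x\<^sub>2. counit H x\<^sub>1 *\<^sub>C x\<^sub>2) x = x"
    and counit_right: "sweedler2 H (\<lambda>x\<^sub>1 x\<^sub>2. counit H x\<^sub>2 *\<^sub>C x\<^sub>1) x = x"
    and comult_mult:
      "comult H (hmult H x y) =
       sweedler2 H (\<lambda>x\<^sub>1 x\<^sub>2. sweedler2 H (\<lambda>y\<^sub>1 y\<^sub>2. hmult H x\<^sub>1 y\<^sub>1 \<otimes> hmult H x\<^sub>2 y\<^sub>2) y) x"
    and comult_unit: "comult H (hunit H) = hunit H \<otimes> hunit H"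
    and counit_mult: "counit H (hmult H x y) = counit H x * counit H y"
    and counit_unit: "counit H (hunit H) = 1"
    and antipode_linear: "clinear (antipode H)"
    and antipode_left:
      "sweedler2 H (\<lambda>x\<^sub>1 x\<^sub>2. hmult H (antipode H x\<^sub>1) x\<^sub>2) x = counit H x *\<^sub>C hunit H"
    and antipode_right:
      "sweedler2 H (\<lambda>x\<^sub>1 x\<^sub>2. hmult H x\<^sub>1 (antipode H x\<^sub>2)) x = counit H x *\<^sub>C hunit H"

locale star_hopf_algebra = hopf_algebra H
  for H :: "'a::complex_vector star_hopf_data" +
  assumes star_conjugate_linear: "conjugate_linear (hstar H)"
    and star_star: "hstar H (hstar H x) = x"
    and star_mult: "hstar H (hmult H x y) = hmult H (hstar H y) (hstar H x)"
    and comult_star: "comult H (hstar H x) = sweedler2 H (\<lambda>x\<^sub>1 x\<^sub>2. hstar H x\<^sub>1 \<otimes> hstar H x\<^sub>2) x"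


section \<open>Compact quantum groups\<close>

text \<open>
  A comodule is carried by a subspace $V$ of an ambient vector space \<open>'v\<close>, so that
  $V \otimes H$ is the span of the tensors $v \otimes h$ with $v \in V$. The coaction on $V$ is
  represented by a linear map on all of \<open>'v\<close>, because a linear map on a subspace can always be
  extended; only its values on $V$ matter.
\<close>

definition right_comodule ::
    "'a::complex_vector star_hopf_data \<Rightarrow> 'v::complex_vector set \<Rightarrow> ('v \<Rightarrow> ('v, 'a) tensor) \<Rightarrow> bool"
  where "right_comodule H V \<rho> \<longleftrightarrow>
    complex_vector.subspace V \<and> clinear \<rho> \<and>
    \<rho> ` V \<subseteq> complex_vector.span {v \<otimes> h | v h. v \<in> V} \<and>
    (\<forall>v\<in>V.
      tensor_sum (\<lambda>v\<^sub>0 h. sweedler2 H (\<lambda>h\<^sub>1 h\<^sub>2. v\<^sub>0 \<otimes> h\<^sub>1 \<otimes> h\<^sub>2) h) (\<rho> v) =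
      tensor_sum (\<lambda>w h\<^sub>2. tensor_sum (\<lambda>v\<^sub>0 h\<^sub>1. v\<^sub>0 \<otimes> h\<^sub>1 \<otimes> h\<^sub>2) (\<rho> w)) (\<rho> v)) \<and>
    (\<forall>v\<in>V. tensor_sum (\<lambda>v\<^sub>0 h. counit H h *\<^sub>C v\<^sub>0) (\<rho> v) = v)"

text \<open>
  Likewise, a sesquilinear form on $V$ is represented by an extension to the ambient space, while
  Hermitian symmetry and definiteness are required on $V$ only.
\<close>

definition inner_product_on ::
    "'v::complex_vector set \<Rightarrow> ('v \<Rightarrow> 'v \<Rightarrow> complex) \<Rightarrow> bool"
  where "inner_product_on V ip \<longleftrightarrow>
    (\<forall>v. clinear (\<lambda>u. ip u v)) \<and> (\<forall>u. conjugate_linear (ip u)) \<and>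
    (\<forall>u\<in>V. \<forall>v\<in>V. ip u v = cnj (ip v u)) \<and> (\<forall>u\<in>V. u \<noteq> 0 \<longrightarrow> ip u u > 0)"

definition invariant_inner_product_on ::
    "'a::complex_vector star_hopf_data \<Rightarrow> 'v::complex_vector set \<Rightarrow> ('v \<Rightarrow> ('v, 'a) tensor) \<Rightarrow>
     ('v \<Rightarrow> 'v \<Rightarrow> complex) \<Rightarrow> bool"
  where "invariant_inner_product_on H V \<rho> ip \<longleftrightarrow>
    inner_product_on V ip \<and>
    (\<forall>u\<in>V. \<forall>v\<in>V.
      tensor_sum (\<lambda>u\<^sub>0 u\<^sub>1. ip u\<^sub>0 v *\<^sub>C antipode H u\<^sub>1) (\<rho> u) =
      tensor_sum (\<lambda>v\<^sub>0 v\<^sub>1. ip u v\<^sub>0 *\<^sub>C hstar H v\<^sub>1) (\<rho> v))"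

text \<open>
  HOL cannot quantify over all types inside a formula, so the quantification over all comodules is
  relative to an ambient vector space \<open>'v\<close>. If \<open>'v\<close> is infinite-dimensional, all
  finite-dimensional comodules occur up to isomorphism, and a statement that is polymorphic in
  \<open>'v\<close> covers comodules of every dimension.
\<close>

definition compact_quantum_group ::
    "'v::complex_vector itself \<Rightarrow> 'a::complex_vector star_hopf_data \<Rightarrow> bool"
  where "compact_quantum_group (TYPE('v)) H \<longleftrightarrow>
    star_hopf_algebra H \<and>
    (\<forall>(V :: 'v set) \<rho>. right_comodule H V \<rho> \<longrightarrow> (\<exists>ip. invariant_inner_product_on H V \<rho> ip))"

definition normal_integral :: "'a::complex_vector star_hopf_data \<Rightarrow> ('a \<Rightarrow> complex) \<Rightarrow> bool"
  where "normal_integral H \<phi> \<longleftrightarrow>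
    clinear \<phi> \<and> \<phi> (hunit H) = 1 \<and>
    (\<forall>x. sweedler2 H (\<lambda>x\<^sub>1 x\<^sub>2. \<phi> x\<^sub>1 *\<^sub>C x\<^sub>2) x = \<phi> x *\<^sub>C hunit H) \<and>
    (\<forall>x. sweedler2 H (\<lambda>x\<^sub>1 x\<^sub>2. \<phi> x\<^sub>2 *\<^sub>C x\<^sub>1) x = \<phi> x *\<^sub>C hunit H)"

definition integral_inner ::
    "'a::complex_vector star_hopf_data \<Rightarrow> ('a \<Rightarrow> complex) \<Rightarrow> 'a \<Rightarrow> 'a \<Rightarrow> complex"
  where "integral_inner H \<phi> x y = \<phi> (hmult H (hstar H y) x)"


section \<open>Cocycles and twisting\<close>

definition convolution_inverses ::
    "'a::complex_vector star_hopf_data \<Rightarrow> (('a, 'a) tensor \<Rightarrow> complex) \<Rightarrow> (('a, 'a) tensor \<Rightarrow> complex) \<Rightarrow> bool"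
  where "convolution_inverses H \<chi> \<psi> \<longleftrightarrow>
    (\<forall>x y. sweedler2 H (\<lambda>x\<^sub>1 x\<^sub>2. sweedler2 H (\<lambda>y\<^sub>1 y\<^sub>2. \<chi> (x\<^sub>1 \<otimes> y\<^sub>1) * \<psi> (x\<^sub>2 \<otimes> y\<^sub>2)) y) x
      = counit H x * counit H y) \<and>
    (\<forall>x y. sweedler2 H (\<lambda>x\<^sub>1 x\<^sub>2. sweedler2 H (\<lambda>y\<^sub>1 y\<^sub>2. \<psi> (x\<^sub>1 \<otimes> y\<^sub>1) * \<chi> (x\<^sub>2 \<otimes> y\<^sub>2)) y) x
      = counit H x * counit H y)"

definition convolution_inverse ::
    "'a::complex_vector star_hopf_data \<Rightarrow> (('a, 'a) tensor \<Rightarrow> complex) \<Rightarrow> ('a, 'a) tensor \<Rightarrow> complex"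
  where "convolution_inverse H \<chi> = (THE \<psi>. clinear \<psi> \<and> convolution_inverses H \<chi> \<psi>)"

definition cocycle ::
    "'a::complex_vector star_hopf_data \<Rightarrow> (('a, 'a) tensor \<Rightarrow> complex) \<Rightarrow> bool"
  where "cocycle H \<chi> \<longleftrightarrow>
    clinear \<chi> \<and> (\<exists>\<psi>. clinear \<psi> \<and> convolution_inverses H \<chi> \<psi>) \<and>
    (\<forall>x y z.
      sweedler2 H (\<lambda>x\<^sub>1 x\<^sub>2. sweedler2 H (\<lambda>y\<^sub>1 y\<^sub>2. \<chi> (x\<^sub>1 \<otimes> y\<^sub>1) * \<chi> (hmult H x\<^sub>2 y\<^sub>2 \<otimes> z)) y) x =
      sweedler2 H (\<lambda>y\<^sub>1 y\<^sub>2. sweedler2 H (\<lambda>z\<^sub>1 z\<^sub>2. \<chi> (y\<^sub>1 \<otimes> z\<^sub>1) * \<chi> (x \<otimes> hmult H y\<^sub>2 z\<^sub>2)) z) y) \<and>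
    (\<forall>x. \<chi> (hunit H \<otimes> x) = counit H x \<and> \<chi> (x \<otimes> hunit H) = counit H x)"

definition star_cocycle ::
    "'a::complex_vector star_hopf_data \<Rightarrow> (('a, 'a) tensor \<Rightarrow> complex) \<Rightarrow> bool"
  where "star_cocycle H \<chi> \<longleftrightarrow>
    cocycle H \<chi> \<and> (\<forall>x y. \<chi> (hstar H x \<otimes> hstar H y) = cnj (\<chi> (y \<otimes> x)))"

definition kappa ::
    "'a::complex_vector star_hopf_data \<Rightarrow> (('a, 'a) tensor \<Rightarrow> complex) \<Rightarrow> 'a \<Rightarrow> complex"
  where "kappa H \<chi> = sweedler2 H (\<lambda>x\<^sub>1 x\<^sub>2. \<chi> (x\<^sub>1 \<otimes> antipode H x\<^sub>2))"

definition kappa_inv ::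
    "'a::complex_vector star_hopf_data \<Rightarrow> (('a, 'a) tensor \<Rightarrow> complex) \<Rightarrow> 'a \<Rightarrow> complex"
  where "kappa_inv H \<chi> =
    sweedler2 H (\<lambda>x\<^sub>1 x\<^sub>2. convolution_inverse H \<chi> (antipode H x\<^sub>1 \<otimes> x\<^sub>2))"

text \<open>The convolution product $\alpha \star T \star \beta$ of two functionals and an operator.\<close>

definition convolve_operator ::
    "'a::complex_vector star_hopf_data \<Rightarrow> ('a \<Rightarrow> complex) \<Rightarrow> ('a \<Rightarrow> 'a) \<Rightarrow> ('a \<Rightarrow> complex) \<Rightarrow> 'a \<Rightarrow> 'a"
  where "convolve_operator H \<alpha> T \<beta> = sweedler3 H (\<lambda>x\<^sub>1 x\<^sub>2 x\<^sub>3. (\<alpha> x\<^sub>1 * \<beta> x\<^sub>3) *\<^sub>C T x\<^sub>2)"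

definition twisted_hopf_algebra ::
    "'a::complex_vector star_hopf_data \<Rightarrow> (('a, 'a) tensor \<Rightarrow> complex) \<Rightarrow> 'a star_hopf_data"
  where "twisted_hopf_algebra H \<chi> = H\<lparr>
    hmult := \<lambda>x y. sweedler3 H (\<lambda>x\<^sub>1 x\<^sub>2 x\<^sub>3. sweedler3 H (\<lambda>y\<^sub>1 y\<^sub>2 y\<^sub>3.
      (\<chi> (x\<^sub>1 \<otimes> y\<^sub>1) * convolution_inverse H \<chi> (x\<^sub>3 \<otimes> y\<^sub>3)) *\<^sub>C hmult H x\<^sub>2 y\<^sub>2) y) x,
    antipode := convolve_operator H (kappa H \<chi>) (antipode H) (kappa_inv H \<chi>)\<rparr>"

definition twist_Phi ::
    "'a::complex_vector star_hopf_data \<Rightarrow> (('a, 'a) tensor \<Rightarrow> complex) \<Rightarrow> 'a \<Rightarrow> 'a"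
  where "twist_Phi H \<chi> =
    convolve_operator H (kappa H \<chi> \<circ> inv (antipode H)) id (kappa_inv H \<chi>)"

end

theory Submission
  imports Defs "HOL-Computational_Algebra.Fundamental_Theorem_Algebra"
begin

text \<open>
  The theorem follows from one formula: for all $x$ and $y$,
  \[ \langle \Phi(x), y \rangle = \varphi(y^* \cdot_\chi x), \]
  so the form defined by $\Phi$ is the integral inner product of the twisted algebra
  (\<open>integral_twisted_mult\<close>, \<open>twisted_form\<close>). It comes from the invariance of $\varphi$:
  in $\sum \chi(y_1, x_1)\, \varphi(y_2 x_2)\, \chi^{-1}(y_3, x_3)$ the outer legs of $y$ can be moved to
  $x$, where $\chi$ becomes $\kappa \circ S^{-1}$ and $\chi^{-1}$ becomes $\kappa^{-1}$.

  Twisting changes neither the coproduct nor the unit, so $\varphi$ is also the normal integral of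
  the twisted algebra. Once this algebra is known to be a $*$-Hopf algebra, the form
  $\varphi(y^* \cdot_\chi x)$ is Hermitian, and this is the self-adjointness of $\Phi$. The equivalence is
  then an instance of a general criterion (\<open>compact_quantum_group_iff_form_positive\<close>): a
  $*$-Hopf algebra with normal integral $\varphi$ is a compact quantum group if and only if
  $\varphi(x^* x) > 0$ for all $x \neq 0$.

  If $\varphi$ is positive, then $\varphi(y^* x)$ is an invariant inner product on the regular comodule. Any
  comodule $V$ embeds into a direct sum of copies of the regular one, by the coordinates of its
  coaction in a basis of the ambient space, and the pulled back form is an invariant inner product
  on $V$.

  Conversely, suppose that all comodules are unitary but $\varphi(x^* x) \le 0$ for some $x \neq 0$. The antipode
  turns $\varphi(y^* x)$ into another invariant Hermitian form $\varphi(S(y)^* S(x))$. On a finite-dimensional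
  subcomodule where this form is not positive, compare it with an invariant inner product: it has
  an eigenvector $x$ with an eigenvalue $c \le 0$, and by invariance all right translates of $x$ are
  eigenvectors with the same eigenvalue. In a unitary subcomodule that contains $X = S(x)$, with
  orthonormal basis $(e)$, the elements $y_e = \sum \langle X_1, e \rangle X_2$ are images under $S$ of right
  translates of $x$, so $\varphi(y_e^* y_e) \le 0$. But they form a column of a multiple of a unitary matrix:
  $\sum_e y_e^* y_e = \langle X, X \rangle 1$, and applying $\varphi$ gives a contradiction.

  The twisted $*$-Hopf algebra is handled in convolution algebras. The twisted product is the
  multiplication, as a coalgebra map from the tensor square, conjugated by $\chi$. Conjugating a
  coalgebra map by an invertible functional gives a coalgebra map, which yields the bialgebra axioms;
  both bracketings of a triple product are conjugates of the untwisted triple product by functionals on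
  the tensor cube, and the cocycle identity says that these two functionals are equal.
\<close>

section \<open>Linear maps and tensor sums\<close>

text \<open>
  In a multilinear Sweedler expression every variable occurs exactly once, so in each step at most one
  of these closure rules leads on, and backward chaining with them proves linearity in any leg.
\<close>

named_theorems lin

abbreviation (input) cspan :: "'a::complex_vector set \<Rightarrow> 'a set"
  where "cspan \<equiv> complex_vector.span"

abbreviation (input) csubspace :: "'a::complex_vector set \<Rightarrow> bool"
  where "csubspace \<equiv> complex_vector.subspace"

lemma clinearI:
  assumes "\<And>x y. f (x + y) = f x + f y" and "\<And>c x. f (c *\<^sub>C x) = c *\<^sub>C f x"
  shows "clinear f"
  using assms by (simp add: clinear_iff)

lemma clinear_add: "clinear f \<Longrightarrow> f (x + y) = f x + f y"
  and clinear_scaleC: "clinear f \<Longrightarrow> f (c *\<^sub>C x) = c *\<^sub>C f x"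
  by (simp_all add: clinear_iff)

lemma clinear_0: "clinear f \<Longrightarrow> f 0 = 0"
  by (metis add_cancel_right_right clinear_add)

lemma clinear_minus: "clinear f \<Longrightarrow> f (- x) = - f x"
  by (metis add.right_inverse clinear_0 clinear_add minus_unique)

lemma clinear_diff: "clinear f \<Longrightarrow> f (x - y) = f x - f y"
  by (metis clinear_add clinear_minus diff_conv_add_uminus)

lemma clinear_sum: "clinear f \<Longrightarrow> f (\<Sum>a\<in>A. g a) = (\<Sum>a\<in>A. f (g a))"
  by (induction A rule: infinite_finite_induct) (simp_all add: clinear_0 clinear_add)

lemma conjugate_linear_0: "conjugate_linear f \<Longrightarrow> f 0 = 0"
  unfolding conjugate_linear_def by (metis add_cancel_right_right)

lemma conjugate_linear_sum:
  "conjugate_linear f \<Longrightarrow> f (\<Sum>a\<in>A. g a) = (\<Sum>a\<in>A. f (g a))"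
  by (induction A rule: infinite_finite_induct)
    (simp_all add: conjugate_linear_0 conjugate_linear_def)

lemma cbilinearI [lin]:
  "(\<And>x. clinear (\<lambda>y. B x y)) \<Longrightarrow> (\<And>y. clinear (\<lambda>x. B x y)) \<Longrightarrow> cbilinear B"
  by (simp add: cbilinear_def)

lemma cbilinear_right: "cbilinear B \<Longrightarrow> clinear f \<Longrightarrow> clinear (\<lambda>x. B y (f x))"
  by (simp add: cbilinear_def clinear_iff)

lemma cbilinear_left: "cbilinear B \<Longrightarrow> clinear f \<Longrightarrow> clinear (\<lambda>x. B (f x) y)"
  by (simp add: cbilinear_def clinear_iff)

lemma clinear_id [lin]: "clinear (\<lambda>x. x)"
  by (simp add: clinear_iff)

lemma clinear_const_scaleC [lin]: "clinear f \<Longrightarrow> clinear (\<lambda>x. c *\<^sub>C f x)"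
  by (simp add: clinear_iff scaleC_add_right scaleC_scaleC mult.commute)

lemma clinear_scaleC_const [lin]: "clinear f \<Longrightarrow> clinear (\<lambda>x. f x *\<^sub>C v)"
  by (simp add: clinear_iff scaleC_add_left scaleC_scaleC)

lemma clinear_mult_left [lin]: "clinear f \<Longrightarrow> clinear (\<lambda>x. f x * (c::complex))"
  and clinear_mult_right [lin]: "clinear f \<Longrightarrow> clinear (\<lambda>x. (c::complex) * f x)"
  by (simp_all add: clinear_iff algebra_simps)

lemma clinear_pure_left [lin]: "clinear f \<Longrightarrow> clinear (\<lambda>x. f x \<otimes> v)"
  by (rule cbilinear_left[OF cbilinear_pure_tensor])

lemma clinear_pure_right [lin]: "clinear f \<Longrightarrow> clinear (\<lambda>x. v \<otimes> f x)"
  by (rule cbilinear_right[OF cbilinear_pure_tensor])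

lemma clinear_compose: "clinear g \<Longrightarrow> clinear f \<Longrightarrow> clinear (\<lambda>x. g (f x))"
  by (simp add: clinear_iff)

lemma clinear_sum_fun [lin]:
  "(\<And>a. a \<in> A \<Longrightarrow> clinear (\<lambda>x. f a x)) \<Longrightarrow> clinear (\<lambda>x. \<Sum>a\<in>A. f a x)"
  by (auto simp: clinear_iff sum.distrib complex_vector.scale_sum_right)

lemma clinear_sum_list:
  "(\<And>a. clinear (\<lambda>x. f a x)) \<Longrightarrow> clinear (\<lambda>x. \<Sum>a\<leftarrow>as. f a x)"
  by (induction as) (auto simp: clinear_iff scaleC_add_right)

lemma clinear_tensor_sum_fun [lin]:
  "(\<And>a b. clinear (\<lambda>x. F x a b)) \<Longrightarrow> clinear (\<lambda>x. tensor_sum (\<lambda>a b. F x a b) t)"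
  unfolding tensor_sum_def case_prod_unfold by (rule clinear_sum_list)

lemma clinear_tensor_sum: "cbilinear B \<Longrightarrow> clinear (\<lambda>t. tensor_sum B t)"
  using tensor_universal_property(1) by metis

lemma clinear_tensor_sum_arg [lin]:
  "cbilinear (\<lambda>a b. B a b) \<Longrightarrow> clinear f \<Longrightarrow> clinear (\<lambda>x. tensor_sum (\<lambda>a b. B a b) (f x))"
  by (rule clinear_compose[OF clinear_tensor_sum])

lemma additive_sum_list:
  assumes "f 0 = 0" "\<And>x y. f (x + y) = f x + f y"
  shows "f (\<Sum>a\<leftarrow>as. g a) = (\<Sum>a\<leftarrow>as. f (g a))"
  by (induction as) (simp_all add: assms)

lemma additive_tensor_sum:
  fixes f :: "'a::ab_group_add \<Rightarrow> 'b::ab_group_add"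
  assumes "\<And>x y. f (x + y) = f x + f y"
  shows "f (tensor_sum B t) = tensor_sum (\<lambda>x y. f (B x y)) t"
proof -
  have "f 0 = 0" by (metis add_cancel_right_right assms)
  then show ?thesis
    by (simp add: tensor_sum_def case_prod_unfold additive_sum_list assms)
qed

lemma linear_tensor_sum:
  "clinear f \<Longrightarrow> f (tensor_sum B t) = tensor_sum (\<lambda>x y. f (B x y)) t"
  by (rule additive_tensor_sum) (rule clinear_add)

lemma conjugate_linear_tensor_sum:
  "conjugate_linear f \<Longrightarrow> f (tensor_sum B t) = tensor_sum (\<lambda>x y. f (B x y)) t"
  by (rule additive_tensor_sum) (simp add: conjugate_linear_def)

lemma cnj_tensor_sum: "cnj (tensor_sum B t) = tensor_sum (\<lambda>x y. cnj (B x y)) t"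
  by (rule additive_tensor_sum) simp

lemma tensor_sum_scaleC_right:
  fixes B :: "'a::complex_vector \<Rightarrow> 'b::complex_vector \<Rightarrow> 'c::complex_vector"
  shows "c *\<^sub>C tensor_sum B t = tensor_sum (\<lambda>x y. c *\<^sub>C B x y) t"
  by (rule linear_tensor_sum[where f = "\<lambda>z. c *\<^sub>C z"]) (intro lin)

lemma tensor_sum_scaleC_left:
  fixes v :: "'c::complex_vector"
  shows "tensor_sum B t *\<^sub>C v = tensor_sum (\<lambda>x y. B x y *\<^sub>C v) t"
  by (rule linear_tensor_sum[where f = "\<lambda>z. z *\<^sub>C v"]) (intro lin)

lemma tensor_sum_mult_left: "tensor_sum B t * v = tensor_sum (\<lambda>x y. B x y * (v::complex)) t"
  by (rule linear_tensor_sum[where f = "\<lambda>z. z * v"]) (intro lin)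

lemma tensor_sum_mult_right: "(v::complex) * tensor_sum B t = tensor_sum (\<lambda>x y. v * B x y) t"
  by (rule linear_tensor_sum[where f = "\<lambda>z. v * z"]) (intro lin)

lemma sum_list_swap:
  "(\<Sum>a\<leftarrow>as. \<Sum>b\<leftarrow>bs. f a b :: 'c::ab_group_add) = (\<Sum>b\<leftarrow>bs. \<Sum>a\<leftarrow>as. f a b)"
  by (induction as) (simp_all add: sum_list_addf)

lemma tensor_sum_swap:
  "tensor_sum (\<lambda>a b. tensor_sum (\<lambda>c d. F a b c d) t) s =
   tensor_sum (\<lambda>c d. tensor_sum (\<lambda>a b. F a b c d) s) t"
  unfolding tensor_sum_def case_prod_unfold by (rule sum_list_swap)

lemma sum_tensor_sum_swap:
  "(\<Sum>i\<in>A. tensor_sum (\<lambda>a b. F i a b) t) = tensor_sum (\<lambda>a b. \<Sum>i\<in>A. F i a b) t"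
  unfolding tensor_sum_def case_prod_unfold
  by (induction A rule: infinite_finite_induct) (simp_all add: sum_list_addf)

lemma tensor_ext:
  assumes "clinear f" and "clinear g" and "\<And>x y. f (x \<otimes> y) = g (x \<otimes> y)"
  shows "f t = g t"
  by (induction t rule: tensor_induct)
    (simp_all add: assms clinear_0 clinear_add)

lemma tensor_sum_pure_tensor: "tensor_sum (\<otimes>) t = t"
  by (rule tensor_ext[where f = "tensor_sum (\<otimes>)" and g = "\<lambda>x. x"])
    (auto intro!: lin clinear_tensor_sum simp: cbilinear_pure_tensor tensor_universal_property)

section \<open>Coalgebras and convolution\<close>

locale coalgebra =
  fixes \<Delta> :: "'c::complex_vector \<Rightarrow> ('c, 'c) tensor" and \<epsilon> :: "'c \<Rightarrow> complex"
  assumes linear_comult: "clinear \<Delta>" and linear_counit: "clinear \<epsilon>"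
    and coassociative:
      "tensor_sum (\<lambda>a y. tensor_sum (\<lambda>b c. a \<otimes> b \<otimes> c) (\<Delta> y)) (\<Delta> x) =
       tensor_sum (\<lambda>y c. tensor_sum (\<lambda>a b. a \<otimes> b \<otimes> c) (\<Delta> y)) (\<Delta> x)"
    and left_counit: "tensor_sum (\<lambda>a b. \<epsilon> a *\<^sub>C b) (\<Delta> x) = x"
    and right_counit: "tensor_sum (\<lambda>a b. \<epsilon> b *\<^sub>C a) (\<Delta> x) = x"
begin

lemma lin_comult [lin]: "clinear f \<Longrightarrow> clinear (\<lambda>x. \<Delta> (f x))"
  and lin_counit [lin]: "clinear f \<Longrightarrow> clinear (\<lambda>x. \<epsilon> (f x))"
  using clinear_compose linear_comult linear_counit by blast+

text \<open>
  The axiom is the case of the universal trilinear map; any other trilinear \<open>F\<close> factors through it.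
\<close>

lemma coassoc_trilinear:
  assumes [lin]: "\<And>b c. clinear (\<lambda>a. F a b c)" "\<And>a c. clinear (\<lambda>b. F a b c)"
    "\<And>a b. clinear (\<lambda>c. F a b c)"
  shows "tensor_sum (\<lambda>y c. tensor_sum (\<lambda>a b. F a b c) (\<Delta> y)) (\<Delta> x) =
    tensor_sum (\<lambda>a y. tensor_sum (\<lambda>b c. F a b c) (\<Delta> y)) (\<Delta> x)"
proof -
  let ?L = "tensor_sum (\<lambda>a t. tensor_sum (\<lambda>b c. F a b c) t)"
  have L: "clinear ?L"
    by (intro lin clinear_tensor_sum)
  have "cbilinear (F a)" "cbilinear (\<lambda>a. tensor_sum (F a))" for a
    by (intro lin clinear_tensor_sum)+
  then have pure: "?L (a \<otimes> b \<otimes> c) = F a b c" for a b c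
    by (simp add: tensor_universal_property(2))
  show ?thesis
    using arg_cong[OF coassociative[of x], of ?L]
    by (simp add: linear_tensor_sum[OF L] pure)
qed

lemma counit_left_linear: "clinear f \<Longrightarrow> tensor_sum (\<lambda>a b. \<epsilon> a *\<^sub>C f b) (\<Delta> x) = f x"
  using linear_tensor_sum[of f "\<lambda>a b. \<epsilon> a *\<^sub>C b" "\<Delta> x"]
  by (simp add: left_counit clinear_scaleC)

lemma counit_right_linear: "clinear f \<Longrightarrow> tensor_sum (\<lambda>a b. \<epsilon> b *\<^sub>C f a) (\<Delta> x) = f x"
  using linear_tensor_sum[of f "\<lambda>a b. \<epsilon> b *\<^sub>C a" "\<Delta> x"]
  by (simp add: right_counit clinear_scaleC)

end

text \<open>
  The pairing \<open>m\<close> is arbitrary, so that one product covers functionals acting from either side on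
  vector-valued maps, maps into an algebra, and the tensor product of two maps.
\<close>

definition convolution ::
    "('c::complex_vector \<Rightarrow> ('c, 'c) tensor) \<Rightarrow> ('x \<Rightarrow> 'y \<Rightarrow> 'z::complex_vector) \<Rightarrow>
     ('c \<Rightarrow> 'x) \<Rightarrow> ('c \<Rightarrow> 'y) \<Rightarrow> 'c \<Rightarrow> 'z"
  where "convolution \<Delta> m f g x = tensor_sum (\<lambda>a b. m (f a) (g b)) (\<Delta> x)"

context coalgebra begin

lemma convolution_linear [lin]:
  assumes "cbilinear m" "clinear f" "clinear g"
  shows "clinear (convolution \<Delta> m f g)"
  unfolding convolution_def
  by (intro lin cbilinear_left[OF assms(1)] cbilinear_right[OF assms(1)] assms(2,3))

lemma convolution_assoc:
  assumes "cbilinear m" "cbilinear n" "cbilinear m'" "cbilinear n'"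
    and "clinear f" "clinear g" "clinear h"
    and "\<And>a b c. m (n a b) c = m' a (n' b c)"
  shows "convolution \<Delta> m (convolution \<Delta> n f g) h = convolution \<Delta> m' f (convolution \<Delta> n' g h)"
proof
  fix x
  have "convolution \<Delta> m (convolution \<Delta> n f g) h x =
      tensor_sum (\<lambda>y c. tensor_sum (\<lambda>a b. m (n (f a) (g b)) (h c)) (\<Delta> y)) (\<Delta> x)"
    unfolding convolution_def
    using linear_tensor_sum[OF cbilinear_left[OF assms(1) clinear_id]] by metis
  also have "\<dots> = tensor_sum (\<lambda>a y. tensor_sum (\<lambda>b c. m (n (f a) (g b)) (h c)) (\<Delta> y)) (\<Delta> x)"
    by (rule coassoc_trilinear)
      (intro cbilinear_left[OF assms(1)] cbilinear_right[OF assms(1)]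
        cbilinear_left[OF assms(2)] cbilinear_right[OF assms(2)] assms(5-7))+
  also have "\<dots> = tensor_sum (\<lambda>a y. m' (f a) (tensor_sum (\<lambda>b c. n' (g b) (h c)) (\<Delta> y))) (\<Delta> x)"
    by (simp add: assms(8) linear_tensor_sum[where f = "m' z" for z, OF cbilinear_right[OF assms(3) clinear_id]])
  finally show "convolution \<Delta> m (convolution \<Delta> n f g) h x =
      convolution \<Delta> m' f (convolution \<Delta> n' g h) x"
    by (simp add: convolution_def)
qed

end

text \<open>
  Functionals are convolved by the same operation as vector-valued maps; unfolding the scalar
  multiplication of complex numbers would separate the two cases.
\<close>

declare complex_scaleC_def [simp del]

lemma cbilinear_scaleC: "cbilinear (scaleC :: complex \<Rightarrow> 'a \<Rightarrow> 'a::complex_vector)"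
  by (intro lin)

lemma cbilinear_scaleC_flip: "cbilinear (\<lambda>(v::'a::complex_vector) c. c *\<^sub>C v)"
  by (intro lin)

definition coalgebra_map ::
    "('d::complex_vector \<Rightarrow> ('d, 'd) tensor) \<Rightarrow> ('d \<Rightarrow> complex) \<Rightarrow>
     ('c::complex_vector \<Rightarrow> ('c, 'c) tensor) \<Rightarrow> ('c \<Rightarrow> complex) \<Rightarrow> ('d \<Rightarrow> 'c) \<Rightarrow> bool"
  where "coalgebra_map \<Delta>\<^sub>1 \<epsilon>\<^sub>1 \<Delta>\<^sub>2 \<epsilon>\<^sub>2 \<theta> \<longleftrightarrow> clinear \<theta> \<and>
    (\<forall>x. \<Delta>\<^sub>2 (\<theta> x) = tensor_sum (\<lambda>a b. \<theta> a \<otimes> \<theta> b) (\<Delta>\<^sub>1 x)) \<and> (\<forall>x. \<epsilon>\<^sub>2 (\<theta> x) = \<epsilon>\<^sub>1 x)"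

lemma convolution_coalgebra_map:
  assumes "coalgebra_map \<Delta>\<^sub>1 \<epsilon>\<^sub>1 \<Delta>\<^sub>2 \<epsilon>\<^sub>2 \<theta>" and m: "cbilinear m" and f: "clinear f" and g: "clinear g"
  shows "convolution \<Delta>\<^sub>2 m f g (\<theta> x) = convolution \<Delta>\<^sub>1 m (\<lambda>x. f (\<theta> x)) (\<lambda>x. g (\<theta> x)) x"
proof -
  have B: "cbilinear (\<lambda>a b. m (f a) (g b))"
    by (intro lin cbilinear_left[OF m] cbilinear_right[OF m] f g)
  show ?thesis
    using assms(1) unfolding coalgebra_map_def convolution_def
    by (simp add: linear_tensor_sum[OF clinear_tensor_sum[OF B]] tensor_universal_property(2)[OF B])
qed

context coalgebra begin

abbreviation left_convolution :: "('c \<Rightarrow> complex) \<Rightarrow> ('c \<Rightarrow> 'z::complex_vector) \<Rightarrow> 'c \<Rightarrow> 'z"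
    (infixr "\<triangleright>" 70)
  where "f \<triangleright> g \<equiv> convolution \<Delta> (\<lambda>c v. c *\<^sub>C v) f g"

abbreviation right_convolution :: "('c \<Rightarrow> 'z::complex_vector) \<Rightarrow> ('c \<Rightarrow> complex) \<Rightarrow> 'c \<Rightarrow> 'z"
    (infixl "\<triangleleft>" 71)
  where "f \<triangleleft> g \<equiv> convolution \<Delta> (\<lambda>v c. c *\<^sub>C v) f g"

lemma counit_convolution: "clinear g \<Longrightarrow> \<epsilon> \<triangleright> g = g"
  by (rule ext) (simp add: convolution_def counit_left_linear)

lemma convolution_counit: "clinear g \<Longrightarrow> g \<triangleleft> \<epsilon> = g"
  by (rule ext) (simp add: convolution_def counit_right_linear)

lemma convolution_counit_scalar: "clinear (g :: 'c \<Rightarrow> complex) \<Longrightarrow> g \<triangleright> \<epsilon> = g"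
  using convolution_counit[of g] by (simp add: convolution_def complex_scaleC_def mult.commute)

lemma counit_right_convolution: "clinear (g :: 'c \<Rightarrow> complex) \<Longrightarrow> \<epsilon> \<triangleleft> g = g"
  using counit_convolution[of g] by (simp add: convolution_def complex_scaleC_def mult.commute)

lemma left_convolution_linear [lin]:
  fixes g :: "'c \<Rightarrow> 'z::complex_vector"
  shows "clinear f \<Longrightarrow> clinear g \<Longrightarrow> clinear (f \<triangleright> g)"
  by (intro convolution_linear lin)

lemma right_convolution_linear [lin]:
  fixes g :: "'c \<Rightarrow> 'z::complex_vector"
  shows "clinear f \<Longrightarrow> clinear g \<Longrightarrow> clinear (g \<triangleleft> f)"
  by (intro convolution_linear lin)

lemma left_left_assoc:
  fixes h :: "'c \<Rightarrow> 'z::complex_vector"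
  shows "clinear f \<Longrightarrow> clinear g \<Longrightarrow> clinear h \<Longrightarrow> (f \<triangleright> g) \<triangleright> h = f \<triangleright> g \<triangleright> h"
  by (rule convolution_assoc)
    (rule cbilinear_scaleC | assumption | simp add: scaleC_scaleC complex_scaleC_def)+

lemma left_right_assoc:
  fixes g :: "'c \<Rightarrow> 'z::complex_vector"
  shows "clinear f \<Longrightarrow> clinear g \<Longrightarrow> clinear h \<Longrightarrow> (f \<triangleright> g) \<triangleleft> h = f \<triangleright> (g \<triangleleft> h)"
  by (rule convolution_assoc)
    (rule cbilinear_scaleC cbilinear_scaleC_flip | assumption |
      simp add: scaleC_scaleC complex_scaleC_def mult.commute)+

lemma right_right_assoc:
  fixes f :: "'c \<Rightarrow> 'z::complex_vector"
  shows "clinear f \<Longrightarrow> clinear g \<Longrightarrow> clinear h \<Longrightarrow> f \<triangleleft> g \<triangleleft> h = f \<triangleleft> (g \<triangleright> h)"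
  by (rule convolution_assoc)
    (rule cbilinear_scaleC cbilinear_scaleC_flip | assumption |
      simp add: scaleC_scaleC complex_scaleC_def mult.commute)+

definition inverses :: "('c \<Rightarrow> complex) \<Rightarrow> ('c \<Rightarrow> complex) \<Rightarrow> bool"
  where "inverses f g \<longleftrightarrow> clinear f \<and> clinear g \<and> f \<triangleright> g = \<epsilon> \<and> g \<triangleright> f = \<epsilon>"

lemma inverses_unique:
  assumes "inverses f g" and "inverses f h"
  shows "g = h"
proof -
  have "g = g \<triangleright> (f \<triangleright> h)"
    using assms by (simp add: inverses_def convolution_counit_scalar)
  also have "\<dots> = (g \<triangleright> f) \<triangleright> h"
    by (rule left_left_assoc[symmetric]) (use assms in \<open>auto simp: inverses_def\<close>)
  also have "\<dots> = h"
    using assms by (simp add: inverses_def counit_convolution)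
  finally show ?thesis .
qed

lemma inverses_convolution:
  assumes "inverses f f'" and "inverses g g'"
  shows "inverses (f \<triangleright> g) (g' \<triangleright> f')"
proof -
  note l = assms[unfolded inverses_def]
  then have l': "clinear f" "clinear f'" "clinear g" "clinear g'"
    by auto
  have "(f \<triangleright> g) \<triangleright> (g' \<triangleright> f') = f \<triangleright> (g \<triangleright> g') \<triangleright> f'"
    by (simp only: left_left_assoc left_convolution_linear l')
  moreover have "(g' \<triangleright> f') \<triangleright> (f \<triangleright> g) = g' \<triangleright> (f' \<triangleright> f) \<triangleright> g"
    by (simp only: left_left_assoc left_convolution_linear l')
  ultimately show ?thesis
    using l by (simp add: inverses_def counit_convolution left_convolution_linear)
qed

text \<open>
  Identities about the antipode are proved with this lemma: the two sides invert the same map.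
\<close>

lemma convolution_inverse_eq:
  fixes m :: "'z::complex_vector \<Rightarrow> 'z \<Rightarrow> 'z"
  assumes m: "cbilinear m" "\<And>a b c. m (m a b) c = m a (m b c)" "\<And>a. m e a = a" "\<And>a. m a e = a"
    and lin: "clinear l" "clinear f" "clinear r"
    and l: "\<And>x. convolution \<Delta> m l f x = \<epsilon> x *\<^sub>C e" and r: "\<And>x. convolution \<Delta> m f r x = \<epsilon> x *\<^sub>C e"
  shows "l x = r x"
proof -
  have me: "m (c *\<^sub>C e) a = c *\<^sub>C a" "m a (c *\<^sub>C e) = c *\<^sub>C a" for c a
    using m by (simp_all add: cbilinear_def clinear_iff)
  have "l = convolution \<Delta> m l (convolution \<Delta> m f r)"
    by (rule ext) (simp add: convolution_def r[unfolded convolution_def] me counit_right_linear lin)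
  also have "\<dots> = convolution \<Delta> m (convolution \<Delta> m l f) r"
    by (rule convolution_assoc[symmetric]) (use m lin in auto)
  also have "\<dots> = r"
    by (rule ext) (simp add: convolution_def l[unfolded convolution_def] me counit_left_linear lin)
  finally show ?thesis
    by simp
qed

text \<open>
  If \<open>f'\<close> is the convolution inverse of \<open>f\<close>, this is the conjugate $f \star \theta \star f^{-1}$. The twisted
  product is the conjugate of the multiplication by the cocycle.
\<close>

definition conjugated :: "('c \<Rightarrow> complex) \<Rightarrow> ('c \<Rightarrow> complex) \<Rightarrow> ('c \<Rightarrow> 'z::complex_vector) \<Rightarrow> 'c \<Rightarrow> 'z"
  where "conjugated f f' \<theta> = f \<triangleright> (\<theta> \<triangleleft> f')"

lemma conjugated_linear [lin]:
  fixes \<theta> :: "'c \<Rightarrow> 'z::complex_vector"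
  shows "clinear f \<Longrightarrow> clinear f' \<Longrightarrow> clinear \<theta> \<Longrightarrow> clinear (conjugated f f' \<theta>)"
  unfolding conjugated_def by (intro lin)

lemma conjugated_compose_linear:
  fixes \<theta> :: "'c \<Rightarrow> 'z::complex_vector" and h :: "'z \<Rightarrow> 'y::complex_vector"
  assumes "clinear h"
  shows "h (conjugated f f' \<theta> x) = conjugated f f' (\<lambda>x. h (\<theta> x)) x"
  by (simp add: conjugated_def convolution_def linear_tensor_sum[OF assms] clinear_scaleC[OF assms])

lemma conjugated_conjugated:
  fixes \<theta> :: "'c \<Rightarrow> 'z::complex_vector"
  assumes l: "clinear f" "clinear f'" "clinear g" "clinear g'" "clinear \<theta>"
  shows "conjugated f f' (conjugated g g' \<theta>) = conjugated (f \<triangleright> g) (g' \<triangleright> f') \<theta>"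
proof -
  have "f \<triangleright> ((g \<triangleright> (\<theta> \<triangleleft> g')) \<triangleleft> f') = f \<triangleright> (g \<triangleright> ((\<theta> \<triangleleft> g') \<triangleleft> f'))"
    using l by (subst left_right_assoc) (auto intro: lin)
  also have "\<dots> = (f \<triangleright> g) \<triangleright> (\<theta> \<triangleleft> (g' \<triangleright> f'))"
    using l by (subst left_left_assoc) (auto intro: lin simp: right_right_assoc)
  finally show ?thesis
    by (simp add: conjugated_def)
qed

end

lemma conjugated_coalgebra_map:
  fixes \<Delta>\<^sub>1 :: "'d::complex_vector \<Rightarrow> ('d, 'd) tensor" and \<Delta>\<^sub>2 :: "'c::complex_vector \<Rightarrow> ('c, 'c) tensor"
    and h :: "'c \<Rightarrow> 'z::complex_vector"
  assumes "coalgebra \<Delta>\<^sub>1 \<epsilon>\<^sub>1" "coalgebra \<Delta>\<^sub>2 \<epsilon>\<^sub>2" and map: "coalgebra_map \<Delta>\<^sub>1 \<epsilon>\<^sub>1 \<Delta>\<^sub>2 \<epsilon>\<^sub>2 \<theta>"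
    and l: "clinear f" "clinear f'" "clinear h"
  shows "coalgebra.conjugated \<Delta>\<^sub>2 f f' h (\<theta> x) =
    coalgebra.conjugated \<Delta>\<^sub>1 (\<lambda>x. f (\<theta> x)) (\<lambda>x. f' (\<theta> x)) (\<lambda>x. h (\<theta> x)) x"
proof -
  interpret D: coalgebra \<Delta>\<^sub>1 \<epsilon>\<^sub>1 by fact
  interpret C: coalgebra \<Delta>\<^sub>2 \<epsilon>\<^sub>2 by fact
  show ?thesis
    unfolding C.conjugated_def D.conjugated_def
    by (simp add: convolution_coalgebra_map[OF map] cbilinear_scaleC cbilinear_scaleC_flip l lin)
qed

lemma inverses_coalgebra_map:
  assumes "coalgebra \<Delta>\<^sub>1 \<epsilon>\<^sub>1" "coalgebra \<Delta>\<^sub>2 \<epsilon>\<^sub>2" and map: "coalgebra_map \<Delta>\<^sub>1 \<epsilon>\<^sub>1 \<Delta>\<^sub>2 \<epsilon>\<^sub>2 \<theta>"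
    and "coalgebra.inverses \<Delta>\<^sub>2 \<epsilon>\<^sub>2 f f'"
  shows "coalgebra.inverses \<Delta>\<^sub>1 \<epsilon>\<^sub>1 (\<lambda>x. f (\<theta> x)) (\<lambda>x. f' (\<theta> x))"
proof -
  interpret D: coalgebra \<Delta>\<^sub>1 \<epsilon>\<^sub>1 by fact
  interpret C: coalgebra \<Delta>\<^sub>2 \<epsilon>\<^sub>2 by fact
  have f: "clinear f" "clinear f'" "convolution \<Delta>\<^sub>2 scaleC f f' = \<epsilon>\<^sub>2" "convolution \<Delta>\<^sub>2 scaleC f' f = \<epsilon>\<^sub>2"
    and \<theta>: "clinear \<theta>" "\<And>x. \<epsilon>\<^sub>2 (\<theta> x) = \<epsilon>\<^sub>1 x"
    using map assms(4) by (auto simp: C.inverses_def coalgebra_map_def)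
  show ?thesis
    unfolding D.inverses_def
    using convolution_coalgebra_map[OF map cbilinear_scaleC f(1,2)]
      convolution_coalgebra_map[OF map cbilinear_scaleC f(2,1)]
    by (auto simp: f \<theta> intro: clinear_compose[OF _ \<theta>(1)])
qed

text \<open>
  In $(f \star \theta \star f') \otimes (f \star \theta \star f')$ the factor $f' \star f$ between the two copies
  of $\theta$ cancels.
\<close>

lemma coalgebra_map_conjugated:
  assumes "coalgebra \<Delta>\<^sub>1 \<epsilon>\<^sub>1" "coalgebra \<Delta>\<^sub>2 \<epsilon>\<^sub>2" and map: "coalgebra_map \<Delta>\<^sub>1 \<epsilon>\<^sub>1 \<Delta>\<^sub>2 \<epsilon>\<^sub>2 \<theta>"
    and inv: "coalgebra.inverses \<Delta>\<^sub>1 \<epsilon>\<^sub>1 f f'"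
  shows "coalgebra_map \<Delta>\<^sub>1 \<epsilon>\<^sub>1 \<Delta>\<^sub>2 \<epsilon>\<^sub>2 (coalgebra.conjugated \<Delta>\<^sub>1 f f' \<theta>)"
proof -
  interpret D: coalgebra \<Delta>\<^sub>1 \<epsilon>\<^sub>1 by fact
  interpret C: coalgebra \<Delta>\<^sub>2 \<epsilon>\<^sub>2 by fact
  let ?c = "D.conjugated f f' \<theta>"
  have f: "clinear f" "clinear f'" "convolution \<Delta>\<^sub>1 (\<lambda>c v. c *\<^sub>C v) f f' = \<epsilon>\<^sub>1" "convolution \<Delta>\<^sub>1 (\<lambda>c v. c *\<^sub>C v) f' f = \<epsilon>\<^sub>1"
    and \<theta>: "clinear \<theta>" "\<And>x. \<epsilon>\<^sub>2 (\<theta> x) = \<epsilon>\<^sub>1 x"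
      "\<And>x. \<Delta>\<^sub>2 (\<theta> x) = convolution \<Delta>\<^sub>1 (\<otimes>) \<theta> \<theta> x"
    using map inv by (auto simp: D.inverses_def coalgebra_map_def convolution_def)
  note bil = cbilinear_pure_tensor cbilinear_scaleC cbilinear_scaleC_flip
  note pt = clinear_scaleC[OF clinear_pure_left[OF clinear_id]]
    clinear_scaleC[OF clinear_pure_right[OF clinear_id]]
  note ls = f(1,2) \<theta>(1) lin bil
  have c: "clinear ?c"
    by (intro ls)
  have "convolution \<Delta>\<^sub>1 (\<otimes>) ?c ?c =
      convolution \<Delta>\<^sub>1 (\<lambda>c v. c *\<^sub>C v) f (convolution \<Delta>\<^sub>1 (\<otimes>) (convolution \<Delta>\<^sub>1 (\<lambda>v c. c *\<^sub>C v) \<theta> f') ?c)"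
    unfolding D.conjugated_def by (rule D.convolution_assoc) (intro ls | simp add: pt)+
  also have "convolution \<Delta>\<^sub>1 (\<otimes>) (convolution \<Delta>\<^sub>1 (\<lambda>v c. c *\<^sub>C v) \<theta> f') ?c =
      convolution \<Delta>\<^sub>1 (\<otimes>) \<theta> (convolution \<Delta>\<^sub>1 (\<lambda>c v. c *\<^sub>C v) f' ?c)"
    by (rule D.convolution_assoc) (intro ls | simp add: pt)+
  also have "convolution \<Delta>\<^sub>1 (\<lambda>c v. c *\<^sub>C v) f' ?c = convolution \<Delta>\<^sub>1 (\<lambda>v c. c *\<^sub>C v) \<theta> f'"
    unfolding D.conjugated_def
    by (subst D.left_left_assoc[symmetric]) (auto intro!: ls D.counit_convolution simp: f(4))
  also have "convolution \<Delta>\<^sub>1 (\<otimes>) \<theta> (convolution \<Delta>\<^sub>1 (\<lambda>v c. c *\<^sub>C v) \<theta> f') =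
      convolution \<Delta>\<^sub>1 (\<lambda>v c. c *\<^sub>C v) (convolution \<Delta>\<^sub>1 (\<otimes>) \<theta> \<theta>) f'"
    by (rule D.convolution_assoc[symmetric]) (intro ls | simp add: pt)+
  finally have "convolution \<Delta>\<^sub>1 (\<otimes>) ?c ?c = D.conjugated f f' (\<lambda>x. \<Delta>\<^sub>2 (\<theta> x))"
    by (simp add: D.conjugated_def \<theta>(3)[abs_def])
  then have "\<Delta>\<^sub>2 (?c x) = convolution \<Delta>\<^sub>1 (\<otimes>) ?c ?c x" for x
    by (simp add: D.conjugated_compose_linear[OF C.linear_comult])
  moreover have "\<epsilon>\<^sub>2 (?c x) = \<epsilon>\<^sub>1 x" for x
    by (simp add: D.conjugated_compose_linear[OF C.linear_counit] \<theta>(2))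
      (simp add: D.conjugated_def D.counit_right_convolution f)
  ultimately show ?thesis
    using c by (simp add: coalgebra_map_def convolution_def)
qed

text \<open>
  This is what makes associativity accessible: a product of products becomes a single conjugation, and
  only the conjugating functionals have to be compared.
\<close>

lemma conjugated_compose:
  fixes \<Delta>\<^sub>1 :: "'d::complex_vector \<Rightarrow> ('d, 'd) tensor" and \<Delta>\<^sub>2 :: "'c::complex_vector \<Rightarrow> ('c, 'c) tensor"
    and h :: "'c \<Rightarrow> 'z::complex_vector"
  assumes "coalgebra \<Delta>\<^sub>1 \<epsilon>\<^sub>1" "coalgebra \<Delta>\<^sub>2 \<epsilon>\<^sub>2" and map: "coalgebra_map \<Delta>\<^sub>1 \<epsilon>\<^sub>1 \<Delta>\<^sub>2 \<epsilon>\<^sub>2 \<theta>"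
    and l: "clinear f" "clinear f'" "clinear g" "clinear g'" "clinear h"
  shows "coalgebra.conjugated \<Delta>\<^sub>2 f f' h (coalgebra.conjugated \<Delta>\<^sub>1 g g' \<theta> x) =
    coalgebra.conjugated \<Delta>\<^sub>1 (convolution \<Delta>\<^sub>1 (\<lambda>c v. c *\<^sub>C v) g (\<lambda>x. f (\<theta> x)))
      (convolution \<Delta>\<^sub>1 (\<lambda>c v. c *\<^sub>C v) (\<lambda>x. f' (\<theta> x)) g') (\<lambda>x. h (\<theta> x)) x"
proof -
  interpret D: coalgebra \<Delta>\<^sub>1 \<epsilon>\<^sub>1 by fact
  interpret C: coalgebra \<Delta>\<^sub>2 \<epsilon>\<^sub>2 by fact
  have \<theta>: "clinear \<theta>"
    using map by (simp add: coalgebra_map_def)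
  show ?thesis
    using l \<theta>
    by (simp add: D.conjugated_compose_linear lin conjugated_coalgebra_map[OF assms(1-3)]
        D.conjugated_conjugated clinear_compose[OF _ \<theta>])
qed

section \<open>Tensor products of coalgebras and of algebras\<close>

definition tensor_comult ::
    "('a::complex_vector \<Rightarrow> ('a, 'a) tensor) \<Rightarrow> ('b::complex_vector \<Rightarrow> ('b, 'b) tensor) \<Rightarrow>
     ('a, 'b) tensor \<Rightarrow> (('a, 'b) tensor, ('a, 'b) tensor) tensor"
  where "tensor_comult \<Delta>\<^sub>1 \<Delta>\<^sub>2 = tensor_sum (\<lambda>x y.
    tensor_sum (\<lambda>a b. tensor_sum (\<lambda>c d. (a \<otimes> c) \<otimes> (b \<otimes> d)) (\<Delta>\<^sub>2 y)) (\<Delta>\<^sub>1 x))"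

definition tensor_counit ::
    "('a::complex_vector \<Rightarrow> complex) \<Rightarrow> ('b::complex_vector \<Rightarrow> complex) \<Rightarrow> ('a, 'b) tensor \<Rightarrow> complex"
  where "tensor_counit \<epsilon>\<^sub>1 \<epsilon>\<^sub>2 = tensor_sum (\<lambda>x y. \<epsilon>\<^sub>1 x * \<epsilon>\<^sub>2 y)"

locale coalgebra_pair = L: coalgebra \<Delta>\<^sub>1 \<epsilon>\<^sub>1 + R: coalgebra \<Delta>\<^sub>2 \<epsilon>\<^sub>2
  for \<Delta>\<^sub>1 :: "'a::complex_vector \<Rightarrow> ('a, 'a) tensor" and \<epsilon>\<^sub>1
    and \<Delta>\<^sub>2 :: "'b::complex_vector \<Rightarrow> ('b, 'b) tensor" and \<epsilon>\<^sub>2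
begin

lemma linear_tensor_comult: "clinear (tensor_comult \<Delta>\<^sub>1 \<Delta>\<^sub>2)"
  unfolding tensor_comult_def by (intro lin clinear_tensor_sum)

lemma linear_tensor_counit: "clinear (tensor_counit \<epsilon>\<^sub>1 \<epsilon>\<^sub>2)"
  unfolding tensor_counit_def
  by (intro lin clinear_tensor_sum L.linear_counit R.linear_counit)

lemma tensor_counit_pure: "tensor_counit \<epsilon>\<^sub>1 \<epsilon>\<^sub>2 (x \<otimes> y) = \<epsilon>\<^sub>1 x * \<epsilon>\<^sub>2 y"
  unfolding tensor_counit_def
  by (rule tensor_universal_property(2)) (intro lin)

lemma tensor_comult_sum:
  assumes B: "cbilinear B"
  shows "tensor_sum B (tensor_comult \<Delta>\<^sub>1 \<Delta>\<^sub>2 (x \<otimes> y)) =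
    tensor_sum (\<lambda>a b. tensor_sum (\<lambda>c d. B (a \<otimes> c) (b \<otimes> d)) (\<Delta>\<^sub>2 y)) (\<Delta>\<^sub>1 x)"
proof -
  have *: "tensor_comult \<Delta>\<^sub>1 \<Delta>\<^sub>2 (x \<otimes> y) =
      tensor_sum (\<lambda>a b. tensor_sum (\<lambda>c d. (a \<otimes> c) \<otimes> (b \<otimes> d)) (\<Delta>\<^sub>2 y)) (\<Delta>\<^sub>1 x)"
    unfolding tensor_comult_def by (rule tensor_universal_property(2)) (intro lin)
  show ?thesis
    by (simp add: * linear_tensor_sum[OF clinear_tensor_sum[OF B]] tensor_universal_property(2)[OF B])
qed

lemma coalgebra_tensor: "coalgebra (tensor_comult \<Delta>\<^sub>1 \<Delta>\<^sub>2) (tensor_counit \<epsilon>\<^sub>1 \<epsilon>\<^sub>2)"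
proof (rule coalgebra.intro)
  let ?D = "tensor_comult \<Delta>\<^sub>1 \<Delta>\<^sub>2" and ?e = "tensor_counit \<epsilon>\<^sub>1 \<epsilon>\<^sub>2"
  note ls = lin clinear_compose[OF linear_tensor_comult] clinear_compose[OF linear_tensor_counit]
  show "clinear ?D" "clinear ?e"
    by (rule linear_tensor_comult linear_tensor_counit)+
  fix t
  show "tensor_sum (\<lambda>a y. tensor_sum (\<lambda>b c. a \<otimes> b \<otimes> c) (?D y)) (?D t) =
    tensor_sum (\<lambda>y c. tensor_sum (\<lambda>a b. a \<otimes> b \<otimes> c) (?D y)) (?D t)"
  proof (rule tensor_ext[where t = t])
    show "clinear (\<lambda>t. tensor_sum (\<lambda>a y. tensor_sum (\<lambda>b c. a \<otimes> b \<otimes> c) (?D y)) (?D t))"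
      "clinear (\<lambda>t. tensor_sum (\<lambda>y c. tensor_sum (\<lambda>a b. a \<otimes> b \<otimes> c) (?D y)) (?D t))"
      by (intro ls)+
    fix x y
    let ?F = "\<lambda>a b c a' b' c'. (a \<otimes> a') \<otimes> (b \<otimes> b') \<otimes> (c \<otimes> c')"
    have outer1: "tensor_sum (\<lambda>a y. tensor_sum (\<lambda>b c. a \<otimes> b \<otimes> c) (?D y)) (?D (x \<otimes> y)) =
      tensor_sum (\<lambda>a b. tensor_sum (\<lambda>a' b'. tensor_sum (\<lambda>u v. (a \<otimes> a') \<otimes> u \<otimes> v) (?D (b \<otimes> b'))) (\<Delta>\<^sub>2 y)) (\<Delta>\<^sub>1 x)"
      by (rule tensor_comult_sum) (intro ls)
    have outer2: "tensor_sum (\<lambda>y c. tensor_sum (\<lambda>a b. a \<otimes> b \<otimes> c) (?D y)) (?D (x \<otimes> y)) =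
      tensor_sum (\<lambda>b c. tensor_sum (\<lambda>b' c'. tensor_sum (\<lambda>u v. u \<otimes> v \<otimes> (c \<otimes> c')) (?D (b \<otimes> b'))) (\<Delta>\<^sub>2 y)) (\<Delta>\<^sub>1 x)"
      by (rule tensor_comult_sum) (intro ls)
    have inner1: "tensor_sum (\<lambda>u v. w \<otimes> u \<otimes> v) (?D (b \<otimes> b')) =
      tensor_sum (\<lambda>b c. tensor_sum (\<lambda>b' c'. w \<otimes> (b \<otimes> b') \<otimes> (c \<otimes> c')) (\<Delta>\<^sub>2 b')) (\<Delta>\<^sub>1 b)" for w b b'
      by (rule tensor_comult_sum) (intro ls)
    have inner2: "tensor_sum (\<lambda>u v. u \<otimes> v \<otimes> w) (?D (b \<otimes> b')) =
      tensor_sum (\<lambda>b c. tensor_sum (\<lambda>b' c'. (b \<otimes> b') \<otimes> (c \<otimes> c') \<otimes> w) (\<Delta>\<^sub>2 b')) (\<Delta>\<^sub>1 b)" for w b b'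
      by (rule tensor_comult_sum) (intro ls)
    have inner3: "tensor_sum (\<lambda>b' c'. tensor_sum (\<lambda>a' b'. ?F a b c a' b' c') (\<Delta>\<^sub>2 b')) (\<Delta>\<^sub>2 y) =
      tensor_sum (\<lambda>a' b'. tensor_sum (\<lambda>b' c'. ?F a b c a' b' c') (\<Delta>\<^sub>2 b')) (\<Delta>\<^sub>2 y)" for a b c
      by (rule R.coassoc_trilinear) (intro lin)+
    have "tensor_sum (\<lambda>a y. tensor_sum (\<lambda>b c. a \<otimes> b \<otimes> c) (?D y)) (?D (x \<otimes> y)) =
      tensor_sum (\<lambda>a b. tensor_sum (\<lambda>a' b'. tensor_sum (\<lambda>b c. tensor_sum (\<lambda>b' c'.
        ?F a b c a' b' c') (\<Delta>\<^sub>2 b')) (\<Delta>\<^sub>1 b)) (\<Delta>\<^sub>2 y)) (\<Delta>\<^sub>1 x)"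
      unfolding outer1 inner1 ..
    also have "\<dots> = tensor_sum (\<lambda>a b. tensor_sum (\<lambda>b c. tensor_sum (\<lambda>a' b'. tensor_sum (\<lambda>b' c'.
        ?F a b c a' b' c') (\<Delta>\<^sub>2 b')) (\<Delta>\<^sub>2 y)) (\<Delta>\<^sub>1 b)) (\<Delta>\<^sub>1 x)"
      by (simp only: tensor_sum_swap[of _ "\<Delta>\<^sub>2 _" "\<Delta>\<^sub>1 _"])
    also have "\<dots> = tensor_sum (\<lambda>b c. tensor_sum (\<lambda>a b. tensor_sum (\<lambda>a' b'. tensor_sum (\<lambda>b' c'.
        ?F a b c a' b' c') (\<Delta>\<^sub>2 b')) (\<Delta>\<^sub>2 y)) (\<Delta>\<^sub>1 b)) (\<Delta>\<^sub>1 x)"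
      by (rule L.coassoc_trilinear[symmetric]) (intro lin)+
    also have "\<dots> = tensor_sum (\<lambda>b c. tensor_sum (\<lambda>a b. tensor_sum (\<lambda>b' c'. tensor_sum (\<lambda>a' b'.
        ?F a b c a' b' c') (\<Delta>\<^sub>2 b')) (\<Delta>\<^sub>2 y)) (\<Delta>\<^sub>1 b)) (\<Delta>\<^sub>1 x)"
      by (simp only: inner3)
    also have "\<dots> = tensor_sum (\<lambda>b c. tensor_sum (\<lambda>b' c'. tensor_sum (\<lambda>a b. tensor_sum (\<lambda>a' b'.
        ?F a b c a' b' c') (\<Delta>\<^sub>2 b')) (\<Delta>\<^sub>1 b)) (\<Delta>\<^sub>2 y)) (\<Delta>\<^sub>1 x)"
      by (simp only: tensor_sum_swap[of "\<lambda>b' c' a b. tensor_sum (\<lambda>a' b'. ?F a b c a' b' c') (\<Delta>\<^sub>2 b')" for c])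
    also have "\<dots> = tensor_sum (\<lambda>y c. tensor_sum (\<lambda>a b. a \<otimes> b \<otimes> c) (?D y)) (?D (x \<otimes> y))"
      unfolding outer2 inner2 ..
    finally show "tensor_sum (\<lambda>a y. tensor_sum (\<lambda>b c. a \<otimes> b \<otimes> c) (?D y)) (?D (x \<otimes> y)) =
      tensor_sum (\<lambda>y c. tensor_sum (\<lambda>a b. a \<otimes> b \<otimes> c) (?D y)) (?D (x \<otimes> y))" .
  qed
  show "tensor_sum (\<lambda>a b. ?e a *\<^sub>C b) (?D t) = t"
  proof (rule tensor_ext[where t = t])
    show "clinear (\<lambda>t. tensor_sum (\<lambda>a b. ?e a *\<^sub>C b) (?D t))" "clinear (\<lambda>t. t)"
      by (intro ls)+
    fix x y
    have "tensor_sum (\<lambda>a b. ?e a *\<^sub>C b) (?D (x \<otimes> y)) =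
        tensor_sum (\<lambda>a b. \<epsilon>\<^sub>1 a *\<^sub>C tensor_sum (\<lambda>c d. \<epsilon>\<^sub>2 c *\<^sub>C (b \<otimes> d)) (\<Delta>\<^sub>2 y)) (\<Delta>\<^sub>1 x)"
      by (subst tensor_comult_sum, intro ls)
        (simp add: tensor_counit_pure tensor_sum_scaleC_right scaleC_scaleC)
    then show "tensor_sum (\<lambda>a b. ?e a *\<^sub>C b) (?D (x \<otimes> y)) = x \<otimes> y"
      by (simp add: R.counit_left_linear[OF clinear_pure_right[OF clinear_id]]
          L.counit_left_linear[OF clinear_pure_left[OF clinear_id]])
  qed
  show "tensor_sum (\<lambda>a b. ?e b *\<^sub>C a) (?D t) = t"
  proof (rule tensor_ext[where t = t])
    show "clinear (\<lambda>t. tensor_sum (\<lambda>a b. ?e b *\<^sub>C a) (?D t))" "clinear (\<lambda>t. t)"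
      by (intro ls)+
    fix x y
    have "tensor_sum (\<lambda>a b. ?e b *\<^sub>C a) (?D (x \<otimes> y)) =
        tensor_sum (\<lambda>a b. \<epsilon>\<^sub>1 b *\<^sub>C tensor_sum (\<lambda>c d. \<epsilon>\<^sub>2 d *\<^sub>C (a \<otimes> c)) (\<Delta>\<^sub>2 y)) (\<Delta>\<^sub>1 x)"
      by (subst tensor_comult_sum, intro ls)
        (simp add: tensor_counit_pure tensor_sum_scaleC_right scaleC_scaleC)
    then show "tensor_sum (\<lambda>a b. ?e b *\<^sub>C a) (?D (x \<otimes> y)) = x \<otimes> y"
      by (simp add: R.counit_right_linear[OF clinear_pure_right[OF clinear_id]]
          L.counit_right_linear[OF clinear_pure_left[OF clinear_id]])
  qed
qed

end

definition tensor_mult ::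
    "('a::complex_vector \<Rightarrow> 'a \<Rightarrow> 'a) \<Rightarrow> ('b::complex_vector \<Rightarrow> 'b \<Rightarrow> 'b) \<Rightarrow>
     ('a, 'b) tensor \<Rightarrow> ('a, 'b) tensor \<Rightarrow> ('a, 'b) tensor"
  where "tensor_mult m n s t =
    tensor_sum (\<lambda>a b. tensor_sum (\<lambda>c d. m a c \<otimes> n b d) t) s"

context
  fixes m :: "'a::complex_vector \<Rightarrow> 'a \<Rightarrow> 'a" and n :: "'b::complex_vector \<Rightarrow> 'b \<Rightarrow> 'b"
  assumes m: "cbilinear m" and n: "cbilinear n"
begin

lemma cbilinear_tensor_mult: "cbilinear (tensor_mult m n)"
  unfolding tensor_mult_def
  by (intro lin cbilinear_left[OF m] cbilinear_right[OF m] cbilinear_left[OF n] cbilinear_right[OF n]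
      clinear_tensor_sum)

lemma tensor_mult_pure: "tensor_mult m n (a \<otimes> b) (c \<otimes> d) = m a c \<otimes> n b d"
  unfolding tensor_mult_def
  by (subst tensor_universal_property(2), intro lin cbilinear_left[OF m] cbilinear_right[OF m]
      cbilinear_left[OF n] cbilinear_right[OF n])
    (rule tensor_universal_property(2), intro lin cbilinear_left[OF m] cbilinear_right[OF m]
      cbilinear_left[OF n] cbilinear_right[OF n])

lemma tensor_mult_assoc:
  assumes "\<And>x y z. m (m x y) z = m x (m y z)" and "\<And>x y z. n (n x y) z = n x (n y z)"
  shows "tensor_mult m n (tensor_mult m n r s) t = tensor_mult m n r (tensor_mult m n s t)"
proof -
  note B = cbilinear_left[OF cbilinear_tensor_mult] cbilinear_right[OF cbilinear_tensor_mult]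
  have 1: "tensor_mult m n (tensor_mult m n (a \<otimes> b) (c \<otimes> d)) t =
      tensor_mult m n (a \<otimes> b) (tensor_mult m n (c \<otimes> d) t)" for a b c d t
    by (rule tensor_ext[where t = t]) (intro B lin | simp add: tensor_mult_pure assms)+
  have 2: "tensor_mult m n (tensor_mult m n (a \<otimes> b) s) t =
      tensor_mult m n (a \<otimes> b) (tensor_mult m n s t)" for a b s t
    by (rule tensor_ext[where t = s]) (intro B lin | simp add: 1)+
  show ?thesis
    by (rule tensor_ext[where t = r]) (intro B lin | simp add: 2)+
qed

lemma tensor_mult_unit:
  assumes "\<And>x. m e x = x" and "\<And>x. n e' x = x"
  shows "tensor_mult m n (e \<otimes> e') t = t"
  by (rule tensor_ext[where t = t])
    (intro cbilinear_right[OF cbilinear_tensor_mult] lin | simp add: tensor_mult_pure assms)+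

lemma tensor_unit_mult:
  assumes "\<And>x. m x e = x" and "\<And>x. n x e' = x"
  shows "tensor_mult m n t (e \<otimes> e') = t"
  by (rule tensor_ext[where t = t])
    (intro cbilinear_left[OF cbilinear_tensor_mult] lin | simp add: tensor_mult_pure assms)+

end

section \<open>Hopf algebras and their antipodes\<close>

sublocale hopf_algebra \<subseteq> coalgebra "comult H" "counit H"
  by (rule coalgebra.intro)
    (use comult_linear counit_linear coassoc counit_left counit_right in \<open>auto simp: sweedler2_def\<close>)

sublocale hopf_algebra \<subseteq> pair: coalgebra_pair "comult H" "counit H" "comult H" "counit H" ..

sublocale hopf_algebra \<subseteq> square: coalgebra "tensor_comult (comult H) (comult H)"
    "tensor_counit (counit H) (counit H)"
  by (rule pair.coalgebra_tensor)

context hopf_algebra begin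

abbreviation sw where "sw \<equiv> sweedler2 H"
abbreviation sw3 where "sw3 \<equiv> sweedler3 H"

abbreviation mult_infix (infixl "\<cdot>" 73) where "x \<cdot> y \<equiv> hmult H x y"

abbreviation antip ("\<S>") where "\<S> \<equiv> antipode H"

lemma lin_mult_left [lin]: "clinear f \<Longrightarrow> clinear (\<lambda>x. f x \<cdot> y)"
  by (rule cbilinear_left[OF mult_bilinear])

lemma lin_mult_right [lin]: "clinear f \<Longrightarrow> clinear (\<lambda>x. y \<cdot> f x)"
  by (rule cbilinear_right[OF mult_bilinear])

lemma lin_antipode [lin]: "clinear f \<Longrightarrow> clinear (\<lambda>x. \<S> (f x))"
  by (rule clinear_compose[OF antipode_linear])

lemma lin_sweedler_fun [lin]:
  "(\<And>a b. clinear (\<lambda>x. F x a b)) \<Longrightarrow> clinear (\<lambda>x. sw (\<lambda>a b. F x a b) y)"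
  unfolding sweedler2_def by (rule clinear_tensor_sum_fun)

lemma lin_sweedler [lin]:
  "cbilinear (\<lambda>a b. F a b) \<Longrightarrow> clinear f \<Longrightarrow> clinear (\<lambda>x. sw (\<lambda>a b. F a b) (f x))"
  unfolding sweedler2_def by (rule clinear_tensor_sum_arg[OF _ lin_comult])

lemma sweedler2_cong: "(\<And>a b. F a b = G a b) \<Longrightarrow> sw F x = sw G x"
  by (rule arg_cong[where f = "\<lambda>F. sw F x"]) (intro ext)

lemma mult_scaleC_left: "(c *\<^sub>C x) \<cdot> y = c *\<^sub>C (x \<cdot> y)"
  by (rule clinear_scaleC) (intro lin)

lemma mult_scaleC_right: "x \<cdot> (c *\<^sub>C y) = c *\<^sub>C (x \<cdot> y)"
  by (rule clinear_scaleC) (intro lin)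

lemma sweedler2_linear: "clinear f \<Longrightarrow> f (sw F x) = sw (\<lambda>a b. f (F a b)) x"
  unfolding sweedler2_def by (rule linear_tensor_sum)

lemma sweedler2_mult_left: "sw F x \<cdot> y = sw (\<lambda>a b. F a b \<cdot> y) x"
  by (rule sweedler2_linear) (intro lin)

lemma sweedler2_mult_right: "y \<cdot> sw F x = sw (\<lambda>a b. y \<cdot> F a b) x"
  by (rule sweedler2_linear) (intro lin)

lemma sweedler2_scaleC_right:
  fixes F :: "'a \<Rightarrow> 'a \<Rightarrow> 'b::complex_vector"
  shows "c *\<^sub>C sw F x = sw (\<lambda>a b. c *\<^sub>C F a b) x"
  unfolding sweedler2_def by (rule tensor_sum_scaleC_right)

lemma sweedler2_scaleC_left:
  fixes v :: "'b::complex_vector"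
  shows "sw F x *\<^sub>C v = sw (\<lambda>a b. F a b *\<^sub>C v) x"
  unfolding sweedler2_def by (rule tensor_sum_scaleC_left)

lemma sweedler2_complex_left: "sw F x * v = sw (\<lambda>a b. F a b * (v::complex)) x"
  unfolding sweedler2_def by (rule tensor_sum_mult_left)

lemma sweedler2_complex_right: "(v::complex) * sw F x = sw (\<lambda>a b. v * F a b) x"
  unfolding sweedler2_def by (rule tensor_sum_mult_right)

lemmas sweedler2_out = sweedler2_mult_left sweedler2_mult_right sweedler2_scaleC_right
  sweedler2_scaleC_left sweedler2_complex_left sweedler2_complex_right

lemma sweedler2_swap:
  "sw (\<lambda>a b. sw (\<lambda>c d. F a b c d) y) x =
   sw (\<lambda>c d. sw (\<lambda>a b. F a b c d) x) y"
  unfolding sweedler2_def by (rule tensor_sum_swap)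

lemma sweedler2_assoc:
  assumes "\<And>b c. clinear (\<lambda>a. F a b c)" "\<And>a c. clinear (\<lambda>b. F a b c)" "\<And>a b. clinear (\<lambda>c. F a b c)"
  shows "sw (\<lambda>y c. sw (\<lambda>a b. F a b c) y) x =
    sw (\<lambda>a y. sw (\<lambda>b c. F a b c) y) x"
  unfolding sweedler2_def by (rule coassoc_trilinear) (fact assms)+

lemma sweedler2_counit_left:
  fixes f :: "'a \<Rightarrow> 'b::complex_vector"
  shows "clinear f \<Longrightarrow> sw (\<lambda>a b. counit H a *\<^sub>C f b) x = f x"
  unfolding sweedler2_def by (rule counit_left_linear)

lemma sweedler2_counit_right:
  fixes f :: "'a \<Rightarrow> 'b::complex_vector"
  shows "clinear f \<Longrightarrow> sw (\<lambda>a b. counit H b *\<^sub>C f a) x = f x"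
  unfolding sweedler2_def by (rule counit_right_linear)

lemma sweedler2_mult:
  assumes B: "cbilinear (\<lambda>a b. B a b)"
  shows "sw (\<lambda>a b. B a b) (x \<cdot> y) =
    sw (\<lambda>x\<^sub>1 x\<^sub>2. sw (\<lambda>y\<^sub>1 y\<^sub>2. B (x\<^sub>1 \<cdot> y\<^sub>1) (x\<^sub>2 \<cdot> y\<^sub>2)) y) x"
  unfolding sweedler2_def comult_mult
  by (simp add: linear_tensor_sum[OF clinear_tensor_sum[OF B]] tensor_universal_property(2)[OF B])

lemma sweedler2_unit: "cbilinear B \<Longrightarrow> sw B (hunit H) = B (hunit H) (hunit H)"
  by (simp add: sweedler2_def comult_unit tensor_universal_property)

text \<open>
  The antipode reverses coproducts, so an expression with an antipode in one factor pairs the last leg of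
  that factor with the first leg of the next one. Regrouped from the outside in, the paired
  legs become the two legs of one element.
\<close>

lemma sweedler2_sandwich:
  assumes [lin]: "\<And>q r s. clinear (\<lambda>p. F p q r s)" "\<And>p r s. clinear (\<lambda>q. F p q r s)"
    "\<And>p q s. clinear (\<lambda>r. F p q r s)" "\<And>p q r. clinear (\<lambda>s. F p q r s)"
  shows "sw (\<lambda>a b. sw (\<lambda>p q. sw (\<lambda>r s. F p q r s) b) a) x =
    sw (\<lambda>p y. sw (\<lambda>z s. sw (\<lambda>q r. F p q r s) z) y) x"
proof -
  have "sw (\<lambda>a b. sw (\<lambda>p q. sw (\<lambda>r s. F p q r s) b) a) x =
      sw (\<lambda>p y. sw (\<lambda>q b. sw (\<lambda>r s. F p q r s) b) y) x"
    by (rule sweedler2_assoc) (intro lin)+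
  also have "\<dots> = sw (\<lambda>p y. sw (\<lambda>z s. sw (\<lambda>q r. F p q r s) z) y) x"
    by (rule sweedler2_cong, rule sweedler2_assoc[symmetric]) (intro lin)+
  finally show ?thesis .
qed

lemma sweedler3_sandwich:
  assumes [lin]: "\<And>q m r s. clinear (\<lambda>p. F p q m r s)" "\<And>p m r s. clinear (\<lambda>q. F p q m r s)"
    "\<And>p q r s. clinear (\<lambda>m. F p q m r s)"
    "\<And>p q m s. clinear (\<lambda>r. F p q m r s)" "\<And>p q m r. clinear (\<lambda>s. F p q m r s)"
  shows "sw3 (\<lambda>a m b. sw (\<lambda>p q. sw (\<lambda>r s. F p q m r s) b) a) x =
    sw3 (\<lambda>p y s. sw3 (\<lambda>q m r. F p q m r s) y) x"
proof -
  have "sw3 (\<lambda>a m b. sw (\<lambda>p q. sw (\<lambda>r s. F p q m r s) b) a) x =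
      sw (\<lambda>a y. sw (\<lambda>p q.
        sw (\<lambda>m b. sw (\<lambda>r s. F p q m r s) b) y) a) x"
    unfolding sweedler3_def by (rule sweedler2_cong, rule sweedler2_swap)
  also have "\<dots> = sw (\<lambda>a y. sw (\<lambda>p q.
        sw (\<lambda>w s. sw (\<lambda>m r. F p q m r s) w) y) a) x"
    by (rule sweedler2_cong, rule sweedler2_cong, rule sweedler2_assoc[symmetric]) (intro lin)+
  also have "\<dots> = sw (\<lambda>p y. sw (\<lambda>z s. sw (\<lambda>q w.
        sw (\<lambda>m r. F p q m r s) w) z) y) x"
    by (rule sweedler2_sandwich) (intro lin)+
  finally show ?thesis
    by (simp add: sweedler3_def)
qed

lemma tensor_sum_mult_coalgebra_map:
  "coalgebra_map (tensor_comult (comult H) (comult H)) (tensor_counit (counit H) (counit H))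
    (comult H) (counit H) (tensor_sum (hmult H))"
proof -
  let ?M = "tensor_sum (hmult H)"
  note M = tensor_universal_property[OF mult_bilinear]
  note Ml = clinear_compose[OF M(1)]
  have "comult H (?M t) = tensor_sum (\<lambda>a b. ?M a \<otimes> ?M b) (tensor_comult (comult H) (comult H) t)" for t
  proof (rule tensor_ext[where t = t])
    show "clinear (\<lambda>t. comult H (?M t))"
      "clinear (\<lambda>t. tensor_sum (\<lambda>a b. ?M a \<otimes> ?M b) (tensor_comult (comult H) (comult H) t))"
      by (intro lin Ml pair.linear_tensor_comult)+
    have "cbilinear (\<lambda>a b. ?M a \<otimes> ?M b)"
      by (intro lin Ml)
    then show "comult H (?M (x \<otimes> y)) =
        tensor_sum (\<lambda>a b. ?M a \<otimes> ?M b) (tensor_comult (comult H) (comult H) (x \<otimes> y))" for x y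
      by (simp add: M(2) pair.tensor_comult_sum comult_mult sweedler2_def)
  qed
  moreover have "counit H (?M t) = tensor_counit (counit H) (counit H) t" for t
    by (rule tensor_ext[where t = t])
      (auto intro!: lin Ml pair.linear_tensor_counit simp: M(2) pair.tensor_counit_pure counit_mult)
  ultimately show ?thesis
    by (simp add: coalgebra_map_def M(1))
qed

text \<open>
  On the tensor square, both sides are convolution inverse to the multiplication.
\<close>

lemma antipode_mult: "\<S> (x \<cdot> y) = \<S> y \<cdot> \<S> x"
proof -
  let ?D = "tensor_comult (comult H) (comult H)" and ?e = "tensor_counit (counit H) (counit H)"
  let ?M = "tensor_sum (hmult H)" and ?R = "tensor_sum (\<lambda>x y. \<S> y \<cdot> \<S> x)"
  note M = tensor_universal_property[OF mult_bilinear]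
  have R: "cbilinear (\<lambda>x y. \<S> y \<cdot> \<S> x)"
    by (intro lin)
  have "\<S> (?M t) = ?R t" for t
  proof (rule square.convolution_inverse_eq[where m = "hmult H" and e = "hunit H" and f = ?M])
    show "clinear (\<lambda>t. \<S> (?M t))" "clinear ?M" "clinear ?R"
      by (intro lin M(1) clinear_tensor_sum)+
    show "convolution ?D (hmult H) (\<lambda>t. \<S> (?M t)) ?M t = ?e t *\<^sub>C hunit H" for t
      using convolution_coalgebra_map[OF tensor_sum_mult_coalgebra_map mult_bilinear
          antipode_linear clinear_id, of t] antipode_left[of "?M t"]
        tensor_sum_mult_coalgebra_map
      by (simp add: convolution_def sweedler2_def coalgebra_map_def)
    show "convolution ?D (hmult H) ?M ?R t = ?e t *\<^sub>C hunit H" for t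
    proof (rule tensor_ext[where t = t])
      have B: "cbilinear (\<lambda>a b. ?M a \<cdot> ?R b)"
        by (intro lin clinear_tensor_sum)
      then show "clinear (convolution ?D (hmult H) ?M ?R)"
        unfolding convolution_def
        by (intro lin pair.linear_tensor_comult)
      show "clinear (\<lambda>t. ?e t *\<^sub>C hunit H)"
        by (intro lin pair.linear_tensor_counit)
      fix x y
      have "convolution ?D (hmult H) ?M ?R (x \<otimes> y) =
          sw (\<lambda>a b. sw (\<lambda>c d. (a \<cdot> c) \<cdot> (\<S> d \<cdot> \<S> b)) y) x"
        by (simp add: convolution_def pair.tensor_comult_sum[OF B] M(2)
            tensor_universal_property(2)[OF R] sweedler2_def)
      also have "\<dots> = sw (\<lambda>a b. a \<cdot> (sw (\<lambda>c d. c \<cdot> \<S> d) y \<cdot> \<S> b)) x"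
        by (simp add: sweedler2_out mult_assoc)
      also have "\<dots> = (counit H x * counit H y) *\<^sub>C hunit H"
        by (simp add: antipode_right mult_scaleC_left mult_scaleC_right unit_mult
            sweedler2_scaleC_right[symmetric] scaleC_scaleC mult.commute)
      finally show "convolution ?D (hmult H) ?M ?R (x \<otimes> y) = ?e (x \<otimes> y) *\<^sub>C hunit H"
        by (simp add: pair.tensor_counit_pure)
    qed
  qed (use mult_bilinear mult_assoc unit_mult mult_unit in auto)
  from this[of "x \<otimes> y"] show ?thesis
    by (simp add: M(2) tensor_universal_property(2)[OF R])
qed

lemma antipode_unit: "\<S> (hunit H) = hunit H"
  using antipode_left[of "hunit H"]
  by (simp add: sweedler2_unit mult_bilinear[unfolded cbilinear_def] lin mult_unit counit_unit scaleC_one)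

lemma counit_antipode: "counit H (\<S> x) = counit H x"
proof -
  have "counit H (sw (\<lambda>a b. \<S> a \<cdot> b) x) = sw (\<lambda>a b. counit H b *\<^sub>C counit H (\<S> a)) x"
    by (simp add: sweedler2_linear[OF counit_linear] counit_mult complex_scaleC_def mult.commute)
  also have "\<dots> = counit H (\<S> x)"
    by (rule sweedler2_counit_right) (intro lin)
  finally show ?thesis
    by (simp add: antipode_left clinear_scaleC[OF counit_linear] counit_unit complex_scaleC_def)
qed

text \<open>
  Both sides are convolution inverse to the comultiplication, for maps into the tensor square.
\<close>

lemma comult_antipode: "comult H (\<S> x) = sw (\<lambda>a b. \<S> b \<otimes> \<S> a) x"
proof -
  let ?m = "tensor_mult (hmult H) (hmult H)" and ?e = "hunit H \<otimes> hunit H"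
  let ?R = "\<lambda>x. sw (\<lambda>a b. \<S> b \<otimes> \<S> a) x"
  note T = cbilinear_tensor_mult[OF mult_bilinear mult_bilinear]
  note pure = tensor_mult_pure[OF mult_bilinear mult_bilinear]
  note TL = cbilinear_left[OF T] cbilinear_right[OF T]
  show ?thesis
  proof (rule convolution_inverse_eq[where m = ?m and e = ?e and f = "comult H"])
    show "clinear (\<lambda>x. comult H (\<S> x))" "clinear (comult H)" "clinear ?R"
      by (intro lin comult_linear)+
    have mult: "comult H (a \<cdot> b) = ?m (comult H a) (comult H b)" for a b
      by (simp add: comult_mult sweedler2_def tensor_mult_def)
    show "convolution (comult H) ?m (\<lambda>x. comult H (\<S> x)) (comult H) x = counit H x *\<^sub>C ?e" for x
    proof -
      have "convolution (comult H) ?m (\<lambda>x. comult H (\<S> x)) (comult H) x =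
          comult H (sw (\<lambda>a b. \<S> a \<cdot> b) x)"
        by (simp add: linear_tensor_sum[OF comult_linear] convolution_def mult sweedler2_def)
      then show ?thesis
        by (simp add: antipode_left clinear_scaleC[OF comult_linear] comult_unit)
    qed
    show "convolution (comult H) ?m (comult H) ?R x = counit H x *\<^sub>C ?e" for x
    proof -
      have c: "comult H a = sw (\<otimes>) a" for a
        by (simp add: sweedler2_def tensor_sum_pure_tensor)
      have "convolution (comult H) ?m (comult H) ?R x =
          sw (\<lambda>a b. ?m (sw (\<otimes>) a) (?R b)) x"
        by (simp add: convolution_def sweedler2_def tensor_sum_pure_tensor)
      also have "\<dots> = sw (\<lambda>a b. sw (\<lambda>r s. sw (\<lambda>p q.
          (p \<cdot> \<S> s) \<otimes> (q \<cdot> \<S> r)) a) b) x"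
        by (simp add: sweedler2_linear[where f = "\<lambda>y. ?m y z" for z, OF TL(1)[OF clinear_id]]
            sweedler2_linear[where f = "\<lambda>y. ?m z y" for z, OF TL(2)[OF clinear_id]] pure)
      also have "\<dots> = sw (\<lambda>a b. sw (\<lambda>p q. sw (\<lambda>r s.
          (p \<cdot> \<S> s) \<otimes> (q \<cdot> \<S> r)) b) a) x"
        by (rule sweedler2_cong, rule sweedler2_swap)
      also have "\<dots> = sw (\<lambda>p y. sw (\<lambda>z s. sw (\<lambda>q r.
          (p \<cdot> \<S> s) \<otimes> (q \<cdot> \<S> r)) z) y) x"
        by (rule sweedler2_sandwich) (intro lin)+
      also have "\<dots> = sw (\<lambda>p y. sw (\<lambda>z s. counit H z *\<^sub>C ((p \<cdot> \<S> s) \<otimes> hunit H)) y) x"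
        by (simp add: sweedler2_linear[where f = "\<lambda>y. z \<otimes> y" for z, OF clinear_pure_right[OF clinear_id],
              symmetric] antipode_right clinear_scaleC[OF clinear_pure_right[OF clinear_id]])
      also have "\<dots> = sw (\<lambda>p y. (p \<cdot> \<S> y) \<otimes> hunit H) x"
        by (rule sweedler2_cong, rule sweedler2_counit_left) (intro lin)
      also have "\<dots> = counit H x *\<^sub>C ?e"
        by (simp add: sweedler2_linear[where f = "\<lambda>y. y \<otimes> z" for z, OF clinear_pure_left[OF clinear_id],
              symmetric] antipode_right clinear_scaleC[OF clinear_pure_left[OF clinear_id]])
      finally show ?thesis .
    qed
  qed (use T tensor_mult_assoc[OF mult_bilinear mult_bilinear] mult_assoc
      tensor_mult_unit[OF mult_bilinear mult_bilinear] tensor_unit_mult[OF mult_bilinear mult_bilinear]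
      unit_mult mult_unit in auto)
qed

lemma sweedler2_antipode:
  assumes B: "cbilinear (\<lambda>a b. B a b)"
  shows "sw (\<lambda>a b. B a b) (\<S> x) = sw (\<lambda>a b. B (\<S> b) (\<S> a)) x"
  unfolding sweedler2_def comult_antipode
  by (simp add: linear_tensor_sum[OF clinear_tensor_sum[OF B]] tensor_universal_property(2)[OF B])

end

section \<open>Star structures and normal integrals\<close>

context star_hopf_algebra begin

abbreviation star_post ("_\<^bold>*" [1000] 999) where "x\<^bold>* \<equiv> hstar H x"

lemma star_add: "(x + y)\<^bold>* = x\<^bold>* + y\<^bold>*"
  and star_scaleC: "(c *\<^sub>C x)\<^bold>* = cnj c *\<^sub>C x\<^bold>*"
  using star_conjugate_linear by (simp_all add: conjugate_linear_def)

lemma star_sweedler2: "(sw F x)\<^bold>* = sw (\<lambda>a b. (F a b)\<^bold>*) x"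
  unfolding sweedler2_def by (rule conjugate_linear_tensor_sum[OF star_conjugate_linear])

lemma cnj_sweedler2: "cnj (sw F x) = sw (\<lambda>a b. cnj (F a b)) x"
  unfolding sweedler2_def by (rule cnj_tensor_sum)

lemma sweedler2_star:
  assumes B: "cbilinear (\<lambda>a b. B a b)"
  shows "sw (\<lambda>a b. B a b) (x\<^bold>*) = sw (\<lambda>a b. B (a\<^bold>*) (b\<^bold>*)) x"
  unfolding sweedler2_def comult_star
  by (simp add: linear_tensor_sum[OF clinear_tensor_sum[OF B]] tensor_universal_property(2)[OF B])

lemma clinear_star_star: "clinear f \<Longrightarrow> clinear (\<lambda>x. (f (x\<^bold>*))\<^bold>*)"
  by (simp add: clinear_iff star_add star_scaleC)

lemma clinear_cnj_star: "clinear f \<Longrightarrow> clinear (\<lambda>x. cnj (f (x\<^bold>*)))"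
  by (simp add: clinear_iff star_add star_scaleC complex_scaleC_def)

lemma star_unit: "(hunit H)\<^bold>* = hunit H"
  by (metis mult_unit star_mult star_star unit_mult)

text \<open>
  The functional $x \mapsto \overline{\varepsilon(x^*)}$ is also a left counit, and a left counit agrees
  with a right one.
\<close>

lemma counit_star: "counit H (x\<^bold>*) = cnj (counit H x)"
proof -
  let ?e = "\<lambda>x. cnj (counit H (x\<^bold>*))"
  note e = clinear_cnj_star[OF counit_linear]
  have "x = (sw (\<lambda>a b. counit H a *\<^sub>C b) (x\<^bold>*))\<^bold>*"
    by (simp add: counit_left star_star)
  also have "\<dots> = sw (\<lambda>a b. ?e a *\<^sub>C b) x"
    by (subst sweedler2_star) (intro lin | simp add: star_sweedler2 star_scaleC star_star)+
  finally have "x = sw (\<lambda>a b. ?e a *\<^sub>C b) x" .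
  from arg_cong[OF this, of "counit H"] have "counit H x = sw (\<lambda>a b. ?e a *\<^sub>C counit H b) x"
    by (simp only: sweedler2_linear[OF counit_linear] clinear_scaleC[OF counit_linear])
  also have "\<dots> = sw (\<lambda>a b. counit H b *\<^sub>C ?e a) x"
    by (simp add: complex_scaleC_def mult.commute)
  also have "\<dots> = ?e x"
    by (rule sweedler2_counit_right[OF e])
  finally show ?thesis
    by simp
qed

text \<open>
  This is the inverse of the antipode.
\<close>

definition coantipode :: "'a \<Rightarrow> 'a"
  where "coantipode x = (\<S> (x\<^bold>*))\<^bold>*"

lemma coantipode_linear: "clinear coantipode"
  unfolding coantipode_def by (rule clinear_star_star[OF antipode_linear])

lemma lin_coantipode [lin]: "clinear f \<Longrightarrow> clinear (\<lambda>x. coantipode (f x))"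
  by (rule clinear_compose[OF coantipode_linear])

lemma coantipode_left: "sw (\<lambda>a b. coantipode b \<cdot> a) x = counit H x *\<^sub>C hunit H"
proof -
  have "sw (\<lambda>a b. coantipode b \<cdot> a) x = (sw (\<lambda>a b. a \<cdot> \<S> b) (x\<^bold>*))\<^bold>*"
    by (subst sweedler2_star, intro lin) (simp add: star_sweedler2 star_mult star_star coantipode_def)
  then show ?thesis
    by (simp add: antipode_right star_scaleC counit_star star_unit)
qed

lemma coantipode_right: "sw (\<lambda>a b. b \<cdot> coantipode a) x = counit H x *\<^sub>C hunit H"
proof -
  have "sw (\<lambda>a b. b \<cdot> coantipode a) x = (sw (\<lambda>a b. \<S> a \<cdot> b) (x\<^bold>*))\<^bold>*"
    by (subst sweedler2_star, intro lin) (simp add: star_sweedler2 star_mult star_star coantipode_def)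
  then show ?thesis
    by (simp add: antipode_left star_scaleC counit_star star_unit)
qed

text \<open>
  The antipode, applied to \<open>coantipode_left\<close>, shows that $S \circ S'$ is a convolution inverse of $S$,
  where $S'$ is the coantipode; the identity map is the other one.
\<close>

lemma antipode_coantipode: "\<S> (coantipode x) = x"
proof -
  have r: "sw (\<lambda>a b. \<S> a \<cdot> \<S> (coantipode b)) x = counit H x *\<^sub>C hunit H" for x
    using arg_cong[OF coantipode_left[of x], of \<S>]
    by (simp add: sweedler2_linear[OF antipode_linear] antipode_mult
        clinear_scaleC[OF antipode_linear] antipode_unit)
  have "x = \<S> (coantipode x)"
    by (rule convolution_inverse_eq[where m = "hmult H" and e = "hunit H" and l = "\<lambda>x. x" and f = \<S>
          and r = "\<lambda>x. \<S> (coantipode x)"])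
      (use mult_bilinear mult_assoc unit_mult mult_unit r antipode_right in
        \<open>auto intro!: lin simp: convolution_def sweedler2_def\<close>)
  then show ?thesis
    by simp
qed

lemma coantipode_antipode: "coantipode (\<S> x) = x"
  by (metis antipode_coantipode coantipode_def star_star)

lemma antipode_star_star: "\<S> ((\<S> x)\<^bold>*) = x\<^bold>*"
  by (metis coantipode_antipode coantipode_def star_star)

lemma inv_antipode: "inv \<S> = coantipode"
  by (rule ext) (metis antipode_coantipode coantipode_antipode injI inv_f_eq)

lemma sweedler2_coantipode:
  assumes B: "cbilinear B"
  shows "sw B (coantipode x) = sw (\<lambda>a b. B (coantipode b) (coantipode a)) x"
proof -
  have "cbilinear (\<lambda>a b. B (coantipode b) (coantipode a))"
    by (intro lin cbilinear_left[OF B] cbilinear_right[OF B])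
  from sweedler2_antipode[OF this, of "coantipode x"] show ?thesis
    by (simp add: antipode_coantipode coantipode_antipode)
qed

end

locale integral_star_hopf_algebra = star_hopf_algebra H
  for H :: "'a::complex_vector star_hopf_data" +
  fixes \<phi> :: "'a \<Rightarrow> complex"
  assumes integral: "normal_integral H \<phi>"
begin

lemma integral_linear: "clinear \<phi>"
  and integral_unit: "\<phi> (hunit H) = 1"
  and integral_left: "sw (\<lambda>a b. \<phi> a *\<^sub>C b) x = \<phi> x *\<^sub>C hunit H"
  and integral_right: "sw (\<lambda>a b. \<phi> b *\<^sub>C a) x = \<phi> x *\<^sub>C hunit H"
  using integral by (auto simp: normal_integral_def)

lemma lin_integral [lin]: "clinear f \<Longrightarrow> clinear (\<lambda>x. \<phi> (f x))"
  by (rule clinear_compose[OF integral_linear])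

text \<open>
  The functional $x \mapsto \overline{\varphi(x^*)}$ is again a normal integral. Normal integrals are
  unique: a left invariant and a right invariant one agree with their convolution product.
\<close>

lemma integral_star: "\<phi> (x\<^bold>*) = cnj (\<phi> x)"
proof -
  let ?p = "\<lambda>x. cnj (\<phi> (x\<^bold>*))"
  note p = clinear_cnj_star[OF integral_linear]
  have "?p x *\<^sub>C hunit H = (sw (\<lambda>a b. \<phi> b *\<^sub>C a) (x\<^bold>*))\<^bold>*"
    by (simp add: integral_right star_scaleC star_unit)
  also have "\<dots> = sw (\<lambda>a b. ?p b *\<^sub>C a) x"
    by (subst sweedler2_star) (intro lin | simp add: star_sweedler2 star_scaleC star_star)+
  finally have "?p x *\<^sub>C hunit H = sw (\<lambda>a b. ?p b *\<^sub>C a) x" .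
  from arg_cong[OF this, of \<phi>] have "?p x *\<^sub>C 1 = sw (\<lambda>a b. ?p b *\<^sub>C \<phi> a) x"
    by (simp only: sweedler2_linear[OF integral_linear] clinear_scaleC[OF integral_linear] integral_unit)
  then have "?p x = sw (\<lambda>a b. ?p b *\<^sub>C \<phi> a) x"
    by (simp add: complex_scaleC_def)
  also have "\<dots> = sw (\<lambda>a b. \<phi> a *\<^sub>C ?p b) x"
    by (simp add: complex_scaleC_def mult.commute)
  also have "\<dots> = ?p (sw (\<lambda>a b. \<phi> a *\<^sub>C b) x)"
    by (simp add: sweedler2_linear[OF p] clinear_scaleC[OF p])
  also have "\<dots> = \<phi> x"
    by (simp add: integral_left clinear_scaleC[OF p] star_unit integral_unit complex_scaleC_def)
  finally show ?thesis
    by (metis complex_cnj_cnj)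
qed

text \<open>
  Replace $\varphi(y x_1) 1$ by $\sum \varphi(y_1 x_1) y_2 x_2$; the second leg of $x$ then cancels against
  the antipode of the third.
\<close>

lemma integral_move_right:
  "sw (\<lambda>a b. \<phi> (y \<cdot> a) *\<^sub>C \<S> b) x = sw (\<lambda>a b. \<phi> (a \<cdot> x) *\<^sub>C b) y"
proof -
  have "sw (\<lambda>a b. \<phi> (y \<cdot> a) *\<^sub>C \<S> b) x =
      sw (\<lambda>u b. sw (\<lambda>c d. \<phi> c *\<^sub>C d) (y \<cdot> u) \<cdot> \<S> b) x"
    by (simp add: integral_left mult_scaleC_left unit_mult)
  also have "\<dots> = sw (\<lambda>u b. sw (\<lambda>p q. sw (\<lambda>r s.
      (\<phi> (p \<cdot> r) *\<^sub>C (q \<cdot> s)) \<cdot> \<S> b) u) y) x"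
    by (subst sweedler2_mult, intro lin) (simp add: sweedler2_mult_left)
  also have "\<dots> = sw (\<lambda>u b. sw (\<lambda>r s. sw (\<lambda>p q.
      (\<phi> (p \<cdot> r) *\<^sub>C (q \<cdot> s)) \<cdot> \<S> b) y) u) x"
    by (rule sweedler2_cong, rule sweedler2_swap)
  also have "\<dots> = sw (\<lambda>r u. sw (\<lambda>s b. sw (\<lambda>p q.
      (\<phi> (p \<cdot> r) *\<^sub>C (q \<cdot> s)) \<cdot> \<S> b) y) u) x"
    by (rule sweedler2_assoc) (intro lin)+
  also have "\<dots> = sw (\<lambda>r u. sw (\<lambda>p q. sw (\<lambda>s b.
      (\<phi> (p \<cdot> r) *\<^sub>C (q \<cdot> s)) \<cdot> \<S> b) u) y) x"
    by (rule sweedler2_cong, rule sweedler2_swap)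
  also have "\<dots> = sw (\<lambda>r u. sw (\<lambda>p q. \<phi> (p \<cdot> r) *\<^sub>C (q \<cdot> sw (\<lambda>s b. s \<cdot> \<S> b) u)) y) x"
    by (simp add: sweedler2_out mult_scaleC_left mult_assoc)
  also have "\<dots> = sw (\<lambda>r u. counit H u *\<^sub>C sw (\<lambda>p q. \<phi> (p \<cdot> r) *\<^sub>C q) y) x"
    by (simp add: antipode_right mult_scaleC_right mult_unit sweedler2_scaleC_right scaleC_scaleC mult.commute)
  also have "\<dots> = sw (\<lambda>p q. \<phi> (p \<cdot> x) *\<^sub>C q) y"
    by (rule sweedler2_counit_right) (intro lin)
  finally show ?thesis .
qed

text \<open>
  The mirror image: replace $\varphi(y x_2) 1$ by $\sum \varphi(y_2 x_3) y_1 x_2$; the product that cancels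
  is now $x_2 S^{-1}(x_1)$, in reversed order, and therefore contains the inverse of the antipode.
\<close>

lemma integral_move_left:
  "sw (\<lambda>a b. \<phi> (y \<cdot> b) *\<^sub>C coantipode a) x = sw (\<lambda>a b. \<phi> (b \<cdot> x) *\<^sub>C a) y"
proof -
  have "sw (\<lambda>a b. \<phi> (y \<cdot> b) *\<^sub>C coantipode a) x =
      sw (\<lambda>b u. sw (\<lambda>c d. \<phi> d *\<^sub>C c) (y \<cdot> u) \<cdot> coantipode b) x"
    by (simp add: integral_right mult_scaleC_left unit_mult)
  also have "\<dots> = sw (\<lambda>b u. sw (\<lambda>p q. sw (\<lambda>r s.
      (\<phi> (q \<cdot> s) *\<^sub>C (p \<cdot> r)) \<cdot> coantipode b) u) y) x"
    by (subst sweedler2_mult, intro lin) (simp add: sweedler2_mult_left)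
  also have "\<dots> = sw (\<lambda>b u. sw (\<lambda>r s. sw (\<lambda>p q.
      (\<phi> (q \<cdot> s) *\<^sub>C (p \<cdot> r)) \<cdot> coantipode b) y) u) x"
    by (rule sweedler2_cong, rule sweedler2_swap)
  also have "\<dots> = sw (\<lambda>u s. sw (\<lambda>b r. sw (\<lambda>p q.
      (\<phi> (q \<cdot> s) *\<^sub>C (p \<cdot> r)) \<cdot> coantipode b) y) u) x"
    by (rule sweedler2_assoc[symmetric]) (intro lin)+
  also have "\<dots> = sw (\<lambda>u s. sw (\<lambda>p q. sw (\<lambda>b r.
      (\<phi> (q \<cdot> s) *\<^sub>C (p \<cdot> r)) \<cdot> coantipode b) u) y) x"
    by (rule sweedler2_cong, rule sweedler2_swap)
  also have "\<dots> = sw (\<lambda>u s. sw (\<lambda>p q. \<phi> (q \<cdot> s) *\<^sub>C (p \<cdot> sw (\<lambda>b r. r \<cdot> coantipode b) u)) y) x"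
    by (simp add: sweedler2_out mult_scaleC_left mult_assoc)
  also have "\<dots> = sw (\<lambda>u s. counit H u *\<^sub>C sw (\<lambda>p q. \<phi> (q \<cdot> s) *\<^sub>C p) y) x"
    by (simp add: coantipode_right mult_scaleC_right mult_unit sweedler2_scaleC_right scaleC_scaleC mult.commute)
  also have "\<dots> = sw (\<lambda>p q. \<phi> (q \<cdot> x) *\<^sub>C p) y"
    by (rule sweedler2_counit_left) (intro lin)
  finally show ?thesis .
qed

lemma integral_move_left':
  "sw (\<lambda>a b. \<phi> (y \<cdot> b) *\<^sub>C a) x = sw (\<lambda>a b. \<phi> (b \<cdot> x) *\<^sub>C \<S> a) y"
  using arg_cong[OF integral_move_left[of y x], of \<S>]
  by (simp add: sweedler2_linear[OF antipode_linear] clinear_scaleC[OF antipode_linear]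
      antipode_coantipode)

end

section \<open>Hermitian forms on finite-dimensional spaces\<close>

lemma sesquilinear_simps:
  assumes "\<forall>v. clinear (\<lambda>u. ip u v)" and "\<forall>u. conjugate_linear (ip u)"
  shows "ip (x + y) z = ip x z + ip y z" "ip (c *\<^sub>C x) z = c * ip x z" "ip (x - y) z = ip x z - ip y z"
    "ip 0 z = 0" "ip (\<Sum>a\<in>A. f a) z = (\<Sum>a\<in>A. ip (f a) z)"
    "ip z (x + y) = ip z x + ip z y" "ip z (c *\<^sub>C x) = cnj c * ip z x" "ip z 0 = 0"
    "ip z (\<Sum>a\<in>A. f a) = (\<Sum>a\<in>A. ip z (f a))"
proof -
  have l: "clinear (\<lambda>u. ip u z)" and c: "conjugate_linear (ip z)"
    using assms by blast+
  show "ip (x + y) z = ip x z + ip y z" "ip (x - y) z = ip x z - ip y z"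
    "ip 0 z = 0" "ip (\<Sum>a\<in>A. f a) z = (\<Sum>a\<in>A. ip (f a) z)"
    by (rule clinear_add[OF l] clinear_diff[OF l] clinear_0[OF l] clinear_sum[OF l])+
  show "ip (c *\<^sub>C x) z = c * ip x z"
    using clinear_scaleC[OF l] by (simp add: complex_scaleC_def)
  show "ip z (x + y) = ip z x + ip z y" "ip z (c *\<^sub>C x) = cnj c * ip z x"
    using c by (auto simp: conjugate_linear_def complex_scaleC_def)
  show "ip z 0 = 0" "ip z (\<Sum>a\<in>A. f a) = (\<Sum>a\<in>A. ip z (f a))"
    by (rule conjugate_linear_0[OF c] conjugate_linear_sum[OF c])+
qed

lemma inner_product_onD:
  assumes "inner_product_on W ip"
  shows "\<forall>v. clinear (\<lambda>u. ip u v)" "\<forall>u. conjugate_linear (ip u)"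
    "\<And>u v. u \<in> W \<Longrightarrow> v \<in> W \<Longrightarrow> ip u v = cnj (ip v u)"
    "\<And>u. u \<in> W \<Longrightarrow> u \<noteq> 0 \<Longrightarrow> ip u u > 0"
proof -
  note ip = assms[unfolded inner_product_on_def]
  show "\<forall>v. clinear (\<lambda>u. ip u v)" "\<forall>u. conjugate_linear (ip u)"
    by (rule ip[THEN conjunct1] ip[THEN conjunct2, THEN conjunct1])+
  show "ip u v = cnj (ip v u)" if "u \<in> W" "v \<in> W" for u v
    by (rule ip[THEN conjunct2, THEN conjunct2, THEN conjunct1, rule_format]) (fact that)+
  show "ip u u > 0" if "u \<in> W" "u \<noteq> 0" for u
    by (rule ip[THEN conjunct2, THEN conjunct2, THEN conjunct2, rule_format]) (fact that)+
qed

lemma inner_product_on_subset: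
  assumes "inner_product_on W ip" and "V \<subseteq> W"
  shows "inner_product_on V ip"
  unfolding inner_product_on_def
proof (intro conjI ballI impI)
  fix u v assume "u \<in> V" "v \<in> V"
  then show "ip u v = cnj (ip v u)"
    using assms(2) by (intro inner_product_onD(3)[OF assms(1)]) blast+
next
  fix u assume "u \<in> V" "u \<noteq> 0"
  then show "ip u u > 0"
    using assms(2) by (intro inner_product_onD(4)[OF assms(1)]) blast+
qed (rule inner_product_onD(1,2)[OF assms(1)])+

text \<open>
  Gram-Schmidt orthogonalisation, one spanning vector at a time.
\<close>

lemma orthonormal_basis:
  fixes W :: "'a::complex_vector set"
  assumes W: "csubspace W" "inner_product_on W ip"
    and B: "finite B" "B \<subseteq> W"
  shows "\<exists>E. finite E \<and> E \<subseteq> cspan B \<and> (\<forall>e\<in>E. \<forall>f\<in>E. ip e f = (if e = f then 1 else 0)) \<and>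
    (\<forall>u\<in>cspan B. u = (\<Sum>e\<in>E. ip u e *\<^sub>C e))"
  using B
proof (induction B rule: finite_induct)
  case empty
  then show ?case
    by (intro exI[of _ "{}"]) simp
next
  case (insert b B)
  note ip = inner_product_onD[OF W(2)]
  note ips = sesquilinear_simps[OF ip(1,2)]
  obtain E where E: "finite E" "E \<subseteq> cspan B"
      "\<And>e f. e \<in> E \<Longrightarrow> f \<in> E \<Longrightarrow> ip e f = (if e = f then 1 else 0)"
      "\<And>u. u \<in> cspan B \<Longrightarrow> u = (\<Sum>e\<in>E. ip u e *\<^sub>C e)"
    using insert.IH insert.prems
    by (elim exE conjE impE meta_impE, simp)
      (rule that; (assumption | drule (1) bspec)+)
  have BW: "cspan (insert b B) \<subseteq> W"
    using insert.prems W(1) by (simp add: complex_vector.span_minimal)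
  have EB: "E \<subseteq> cspan (insert b B)"
    using E(2) complex_vector.span_mono[of B "insert b B"] by blast
  define v where "v = b - (\<Sum>e\<in>E. ip b e *\<^sub>C e)"
  have v: "v \<in> cspan (insert b B)"
    unfolding v_def using EB
    by (intro complex_vector.span_diff complex_vector.span_sum complex_vector.span_scale)
      (auto intro: complex_vector.span_base)
  have ve: "ip v e = 0" if "e \<in> E" for e
  proof -
    have "ip v e = ip b e - (\<Sum>f\<in>E. ip b f * ip f e)"
      by (simp only: v_def ips)
    also have "(\<Sum>f\<in>E. ip b f * ip f e) = (\<Sum>f\<in>E. if f = e then ip b e else 0)"
      by (rule sum.cong[OF HOL.refl]) (simp add: E(3) that)
    finally show ?thesis
      using that E(1) by simp
  qed
  show ?case
  proof (cases "v = 0")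
    case True
    then have "b = (\<Sum>e\<in>E. ip b e *\<^sub>C e)"
      by (simp only: v_def right_minus_eq)
    moreover have "(\<Sum>e\<in>E. ip b e *\<^sub>C e) \<in> cspan B"
      using E(2) by (intro complex_vector.span_sum complex_vector.span_scale) blast
    ultimately have "b \<in> cspan B"
      by (rule ssubst)
    then have "cspan (insert b B) = cspan B"
      by (rule complex_vector.span_redundant)
    then show ?thesis
      using E by (intro exI[of _ E]) blast
  next
    case False
    define r where "r = Re (ip v v)"
    have pos: "ip v v > 0"
      using ip(4)[of v] v BW False by blast
    then have r: "r > 0" "ip v v = of_real r"
      by (auto simp: r_def less_complex_def complex_eq_iff)
    define e0 where "e0 = complex_of_real (1 / sqrt r) *\<^sub>C v"
    have e0B: "e0 \<in> cspan (insert b B)"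
      unfolding e0_def by (rule complex_vector.span_scale[OF v])
    have e00: "ip e0 e0 = 1"
    proof -
      have "cnj (complex_of_real (1 / sqrt r)) * (complex_of_real (1 / sqrt r) * of_real r) =
          of_real (1 / sqrt r * (1 / sqrt r * r))"
        by (simp only: complex_cnj_complex_of_real of_real_mult)
      also have "1 / sqrt r * (1 / sqrt r * r) = 1"
        using r(1) by (simp add: field_simps)
      finally show ?thesis
        by (simp only: e0_def ips r(2) of_real_1)
    qed
    have e0e: "ip e0 e = 0" if "e \<in> E" for e
      using that by (simp add: e0_def ips ve)
    have ee0: "ip e e0 = 0" if "e \<in> E" for e
      using e0e[OF that] ip(3)[of e e0] that EB BW e0B by auto
    have e0E: "e0 \<notin> E"
      using e0e e00 by force
    define D where "D = {u. u = (\<Sum>e\<in>insert e0 E. ip u e *\<^sub>C e)}"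
    have D: "csubspace D"
      unfolding D_def
    proof (rule complex_vector.subspaceI; unfold mem_Collect_eq)
      show "0 = (\<Sum>e\<in>insert e0 E. ip 0 e *\<^sub>C e)"
        by (simp add: ips)
      fix u v c
      assume u: "u = (\<Sum>e\<in>insert e0 E. ip u e *\<^sub>C e)" and v: "v = (\<Sum>e\<in>insert e0 E. ip v e *\<^sub>C e)"
      have "(\<Sum>e\<in>insert e0 E. ip (u + v) e *\<^sub>C e) =
          (\<Sum>e\<in>insert e0 E. ip u e *\<^sub>C e) + (\<Sum>e\<in>insert e0 E. ip v e *\<^sub>C e)"
        by (simp only: ips scaleC_add_left sum.distrib)
      then show "u + v = (\<Sum>e\<in>insert e0 E. ip (u + v) e *\<^sub>C e)"
        by (simp only: u[symmetric] v[symmetric])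
    next
      fix u c
      assume u: "u = (\<Sum>e\<in>insert e0 E. ip u e *\<^sub>C e)"
      have "(\<Sum>e\<in>insert e0 E. ip (c *\<^sub>C u) e *\<^sub>C e) = c *\<^sub>C (\<Sum>e\<in>insert e0 E. ip u e *\<^sub>C e)"
        by (simp only: ips complex_vector.scale_sum_right scaleC_scaleC)
      then show "c *\<^sub>C u = (\<Sum>e\<in>insert e0 E. ip (c *\<^sub>C u) e *\<^sub>C e)"
        by (simp only: u[symmetric])
    qed
    have orth: "ip e f = (if e = f then 1 else 0)" if "e \<in> insert e0 E" "f \<in> insert e0 E" for e f
      using that e00 e0e ee0 E(3) e0E by auto
    have ED: "insert e0 E \<subseteq> D"
    proof
      fix e assume e: "e \<in> insert e0 E"
      have "(\<Sum>f\<in>insert e0 E. ip e f *\<^sub>C f) = (\<Sum>f\<in>insert e0 E. if f = e then e else 0)"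
        by (rule sum.cong[OF HOL.refl]) (auto simp: orth[OF e] scaleC_one)
      then show "e \<in> D"
        using e E(1) by (simp add: D_def)
    qed
    have "v = complex_of_real (sqrt r) *\<^sub>C e0"
    proof -
      have "complex_of_real (sqrt r) * of_real (1 / sqrt r) = 1"
        using r(1) by simp
      then show ?thesis
        by (simp only: e0_def scaleC_scaleC scaleC_one)
    qed
    then have "v \<in> D"
      using ED D by (simp add: complex_vector.subspace_scale)
    moreover have "(\<Sum>e\<in>E. ip b e *\<^sub>C e) \<in> D"
      using ED D by (intro complex_vector.subspace_sum complex_vector.subspace_scale) auto
    ultimately have "b \<in> D"
      using complex_vector.subspace_add[OF D, of v "\<Sum>e\<in>E. ip b e *\<^sub>C e"] by (simp add: v_def)
    moreover have "B \<subseteq> D"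
    proof
      fix u assume "u \<in> B"
      then have "u = (\<Sum>e\<in>E. ip u e *\<^sub>C e)"
        using E(4) complex_vector.span_base by blast
      moreover have "(\<Sum>e\<in>E. ip u e *\<^sub>C e) \<in> D"
        using ED D by (intro complex_vector.subspace_sum complex_vector.subspace_scale) auto
      ultimately show "u \<in> D"
        by (rule ssubst)
    qed
    ultimately have BD: "cspan (insert b B) \<subseteq> D"
      using D by (simp add: complex_vector.span_minimal)
    then have exp: "u = (\<Sum>e\<in>insert e0 E. ip u e *\<^sub>C e)" if "u \<in> cspan (insert b B)" for u
      using that unfolding D_def by blast
    show ?thesis
    proof (intro exI[of _ "insert e0 E"] conjI ballI)
      show "finite (insert e0 E)"
        using E(1) by simp
      show "insert e0 E \<subseteq> cspan (insert b B)"
        using e0B EB by simp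
    qed (rule orth exp; assumption)+
  qed
qed

lemma linear_dependence:
  fixes f :: "'i \<Rightarrow> 'a::complex_vector"
  assumes "finite B" "finite I" "card B < card I" "f ` I \<subseteq> cspan B"
  shows "\<exists>c. (\<exists>i\<in>I. c i \<noteq> 0) \<and> (\<Sum>i\<in>I. c i *\<^sub>C f i) = 0"
proof (cases "inj_on f I")
  case True
  have "complex_vector.dependent (f ` I)"
    using complex_vector.independent_span_bound[of B "f ` I"] assms True
    by (auto simp: card_image)
  then obtain u where u: "\<exists>v\<in>f ` I. u v \<noteq> 0" "(\<Sum>v\<in>f ` I. u v *\<^sub>C v) = 0"
    using complex_vector.dependent_finite[of "f ` I"] assms(2) by auto
  then show ?thesis
    using True by (intro exI[of _ "\<lambda>i. u (f i)"]) (auto simp: sum.reindex)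
next
  case False
  then obtain i j where ij: "i \<in> I" "j \<in> I" "i \<noteq> j" "f i = f j"
    by (auto simp: inj_on_def)
  let ?c = "\<lambda>k. if k = i then 1 else if k = j then - 1 else (0::complex)"
  have "(\<Sum>k\<in>I. ?c k *\<^sub>C f k) = (\<Sum>k\<in>{i, j}. ?c k *\<^sub>C f k)"
    using assms(2) ij by (intro sum.mono_neutral_right) auto
  also have "\<dots> = 0"
    using ij by (simp add: scaleC_one)
  finally show ?thesis
    using ij(1) by (intro exI[of _ ?c]) auto
qed

definition poly_action :: "('a::complex_vector \<Rightarrow> 'a) \<Rightarrow> complex poly \<Rightarrow> 'a \<Rightarrow> 'a"
  where "poly_action T p x = (\<Sum>i\<le>degree p. coeff p i *\<^sub>C (T ^^ i) x)"

context
  fixes T :: "'a::complex_vector \<Rightarrow> 'a"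
  assumes T: "clinear T"
begin

lemma clinear_funpow: "clinear (T ^^ i)"
proof (induction i)
  case 0
  then show ?case by (simp add: id_def clinear_id)
next
  case (Suc i)
  then show ?case by (simp add: o_def clinear_compose[OF T])
qed

lemma poly_action_atMost:
  assumes "degree p \<le> n"
  shows "poly_action T p x = (\<Sum>i\<le>n. coeff p i *\<^sub>C (T ^^ i) x)"
  unfolding poly_action_def
  by (rule sum.mono_neutral_left) (use assms in \<open>auto simp: coeff_eq_0\<close>)

lemma poly_action_add: "poly_action T (p + q) x = poly_action T p x + poly_action T q x"
proof -
  let ?n = "max (degree p) (degree q)"
  have "degree (p + q) \<le> ?n"
    by (rule degree_add_le_max)
  then show ?thesis
    by (simp add: poly_action_atMost[of _ ?n] scaleC_add_left sum.distrib)
qed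

lemma poly_action_smult: "poly_action T (smult c p) x = c *\<^sub>C poly_action T p x"
  by (simp add: poly_action_atMost[of _ "degree p"] degree_smult_le complex_vector.scale_sum_right
      scaleC_scaleC)

lemma poly_action_pCons: "poly_action T (pCons 0 p) x = poly_action T p (T x)"
  by (simp add: poly_action_atMost[of _ "Suc (degree p)"] degree_pCons_le sum.atMost_Suc_shift
      funpow_swap1 poly_action_def del: sum.atMost_Suc)

lemma poly_action_linear: "clinear (poly_action T p)"
  unfolding poly_action_def
  by (intro clinear_sum_fun clinear_const_scaleC clinear_compose[OF clinear_funpow] clinear_id)

lemma poly_action_root_factor:
  "poly_action T ([:- c, 1:] * q) x = poly_action T q (T x - c *\<^sub>C x)"
proof -
  have "[:- c, 1:] * q = smult (- c) q + pCons 0 q"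
    by simp
  then show ?thesis
    by (simp only: poly_action_add poly_action_smult poly_action_pCons
        clinear_diff[OF poly_action_linear] clinear_scaleC[OF poly_action_linear]) simp
qed

text \<open>
  Let $c$ be a root of $p$. Either $T x = c x$, or $T x - c x$ is a nonzero vector that is annihilated by
  the quotient of $p$ by the linear factor.
\<close>

lemma eigenvector_of_annihilating_poly:
  assumes W: "csubspace W" "\<And>x. x \<in> W \<Longrightarrow> T x \<in> W"
    and "p \<noteq> 0" "x \<in> W" "x \<noteq> 0" "poly_action T p x = 0"
  shows "\<exists>y\<in>W. y \<noteq> 0 \<and> (\<exists>c. T y = c *\<^sub>C y)"
  using assms(3-)
proof (induction "degree p" arbitrary: p x rule: less_induct)
  case less
  show ?case
  proof (cases "degree p = 0")
    case True
    then have "coeff p 0 \<noteq> 0"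
      using less.prems(1) by (metis leading_coeff_0_iff)
    then show ?thesis
      using less.prems True by (simp add: poly_action_def)
  next
    case False
    then obtain c where "poly p c = 0"
      using fundamental_theorem_of_algebra[of p] by (auto simp: constant_degree)
    then obtain q where q: "p = [:- c, 1:] * q"
      by (auto simp: poly_eq_0_iff_dvd)
    let ?y = "T x - c *\<^sub>C x"
    show ?thesis
    proof (cases "?y = 0")
      case True
      then show ?thesis
        using less.prems by auto
    next
      case False
      have "?y \<in> W"
        using W less.prems by (simp add: complex_vector.subspace_diff complex_vector.subspace_scale)
      moreover have q0: "q \<noteq> 0"
        using less.prems(1) q by auto
      moreover have "degree p = Suc (degree q)"
        unfolding q using q0 by (subst degree_mult_eq) auto
      then have "degree q < degree p"
        by simp
      moreover have "poly_action T q ?y = 0"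
        using less.prems(4) by (simp only: q poly_action_root_factor)
      ultimately show ?thesis
        using less.hyps[of q ?y] False by blast
    qed
  qed
qed

lemma eigenvector_exists:
  assumes W: "csubspace W" "\<And>x. x \<in> W \<Longrightarrow> T x \<in> W"
    and B: "finite B" "W \<subseteq> cspan B" and x: "x \<in> W" "x \<noteq> 0"
  shows "\<exists>y\<in>W. y \<noteq> 0 \<and> (\<exists>c. T y = c *\<^sub>C y)"
proof -
  have orbit: "(T ^^ i) x \<in> W" for i
    by (induction i) (use x W in auto)
  then have "(\<lambda>i. (T ^^ i) x) ` {..card B} \<subseteq> cspan B"
    using B(2) by blast
  then obtain c where c: "\<exists>i\<le>card B. c i \<noteq> 0" "(\<Sum>i\<le>card B. c i *\<^sub>C (T ^^ i) x) = 0"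
    using linear_dependence[of B "{..card B}" "\<lambda>i. (T ^^ i) x"] B(1) by auto
  define p where "p = (\<Sum>i\<le>card B. monom (c i) i)"
  have coeff: "coeff p i = (if i \<le> card B then c i else 0)" for i
    by (simp add: p_def coeff_sum)
  then have "degree p \<le> card B"
    by (intro degree_le) auto
  then have "poly_action T p x = 0"
    using c(2) by (simp add: poly_action_atMost coeff)
  moreover have "p \<noteq> 0"
    using c(1) coeff by (metis coeff_0)
  ultimately show ?thesis
    using eigenvector_of_annihilating_poly[OF W] x by blast
qed

end

text \<open>
  In an orthonormal basis the form is represented by an operator on \<open>W\<close>, to which
  \<open>eigenvector_exists\<close> applies.
\<close>

lemma hermitian_form_eigenvector:
  fixes W :: "'a::complex_vector set"
  assumes B: "finite B" and WB: "W = cspan B" and ip: "inner_product_on W ip"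
    and h: "\<forall>v. clinear (\<lambda>u. h u v)" "\<forall>u. conjugate_linear (h u)"
    and z: "z \<in> W" "z \<noteq> 0"
  shows "\<exists>x\<in>W. x \<noteq> 0 \<and> (\<exists>c. \<forall>y\<in>W. h x y = c * ip x y)"
proof -
  have W: "csubspace W"
    by (simp add: WB)
  note ips = sesquilinear_simps[OF inner_product_onD(1,2)[OF ip]]
  note hs = sesquilinear_simps[OF h]
  have "B \<subseteq> W"
    by (simp add: WB complex_vector.span_superset)
  from orthonormal_basis[OF W ip B this, folded WB] obtain E where E: "finite E" "E \<subseteq> W"
      "\<And>u. u \<in> W \<Longrightarrow> u = (\<Sum>e\<in>E. ip u e *\<^sub>C e)"
    by (elim exE conjE) (rule that; (assumption | drule (1) bspec)+)
  define T where "T x = (\<Sum>e\<in>E. h x e *\<^sub>C e)" for x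
  have T: "clinear T"
    unfolding T_def[abs_def] by (intro clinear_sum_fun clinear_scaleC_const) (use h in blast)
  have TW: "T x \<in> W" for x
    unfolding T_def using W E(2) by (intro complex_vector.subspace_sum complex_vector.subspace_scale) auto
  have riesz: "ip (T x) y = h x y" if y: "y \<in> W" for x y
  proof -
    have "h x y = h x (\<Sum>e\<in>E. ip y e *\<^sub>C e)"
      using arg_cong[OF E(3)[OF y], of "h x"] .
    also have "\<dots> = (\<Sum>e\<in>E. h x e * ip e y)"
      unfolding hs
      by (rule sum.cong[OF HOL.refl]) (use inner_product_onD(3)[OF ip, of _ y] y E(2) in auto)
    finally show ?thesis
      by (simp add: T_def ips)
  qed
  obtain y c where "y \<in> W" "y \<noteq> 0" "T y = c *\<^sub>C y"
    using eigenvector_exists[OF T W TW B _ z] by (auto simp: WB)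
  then show ?thesis
    using riesz[of _ y] by (metis ips(2))
qed

text \<open>
  If an eigenvector has a positive eigenvalue, the form is not positive on its orthogonal complement
  either, where an eigenvector is found by induction on the dimension.
\<close>

lemma nonpositive_eigenvector:
  fixes W :: "'a::complex_vector set"
  assumes "finite B" "W = cspan B" "inner_product_on W ip"
    and h: "\<forall>v. clinear (\<lambda>u. h u v)" "\<forall>u. conjugate_linear (h u)"
    and "\<And>u v. u \<in> W \<Longrightarrow> v \<in> W \<Longrightarrow> h u v = cnj (h v u)"
    and "z \<in> W" "z \<noteq> 0" "Re (h z z) \<le> 0"
  shows "\<exists>x\<in>W. x \<noteq> 0 \<and> (\<exists>c::real. c \<le> 0 \<and> (\<forall>y\<in>W. h x y = of_real c * ip x y))"
  using assms(1-3,6-)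
proof (induction "card B" arbitrary: B W z rule: less_induct)
  case less
  note WB = less.prems(2) and ip = less.prems(3) and herm = less.prems(4)
  note z = less.prems(5-7)
  have W: "csubspace W"
    by (simp add: WB)
  note ips = sesquilinear_simps[OF inner_product_onD(1,2)[OF ip]]
  note hs = sesquilinear_simps[OF h]
  obtain x c where x: "x \<in> W" "x \<noteq> 0" and c: "\<And>y. y \<in> W \<Longrightarrow> h x y = c * ip x y"
    using hermitian_form_eigenvector[OF less.prems(1-3) h z(1,2)] by blast
  have pos: "ip x x > 0"
    using inner_product_onD(4)[OF ip] x by blast
  then have pos': "Re (ip x x) > 0" "Im (ip x x) = 0"
    by (auto simp: less_complex_def)
  have "c * ip x x = cnj (c * ip x x)"
    using herm[OF x(1) x(1)] unfolding c[OF x(1)] .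
  moreover have "cnj (ip x x) = ip x x"
    using pos' by (simp add: complex_eq_iff)
  ultimately have "c * ip x x = cnj c * ip x x"
    by (metis complex_cnj_mult)
  then have "c = cnj c"
    using pos by (metis less_irrefl mult_right_cancel)
  then have cr: "c = of_real (Re c)"
    by (metis complex_cnj_cancel_iff complex_is_Real_iff Reals_cnj_iff of_real_Re)
  show ?case
  proof (cases "Re c \<le> 0")
    case True
    then show ?thesis
      using x c cr by metis
  next
    case False
    define W' where "W' = {y \<in> W. ip y x = 0}"
    have W': "csubspace W'" "W' \<subseteq> W"
      unfolding W'_def using W
      by (auto simp: complex_vector.subspace_def ips)
    obtain B' where B': "B' \<subseteq> W'" "complex_vector.independent B'" "W' \<subseteq> cspan B'"
      using complex_vector.basis_exists[of W'] by metis
    have span: "cspan B' = W'"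
      using B' W' complex_vector.span_minimal by blast
    have xB': "x \<notin> cspan B'"
      using pos unfolding span W'_def by auto
    have sub: "insert x B' \<subseteq> cspan B"
      using x(1) B'(1) W'(2) unfolding WB by blast
    have "finite (insert x B') \<and> card (insert x B') \<le> card B"
      by (rule complex_vector.independent_span_bound[OF less.prems(1) _ sub])
        (rule complex_vector.independent_insertI[OF xB' B'(2)])
    then have card: "finite B'" "card B' < card B"
      using xB' complex_vector.span_base[of x B'] by (auto simp: card_insert_if split: if_splits)
    have hx: "h y x = 0" "h x y = 0" if "y \<in> W'" for y
    proof -
      have "y \<in> W" "ip y x = 0"
        using that by (auto simp: W'_def)
      then have "ip x y = 0"
        using inner_product_onD(3)[OF ip x(1), of y] by simp
      then show "h x y = 0"
        using c \<open>y \<in> W\<close> by simp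
      then show "h y x = 0"
        using herm[OF \<open>y \<in> W\<close> x(1)] by simp
    qed
    have split: "\<exists>a y'. y' \<in> W' \<and> y = a *\<^sub>C x + y'" if "y \<in> W" for y
    proof -
      let ?a = "ip y x / ip x x"
      have "y - ?a *\<^sub>C x \<in> W'"
        using that x(1) W pos unfolding W'_def
        by (auto simp: ips complex_vector.subspace_diff complex_vector.subspace_scale)
      then show ?thesis
        by (intro exI[of _ ?a] exI[of _ "y - ?a *\<^sub>C x"]) simp
    qed
    obtain a z' where z': "z' \<in> W'" "z = a *\<^sub>C x + z'"
      using split[OF z(1)] by blast
    have hz: "h z z = a * cnj a * (c * ip x x) + h z' z'"
      by (simp add: z'(2) hs hx[OF z'(1)] c[OF x(1)] algebra_simps)
    have "a * cnj a = of_real ((cmod a)\<^sup>2)"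
      by (rule complex_norm_square[symmetric])
    then have "a * cnj a * (c * ip x x) = of_real ((cmod a)\<^sup>2 * (Re c * Re (ip x x)))"
      using cr pos' by (simp add: complex_eq_iff)
    then have Rez: "Re (h z z) = (cmod a)\<^sup>2 * (Re c * Re (ip x x)) + Re (h z' z')"
      using hz by simp
    have "Re c * Re (ip x x) > 0"
      using False pos' by simp
    then have nonneg: "(cmod a)\<^sup>2 * (Re c * Re (ip x x)) \<ge> 0"
      and strict: "a \<noteq> 0 \<Longrightarrow> (cmod a)\<^sup>2 * (Re c * Re (ip x x)) > 0"
      by auto
    have Rez': "Re (h z' z') \<le> 0"
      using Rez nonneg z(3) by linarith
    have "z' \<noteq> 0"
    proof
      assume "z' = 0"
      then have "a \<noteq> 0"
        using z(2) z'(2) by auto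
      then show False
        using strict Rez z(3) \<open>z' = 0\<close> by (simp add: hs)
    qed
    then obtain x' c' where x': "x' \<in> W'" "x' \<noteq> 0" and c': "c' \<le> 0"
      "\<And>y. y \<in> W' \<Longrightarrow> h x' y = of_real c' * ip x' y"
      using less.hyps[OF card(2,1) span[symmetric] inner_product_on_subset[OF ip W'(2)] _ z'(1) _ Rez'] herm W'(2)
      by blast
    have "h x' y = of_real c' * ip x' y" if y: "y \<in> W" for y
    proof -
      obtain a y' where y': "y' \<in> W'" "y = a *\<^sub>C x + y'"
        using split[OF y] by blast
      then show ?thesis
        using c'(2)[OF y'(1)] hx[OF x'(1)] x'(1) by (simp add: hs ips W'_def)
    qed
    then show ?thesis
      using x' c'(1) W'(2) by blast
  qed
qed

lemma finite_dimensional_embedding: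
  fixes W :: "'b::complex_vector set"
  assumes inf: "\<not> (\<exists>B :: 'v::complex_vector set. finite B \<and> cspan B = UNIV)"
    and W: "finite B" "W \<subseteq> cspan B"
  shows "\<exists>(j :: 'b \<Rightarrow> 'v) k. clinear j \<and> clinear k \<and> (\<forall>x\<in>W. k (j x) = x)"
proof -
  interpret bv: vector_space_pair "scaleC :: complex \<Rightarrow> 'b \<Rightarrow> 'b" "scaleC :: complex \<Rightarrow> 'v \<Rightarrow> 'v" ..
  interpret vb: vector_space_pair "scaleC :: complex \<Rightarrow> 'v \<Rightarrow> 'v" "scaleC :: complex \<Rightarrow> 'b \<Rightarrow> 'b" ..
  obtain C where C: "C \<subseteq> cspan B" "complex_vector.independent C"
      "cspan B \<subseteq> cspan C"
    using complex_vector.basis_exists[of "cspan B"] by metis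
  have finC: "finite C"
    using complex_vector.independent_span_bound[OF W(1) C(2,1)] by blast
  obtain A :: "'v set" where A: "complex_vector.independent A" "UNIV \<subseteq> cspan A"
    using complex_vector.basis_exists[of "UNIV :: 'v set"] by metis
  have "infinite A"
    using inf A(2) by auto
  then obtain S where S: "S \<subseteq> A" "finite S" "card S = card C"
    using infinite_arbitrarily_large by blast
  have indS: "complex_vector.independent S"
    using A(1) S(1) complex_vector.independent_mono by blast
  obtain f where f: "bij_betw f C S"
    using finite_same_card_bij[OF finC S(2)] S(3) by metis
  obtain j where j: "clinear j" "\<And>x. x \<in> C \<Longrightarrow> j x = f x"
    using bv.linear_independent_extend[OF C(2), of f] by blast
  obtain k where k: "clinear k" "\<And>x. x \<in> S \<Longrightarrow> k x = inv_into C f x"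
    using vb.linear_independent_extend[OF indS, of "inv_into C f"] by blast
  have "k (j x) = x" if "x \<in> C" for x
    using that f j(2) k(2) bij_betw_inv_into_left[OF f] by (metis bij_betwE)
  then have "\<And>x. x \<in> cspan C \<Longrightarrow> k (j x) = x"
    by (induct_tac x rule: complex_vector.span_induct_alt)
      (use j(1) k(1) in \<open>auto simp: clinear_0 clinear_add clinear_scaleC\<close>)
  then show ?thesis
    using j(1) k(1) W(2) C(3) by blast
qed

section \<open>Unitary comodules from a positive integral\<close>

lemma coordinates_exist:
  "\<exists>coord :: 'v::complex_vector \<Rightarrow> 'v \<Rightarrow> complex. (\<forall>b. clinear (coord b)) \<and>
    (\<forall>w. finite {b. coord b w \<noteq> 0}) \<and> (\<forall>w. (\<Sum>b | coord b w \<noteq> 0. coord b w *\<^sub>C b) = w)"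
proof -
  obtain A :: "'v set" where A: "complex_vector.independent A" "UNIV \<subseteq> cspan A"
    using complex_vector.basis_exists[of "UNIV :: 'v set"] by metis
  then have UNIV: "v \<in> cspan A" for v
    by auto
  show ?thesis
  proof (intro exI[of _ "\<lambda>b w. complex_vector.representation A w b"] conjI allI)
    show "clinear (\<lambda>w. complex_vector.representation A w b)" for b
      by (rule clinearI)
        (simp_all add: complex_vector.representation_add[OF A(1) UNIV UNIV]
          complex_vector.representation_scale[OF A(1) UNIV] complex_scaleC_def)
  qed (simp_all add: complex_vector.finite_representation
      complex_vector.sum_nonzero_representation_eq[OF A(1) UNIV])
qed

context integral_star_hopf_algebra begin

abbreviation form :: "'a \<Rightarrow> 'a \<Rightarrow> complex"
  where "form \<equiv> integral_inner H \<phi>"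

lemma form_def: "form x y = \<phi> (y\<^bold>* \<cdot> x)"
  by (simp add: integral_inner_def)

lemma lin_form [lin]: "clinear f \<Longrightarrow> clinear (\<lambda>x. form (f x) y)"
  unfolding form_def by (intro lin)

lemma form_hermitian: "form x y = cnj (form y x)"
  by (simp add: form_def integral_star[symmetric] star_mult star_star)

lemma form_conjugate_linear: "conjugate_linear (form x)"
  using lin_form[OF clinear_id, of x]
  by (subst form_hermitian[abs_def]) (simp add: conjugate_linear_def clinear_iff complex_scaleC_def)

lemmas form_simps = sesquilinear_simps[of form, OF allI[OF lin_form[OF clinear_id]]
    allI[OF form_conjugate_linear]]

lemma form_invariant:
  "sw (\<lambda>a b. form a y *\<^sub>C \<S> b) x = sw (\<lambda>a b. form x a *\<^sub>C b\<^bold>*) y"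
proof -
  have "sw (\<lambda>a b. form a y *\<^sub>C \<S> b) x = sw (\<lambda>a b. \<phi> (a \<cdot> x) *\<^sub>C b) (y\<^bold>*)"
    unfolding form_def by (rule integral_move_right)
  also have "\<dots> = sw (\<lambda>a b. \<phi> (a\<^bold>* \<cdot> x) *\<^sub>C b\<^bold>*) y"
    by (rule sweedler2_star) (intro lin)
  finally show ?thesis
    unfolding form_def .
qed

text \<open>
  The coordinates of the coaction in a basis of the ambient space are comodule maps to the regular
  comodule. The inner product is the sum of the pull-backs of \<open>form\<close> along all of them; the sum is finite at each pair
  of vectors, and definite because the coordinate maps are jointly injective by the counit axiom.
\<close>

lemma invariant_inner_product_exists:
  fixes V :: "'v::complex_vector set"
  assumes pos: "\<And>x. x \<noteq> 0 \<Longrightarrow> form x x > 0" and com: "right_comodule H V \<rho>"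
  shows "\<exists>ip. invariant_inner_product_on H V \<rho> ip"
proof -
  obtain coord :: "'v \<Rightarrow> 'v \<Rightarrow> complex" where coord: "\<And>b. clinear (coord b)"
      "\<And>w. finite {b. coord b w \<noteq> 0}" "\<And>w. (\<Sum>b | coord b w \<noteq> 0. coord b w *\<^sub>C b) = w"
    using coordinates_exist[where 'v = 'v] by (elim exE conjE) (rule that; erule spec)
  have coord0: "w = 0" if "\<And>b. coord b w = 0" for w
    by (subst coord(3)[symmetric]) (simp add: that)
  note cl = lin clinear_compose[OF coord(1)]
  note com' = com[unfolded right_comodule_def]
  have \<rho>: "clinear \<rho>"
    by (rule com'[THEN conjunct2, THEN conjunct1])
  have coassoc: "tensor_sum (\<lambda>v\<^sub>0 h. sw (\<lambda>h\<^sub>1 h\<^sub>2. v\<^sub>0 \<otimes> h\<^sub>1 \<otimes> h\<^sub>2) h) (\<rho> v) =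
      tensor_sum (\<lambda>w h\<^sub>2. tensor_sum (\<lambda>v\<^sub>0 h\<^sub>1. v\<^sub>0 \<otimes> h\<^sub>1 \<otimes> h\<^sub>2) (\<rho> w)) (\<rho> v)" if "v \<in> V" for v
    by (rule com'[THEN conjunct2, THEN conjunct2, THEN conjunct2, THEN conjunct1, rule_format, OF that])
  have counit: "tensor_sum (\<lambda>v\<^sub>0 h. counit H h *\<^sub>C v\<^sub>0) (\<rho> v) = v" if "v \<in> V" for v
    by (rule com'[THEN conjunct2, THEN conjunct2, THEN conjunct2, THEN conjunct2, rule_format, OF that])
  \<comment> \<open>The coordinate with index \<open>b\<close> of the coaction, a map to the Hopf algebra.\<close>
  define c where "c b u = tensor_sum (\<lambda>w h. coord b w *\<^sub>C h) (\<rho> u)" for b u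
  have c: "clinear (c b)" for b
    unfolding c_def[abs_def] by (intro cl clinear_compose[OF \<rho>])
  have "finite {b. tensor_sum (\<lambda>w h. coord b w *\<^sub>C h) t \<noteq> 0}" for t :: "('v, 'a) tensor"
  proof (induction t rule: tensor_induct)
    case zero
    have "tensor_sum (\<lambda>w h. coord b w *\<^sub>C h) (0 :: ('v, 'a) tensor) = 0" for b
      by (rule clinear_0) (intro cl clinear_tensor_sum)
    then show ?case
      by simp
  next
    case (add x y t)
    have "cbilinear (\<lambda>w h :: 'a. coord b w *\<^sub>C h)" for b
      by (intro cl)
    then have "tensor_sum (\<lambda>w h. coord b w *\<^sub>C h) (x \<otimes> y + t) =
        coord b x *\<^sub>C y + tensor_sum (\<lambda>w h. coord b w *\<^sub>C h) t" for b
      by (simp add: clinear_add[OF clinear_tensor_sum] tensor_universal_property(2))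
    then have "{b. tensor_sum (\<lambda>w h. coord b w *\<^sub>C h) (x \<otimes> y + t) \<noteq> 0} \<subseteq>
        {b. coord b x \<noteq> 0} \<union> {b. tensor_sum (\<lambda>w h. coord b w *\<^sub>C h) t \<noteq> 0}"
      by auto
    then show ?case
      using add coord(2)[of x] by (meson finite_UnI finite_subset)
  qed
  then have fin: "finite {b. c b u \<noteq> 0}" for u
    by (simp add: c_def)
  have colinear: "tensor_sum (\<lambda>w h. F (c b w) h) (\<rho> u) = sw F (c b u)"
    if u: "u \<in> V" and F: "cbilinear F" for b u and F :: "'a \<Rightarrow> 'a \<Rightarrow> 'a"
  proof -
    let ?L = "tensor_sum (\<lambda>w t. coord b w *\<^sub>C tensor_sum F t)"
    note Fl = cbilinear_left[OF F] cbilinear_right[OF F]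
    have bil: "cbilinear (\<lambda>w t. coord b w *\<^sub>C tensor_sum F t)"
      by (intro cl Fl clinear_tensor_sum F)
    have L: "clinear ?L" and pure: "?L (w \<otimes> h \<otimes> h') = coord b w *\<^sub>C F h h'" for w h h'
      using bil by (simp_all add: clinear_tensor_sum tensor_universal_property(2) F)
    have "tensor_sum (\<lambda>v\<^sub>0 h. sw (\<lambda>h\<^sub>1 h\<^sub>2. coord b v\<^sub>0 *\<^sub>C F h\<^sub>1 h\<^sub>2) h) (\<rho> u) =
      tensor_sum (\<lambda>w h\<^sub>2. tensor_sum (\<lambda>v\<^sub>0 h\<^sub>1. coord b v\<^sub>0 *\<^sub>C F h\<^sub>1 h\<^sub>2) (\<rho> w)) (\<rho> u)"
      using arg_cong[OF coassoc[OF u], of ?L]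
      by (simp add: linear_tensor_sum[OF L] sweedler2_linear[OF L] pure)
    moreover have "sw F (c b u) =
        tensor_sum (\<lambda>v\<^sub>0 h. sw (\<lambda>h\<^sub>1 h\<^sub>2. coord b v\<^sub>0 *\<^sub>C F h\<^sub>1 h\<^sub>2) h) (\<rho> u)"
    proof -
      have S: "clinear (sw F)"
        by (intro lin Fl)
      show ?thesis
        by (simp add: c_def linear_tensor_sum[OF S] clinear_scaleC[OF S] sweedler2_scaleC_right)
    qed
    moreover have "F (c b w) h = tensor_sum (\<lambda>v\<^sub>0 h\<^sub>1. coord b v\<^sub>0 *\<^sub>C F h\<^sub>1 h) (\<rho> w)" for w h
    proof -
      have S: "clinear (\<lambda>x. F x h)"
        by (intro Fl lin)
      show ?thesis
        by (simp add: c_def linear_tensor_sum[OF S] clinear_scaleC[OF S])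
    qed
    ultimately show ?thesis
      by simp
  qed
  define ip where "ip u v = (\<Sum>b | c b u \<noteq> 0 \<and> c b v \<noteq> 0. form (c b u) (c b v))" for u v
  have ip: "ip u v = (\<Sum>b\<in>A. form (c b u) (c b v))"
    if "finite A" "\<And>b. c b u \<noteq> 0 \<Longrightarrow> c b v \<noteq> 0 \<Longrightarrow> b \<in> A" for u v A
    unfolding ip_def by (rule sum.mono_neutral_left) (use that in \<open>auto simp: form_simps\<close>)
  have ip_left: "ip u v = (\<Sum>b | c b v \<noteq> 0. form (c b u) (c b v))" for u v
    by (rule ip) (use fin in auto)
  have ip_right: "ip u v = (\<Sum>b | c b u \<noteq> 0. form (c b u) (c b v))" for u v
    by (rule ip) (use fin in auto)
  have ip_lin: "clinear (\<lambda>u. ip u v)" for v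
    unfolding ip_left by (intro lin clinear_compose[OF c])
  have herm: "ip u v = cnj (ip v u)" for u v
  proof -
    have "cnj (ip v u) = (\<Sum>b | c b u \<noteq> 0. cnj (form (c b v) (c b u)))"
      unfolding ip_left by simp
    then show ?thesis
      by (simp add: ip_right form_hermitian[symmetric])
  qed
  have ip_conj: "conjugate_linear (ip u)" for u
    using ip_lin[of u]
    by (subst herm[abs_def]) (simp add: conjugate_linear_def clinear_iff complex_scaleC_def)
  have ip_pos: "ip u u > 0" if u: "u \<in> V" "u \<noteq> 0" for u
  proof -
    have "\<exists>b. c b u \<noteq> 0"
    proof (rule ccontr)
      assume *: "\<nexists>b. c b u \<noteq> 0"
      have "coord b u = 0" for b
      proof -
        have "coord b u = counit H (c b u)"
          using arg_cong[OF counit[OF u(1)], of "coord b"]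
          by (simp add: c_def linear_tensor_sum[OF coord(1)] linear_tensor_sum[OF counit_linear]
              clinear_scaleC[OF coord(1)] clinear_scaleC[OF counit_linear] complex_scaleC_def mult.commute)
        then show ?thesis
          using * by (simp add: clinear_0[OF counit_linear])
      qed
      then show False
        using coord0 u(2) by blast
    qed
    then have ne: "{b. c b u \<noteq> 0} \<noteq> {}"
      by blast
    have "0 < (\<Sum>b | c b u \<noteq> 0. form (c b u) (c b u))"
      by (rule sum_pos[OF fin ne]) (simp add: pos)
    then show ?thesis
      by (simp add: ip_left)
  qed
  have inv: "tensor_sum (\<lambda>u\<^sub>0 u\<^sub>1. ip u\<^sub>0 v *\<^sub>C \<S> u\<^sub>1) (\<rho> u) = tensor_sum (\<lambda>v\<^sub>0 v\<^sub>1. ip u v\<^sub>0 *\<^sub>C v\<^sub>1\<^bold>*) (\<rho> v)"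
    if u: "u \<in> V" and v: "v \<in> V" for u v
  proof -
    let ?A = "{b. c b u \<noteq> 0} \<union> {b. c b v \<noteq> 0}"
    have A: "finite ?A"
      using fin by simp
    have "tensor_sum (\<lambda>u\<^sub>0 u\<^sub>1. ip u\<^sub>0 v *\<^sub>C \<S> u\<^sub>1) (\<rho> u) =
        (\<Sum>b\<in>?A. tensor_sum (\<lambda>u\<^sub>0 u\<^sub>1. form (c b u\<^sub>0) (c b v) *\<^sub>C \<S> u\<^sub>1) (\<rho> u))"
      by (subst ip[OF A]) (auto simp: sum_tensor_sum_swap complex_vector.scale_sum_left)
    also have "\<dots> = (\<Sum>b\<in>?A. sw (\<lambda>x y. form x (c b v) *\<^sub>C \<S> y) (c b u))"
      by (rule sum.cong[OF HOL.refl], rule colinear[OF u]) (intro lin)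
    also have "\<dots> = (\<Sum>b\<in>?A. sw (\<lambda>x y. form (c b u) x *\<^sub>C y\<^bold>*) (c b v))"
      by (simp only: form_invariant)
    also have "\<dots> = (\<Sum>b\<in>?A. (sw (\<lambda>x y. form x (c b u) *\<^sub>C y) (c b v))\<^bold>*)"
      by (simp only: star_sweedler2 star_scaleC form_hermitian[symmetric])
    also have "\<dots> = (\<Sum>b\<in>?A. (tensor_sum (\<lambda>v\<^sub>0 v\<^sub>1. form (c b v\<^sub>0) (c b u) *\<^sub>C v\<^sub>1) (\<rho> v))\<^bold>*)"
      by (intro sum.cong[OF HOL.refl] arg_cong[where f = "hstar H"] colinear[OF v, symmetric] lin)
    also have "\<dots> = (\<Sum>b\<in>?A. tensor_sum (\<lambda>v\<^sub>0 v\<^sub>1. form (c b u) (c b v\<^sub>0) *\<^sub>C v\<^sub>1\<^bold>*) (\<rho> v))"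
      by (simp only: conjugate_linear_tensor_sum[OF star_conjugate_linear] star_scaleC
          form_hermitian[symmetric])
    also have "\<dots> = tensor_sum (\<lambda>v\<^sub>0 v\<^sub>1. ip u v\<^sub>0 *\<^sub>C v\<^sub>1\<^bold>*) (\<rho> v)"
      by (subst ip[OF A]) (auto simp: sum_tensor_sum_swap complex_vector.scale_sum_left)
    finally show ?thesis .
  qed
  have "inner_product_on V ip"
    unfolding inner_product_on_def
    by (intro conjI allI ballI impI) (rule ip_lin ip_conj herm ip_pos; assumption?)+
  then have "invariant_inner_product_on H V \<rho> ip"
    unfolding invariant_inner_product_on_def using inv by blast
  then show ?thesis
    by blast
qed

end

section \<open>Finite-dimensional subcomodules\<close>

lemma balanced_tensor_sum_0: "balanced B \<Longrightarrow> tensor_sum B 0 = 0"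
  using tensor_sum_add[of B 0 0] by simp

lemma tensor_sum_tensor_sum:
  assumes "balanced B"
  shows "tensor_sum B (tensor_sum F t) = tensor_sum (\<lambda>x y. tensor_sum B (F x y)) t"
  by (rule additive_tensor_sum) (rule tensor_sum_add[OF assms])

lemma conjugate_bilinear_balanced:
  assumes "clinear f" and "conjugate_linear g"
  shows "balanced (\<lambda>a b. cnj (f a) *\<^sub>C (g b :: 'a::complex_vector))"
  by (rule conjugate_bilinear_imp_balanced)
    (use assms in \<open>simp_all add: conjugate_linear_def clinear_iff scaleC_add_left scaleC_add_right
      scaleC_scaleC complex_scaleC_def mult.commute\<close>)

text \<open>
  The sum is computed from a representative of \<open>t\<close>, which may contain vectors outside \<open>W\<close>. This lemma
  nevertheless allows rewriting that is valid only for vectors in \<open>W\<close>.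
\<close>

lemma tensor_sum_eq_on_subspace:
  assumes W: "csubspace W" and t: "t \<in> cspan {w \<otimes> h | w h. w \<in> W}"
    and B: "balanced B" and C: "balanced C"
    and eq: "\<And>w h. w \<in> W \<Longrightarrow> B w h = C w h"
  shows "tensor_sum B t = tensor_sum C t"
  using t
proof (induction t rule: complex_vector.span_induct_alt)
  case base
  then show ?case
    by (simp add: balanced_tensor_sum_0 B C)
next
  case (step c x y)
  then obtain w h where x: "x = w \<otimes> h" "w \<in> W"
    by blast
  have "c *\<^sub>C x = (c *\<^sub>C w) \<otimes> h"
    unfolding x by (rule clinear_scaleC[OF clinear_pure_left[OF clinear_id], symmetric])
  then show ?case
    using step(2) eq[OF complex_vector.subspace_scale[OF W x(2)]]
    by (simp add: tensor_sum_add B C)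
qed

lemma tensor_expansion:
  fixes coord :: "'b::complex_vector \<Rightarrow> 'b \<Rightarrow> complex" and t :: "('a::complex_vector, 'b) tensor"
  assumes lin: "\<And>b. clinear (coord b)" and fin: "\<And>w. finite {b. coord b w \<noteq> 0}"
    and exp: "\<And>w. (\<Sum>b | coord b w \<noteq> 0. coord b w *\<^sub>C b) = w"
  shows "\<exists>S. finite S \<and> t = (\<Sum>b\<in>S. tensor_sum (\<lambda>x y. coord b y *\<^sub>C x) t \<otimes> b)"
proof -
  let ?c = "\<lambda>b. tensor_sum (\<lambda>(x::'a) y. coord b y *\<^sub>C x)"
  have bil: "cbilinear (\<lambda>(x::'a) y. coord b y *\<^sub>C x)" for b
    by (intro lin cbilinearI clinear_scaleC_const clinear_const_scaleC clinear_id)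
  \<comment> \<open>The index sets of two summands have to be merged, hence all larger sets are included.\<close>
  have "\<exists>S. finite S \<and> (\<forall>S'. finite S' \<longrightarrow> S \<subseteq> S' \<longrightarrow> t = (\<Sum>b\<in>S'. ?c b t \<otimes> b))"
  proof (induction t rule: tensor_induct)
    case zero
    have "?c b 0 \<otimes> b = 0" for b
      by (simp add: clinear_0[OF clinear_tensor_sum[OF bil]] clinear_0[OF clinear_pure_left[OF clinear_id]])
    then show ?case
      by (intro exI[of _ "{}"]) simp
  next
    case (add x y t)
    then obtain S where S: "finite S"
        "\<And>S'. finite S' \<Longrightarrow> S \<subseteq> S' \<Longrightarrow> (\<Sum>b\<in>S'. ?c b t \<otimes> b) = t"
      by (elim exE conjE) (rule that, assumption, rule HOL.sym, simp only:)
    show ?case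
    proof (intro exI[of _ "S \<union> {b. coord b y \<noteq> 0}"] conjI allI impI)
      show "finite (S \<union> {b. coord b y \<noteq> 0})"
        using S(1) fin by simp
      fix S' assume S': "finite S'" "S \<union> {b. coord b y \<noteq> 0} \<subseteq> S'"
      have "(\<Sum>b\<in>S'. (coord b y *\<^sub>C x) \<otimes> b) = (\<Sum>b\<in>S'. x \<otimes> (coord b y *\<^sub>C b))"
        by (simp add: clinear_scaleC[OF clinear_pure_left[OF clinear_id]]
            clinear_scaleC[OF clinear_pure_right[OF clinear_id]])
      also have "\<dots> = x \<otimes> (\<Sum>b\<in>S'. coord b y *\<^sub>C b)"
        by (rule clinear_sum[OF clinear_pure_right[OF clinear_id], symmetric])
      also have "(\<Sum>b\<in>S'. coord b y *\<^sub>C b) = (\<Sum>b | coord b y \<noteq> 0. coord b y *\<^sub>C b)"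
        by (rule sum.mono_neutral_right) (use S' in auto)
      finally have xy: "(\<Sum>b\<in>S'. (coord b y *\<^sub>C x) \<otimes> b) = x \<otimes> y"
        by (simp only: exp)
      have "(\<Sum>b\<in>S'. ?c b (x \<otimes> y + t) \<otimes> b) =
          (\<Sum>b\<in>S'. (coord b y *\<^sub>C x) \<otimes> b) + (\<Sum>b\<in>S'. ?c b t \<otimes> b)"
        by (simp only: clinear_add[OF clinear_tensor_sum[OF bil]] tensor_universal_property(2)[OF bil]
            clinear_add[OF clinear_pure_left[OF clinear_id]] sum.distrib)
      then show "x \<otimes> y + t = (\<Sum>b\<in>S'. ?c b (x \<otimes> y + t) \<otimes> b)"
        unfolding xy using S(2)[OF S'(1)] S'(2) by simp
    qed
  qed
  then show ?thesis
    by (elim exE conjE) (intro exI conjI, assumption, simp only: subset_refl)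
qed

definition subcomodule :: "'a::complex_vector star_hopf_data \<Rightarrow> 'a set \<Rightarrow> bool"
  where "subcomodule H W \<longleftrightarrow> csubspace W \<and>
    (\<forall>x\<in>W. comult H x \<in> cspan {w \<otimes> h | w h. w \<in> W})"

context hopf_algebra begin

text \<open>
  Expand the second leg of the coproduct of \<open>z\<close> in a basis. The finitely many first legs span a subcomodule by
  coassociativity, and it contains \<open>z\<close> by the counit axiom.
\<close>

lemma finite_subcomodule:
  "\<exists>B. finite B \<and> z \<in> cspan B \<and> subcomodule H (cspan B)"
proof -
  obtain coord :: "'a \<Rightarrow> 'a \<Rightarrow> complex" where coord: "\<And>b. clinear (coord b)"
      "\<And>w. finite {b. coord b w \<noteq> 0}" "\<And>w. (\<Sum>b | coord b w \<noteq> 0. coord b w *\<^sub>C b) = w"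
    using coordinates_exist[where 'v = 'a] by (elim exE conjE) (rule that; erule spec)
  note cl = lin clinear_compose[OF coord(1)]
  define c where "c b = sw (\<lambda>x y. coord b y *\<^sub>C x) z" for b
  obtain S where S: "finite S" "comult H z = (\<Sum>b\<in>S. c b \<otimes> b)"
    using tensor_expansion[OF coord, of "comult H z"] by (auto simp: c_def sweedler2_def)
  let ?W = "cspan (c ` S)"
  have cW: "c b \<in> ?W" if "b \<in> S" for b
    using that by (simp add: complex_vector.span_base)
  have eval: "tensor_sum B (comult H z) = (\<Sum>b\<in>S. B (c b) b)" if B: "cbilinear B"
    for B :: "'a \<Rightarrow> 'a \<Rightarrow> 'd::complex_vector"
    by (simp add: S(2) clinear_sum[OF clinear_tensor_sum[OF B]] tensor_universal_property(2)[OF B])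
  have "z = (\<Sum>b\<in>S. counit H b *\<^sub>C c b)"
    using counit_right[of z] eval[of "\<lambda>a b. counit H b *\<^sub>C a"]
    by (simp add: sweedler2_def lin)
  also have "\<dots> \<in> ?W"
    using cW by (intro complex_vector.span_sum complex_vector.span_scale)
  finally have z: "z \<in> ?W" .
  let ?WH = "cspan {w \<otimes> h | w h. w \<in> ?W}"
  have gen: "comult H (c b) \<in> ?WH" for b
  proof -
    define g where "g u = sw (\<lambda>q y. coord b y *\<^sub>C q) u" for u
    have g: "clinear g"
      unfolding g_def[abs_def] by (intro cl)
    have "comult H (c b) = sw (\<lambda>x y. sw (\<lambda>p q. coord b y *\<^sub>C (p \<otimes> q)) x) z"
      unfolding c_def
      by (simp add: sweedler2_linear[OF comult_linear] clinear_scaleC[OF comult_linear]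
          sweedler2_scaleC_right[symmetric])
        (simp add: sweedler2_def tensor_sum_pure_tensor)
    also have "\<dots> = sw (\<lambda>p u. sw (\<lambda>q y. coord b y *\<^sub>C (p \<otimes> q)) u) z"
      by (rule sweedler2_assoc) (intro cl)+
    also have "\<dots> = sw (\<lambda>p u. p \<otimes> g u) z"
      by (simp add: g_def sweedler2_linear[OF clinear_pure_right[OF clinear_id]]
          clinear_scaleC[OF clinear_pure_right[OF clinear_id]])
    also have "\<dots> = (\<Sum>b\<in>S. c b \<otimes> g b)"
      unfolding sweedler2_def by (rule eval) (intro lin clinear_compose[OF g])
    also have "\<dots> \<in> ?WH"
    proof (rule complex_vector.span_sum)
      fix b assume "b \<in> S"
      then show "c b \<otimes> g b \<in> ?WH"
        using cW[of b] by (intro complex_vector.span_base) blast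
    qed
    finally show ?thesis .
  qed
  have "comult H x \<in> ?WH" if "x \<in> ?W" for x
    using that
  proof (induction x rule: complex_vector.span_induct_alt)
    case base
    then show ?case
      by (simp add: clinear_0[OF comult_linear] complex_vector.span_zero)
  next
    case (step a x y)
    then obtain b where "x = c b"
      by blast
    then show ?case
      using step(2) gen
      by (simp add: clinear_add[OF comult_linear] clinear_scaleC[OF comult_linear]
          complex_vector.span_add complex_vector.span_scale)
  qed
  then have "subcomodule H ?W"
    by (simp add: subcomodule_def)
  then show ?thesis
    using S(1) z by blast
qed

end

context star_hopf_algebra begin

lemma sweedler2_eq_on_subcomodule:
  assumes "subcomodule H W" "x \<in> W" "balanced B" "balanced C" "\<And>w h. w \<in> W \<Longrightarrow> B w h = C w h"
  shows "sw B x = sw C x"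
  unfolding sweedler2_def
  by (rule tensor_sum_eq_on_subspace[of W]) (use assms in \<open>auto simp: subcomodule_def\<close>)

text \<open>
  The defining property of a compact quantum group speaks about subspaces of one ambient space, which is
  infinite-dimensional. So a finite-dimensional subcomodule is embedded there and the inner product of
  its image is pulled back.
\<close>

lemma subcomodule_invariant_form:
  assumes inf: "\<not> (\<exists>B :: 'v::complex_vector set. finite B \<and> cspan B = UNIV)"
    and cqg: "compact_quantum_group TYPE('v) H"
    and W: "finite B" "W = cspan B" "subcomodule H W"
  shows "\<exists>ip. inner_product_on W ip \<and> (\<forall>u\<in>W. \<forall>v\<in>W.
    sw (\<lambda>a b. ip a v *\<^sub>C \<S> b) u = sw (\<lambda>a b. ip u a *\<^sub>C b\<^bold>*) v)"
proof -
  have sub: "csubspace W"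
    using W(3) by (simp add: subcomodule_def)
  have "W \<subseteq> cspan B"
    by (simp add: W(2))
  from finite_dimensional_embedding[OF inf W(1) this]
  obtain j :: "'a \<Rightarrow> 'v" and k where j: "clinear j" and k: "clinear k" and kj: "\<And>x. x \<in> W \<Longrightarrow> k (j x) = x"
    by (elim exE conjE) (rule that; (assumption | drule (1) bspec)+)
  note cl = lin clinear_compose[OF j] clinear_compose[OF k]
  define \<rho> where "\<rho> v = sw (\<lambda>a h. j a \<otimes> h) (k v)" for v
  have \<rho>: "clinear \<rho>"
    unfolding \<rho>_def[abs_def] by (intro cl)
  have \<rho>j: "\<rho> (j x) = sw (\<lambda>a h. j a \<otimes> h) x" if "x \<in> W" for x
    by (simp add: \<rho>_def kj that)
  have eval: "tensor_sum F (\<rho> (j x)) = sw (\<lambda>a h. F (j a) h) x"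
    if "balanced F" "x \<in> W" for F :: "'v \<Rightarrow> 'a \<Rightarrow> 'd::complex_vector" and x
    unfolding \<rho>j[OF that(2)] sweedler2_def by (simp add: tensor_sum_tensor_sum that(1))
  have "right_comodule H (j ` W) \<rho>"
    unfolding right_comodule_def
  proof (intro conjI ballI)
    show "csubspace (j ` W)"
    proof (rule complex_vector.subspaceI)
      show "0 \<in> j ` W"
        using clinear_0[OF j] complex_vector.subspace_0[OF sub] by (metis imageI)
      show "x + y \<in> j ` W" if "x \<in> j ` W" "y \<in> j ` W" for x y
        using that complex_vector.subspace_add[OF sub] by (auto simp: clinear_add[OF j, symmetric])
      show "c *\<^sub>C x \<in> j ` W" if "x \<in> j ` W" for x c
        using that complex_vector.subspace_scale[OF sub] by (auto simp: clinear_scaleC[OF j, symmetric])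
    qed
    show "clinear \<rho>" by (rule \<rho>)
    let ?VH = "cspan {v \<otimes> h | v h. v \<in> j ` W} :: ('v, 'a) tensor set"
    have "tensor_sum (\<lambda>a h. j a \<otimes> h) t \<in> ?VH"
      if "t \<in> cspan {w \<otimes> h | w h. w \<in> W}" for t :: "('a, 'a) tensor"
      using that
    proof (induction t rule: complex_vector.span_induct_alt)
      case base
      have "tensor_sum (\<lambda>a h. j a \<otimes> h) (0 :: ('a, 'a) tensor) = 0"
        by (rule clinear_0) (intro cl clinear_tensor_sum)
      then show ?case
        by (simp add: complex_vector.span_zero)
    next
      case (step c x y)
      then obtain w h where x: "x = w \<otimes> h" "w \<in> W"
        by blast
      have bil: "cbilinear (\<lambda>a (h::'a). j a \<otimes> h)"
        by (intro cl)
      have "j w \<otimes> h \<in> ?VH"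
        using x(2) by (intro complex_vector.span_base) blast
      then show ?case
        using step(2)
        by (simp add: x(1) clinear_add[OF clinear_tensor_sum[OF bil]]
            clinear_scaleC[OF clinear_tensor_sum[OF bil]] tensor_universal_property(2)[OF bil]
            complex_vector.span_add complex_vector.span_scale)
    qed
    then show "\<rho> ` j ` W \<subseteq> ?VH"
      using W(3) by (auto simp: \<rho>j sweedler2_def subcomodule_def)
  next
    fix v assume "v \<in> j ` W"
    then obtain x where x: "x \<in> W" "v = j x"
      by blast
    have "tensor_sum (\<lambda>v\<^sub>0 h. sw (\<lambda>h\<^sub>1 h\<^sub>2. v\<^sub>0 \<otimes> h\<^sub>1 \<otimes> h\<^sub>2) h) (\<rho> v) =
        sw (\<lambda>a h. sw (\<lambda>h\<^sub>1 h\<^sub>2. j a \<otimes> h\<^sub>1 \<otimes> h\<^sub>2) h) x"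
      unfolding x(2) by (rule eval[OF cbilinear_imp_balanced x(1)]) (intro lin)
    also have "\<dots> = sw (\<lambda>a h\<^sub>2. sw (\<lambda>p h\<^sub>1. j p \<otimes> h\<^sub>1 \<otimes> h\<^sub>2) a) x"
      by (rule sweedler2_assoc[symmetric]) (intro cl)+
    also have "\<dots> = sw (\<lambda>a h\<^sub>2. tensor_sum (\<lambda>v\<^sub>0 h\<^sub>1. v\<^sub>0 \<otimes> h\<^sub>1 \<otimes> h\<^sub>2) (\<rho> (j a))) x"
    proof (rule sweedler2_eq_on_subcomodule[OF W(3) x(1)])
      show "balanced (\<lambda>a h\<^sub>2. sw (\<lambda>p h\<^sub>1. j p \<otimes> h\<^sub>1 \<otimes> h\<^sub>2) a)"
        by (rule cbilinear_imp_balanced) (intro cl)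
      show "balanced (\<lambda>a h\<^sub>2. tensor_sum (\<lambda>v\<^sub>0 h\<^sub>1. v\<^sub>0 \<otimes> h\<^sub>1 \<otimes> h\<^sub>2) (\<rho> (j a)))"
        by (rule cbilinear_imp_balanced) (intro cl clinear_compose[OF \<rho>])
      show "sw (\<lambda>p h\<^sub>1. j p \<otimes> h\<^sub>1 \<otimes> h) w = tensor_sum (\<lambda>v\<^sub>0 h\<^sub>1. v\<^sub>0 \<otimes> h\<^sub>1 \<otimes> h) (\<rho> (j w))"
        if "w \<in> W" for w h
        by (rule eval[OF cbilinear_imp_balanced that, symmetric]) (intro lin)
    qed
    also have "\<dots> = tensor_sum (\<lambda>w h\<^sub>2. tensor_sum (\<lambda>v\<^sub>0 h\<^sub>1. v\<^sub>0 \<otimes> h\<^sub>1 \<otimes> h\<^sub>2) (\<rho> w)) (\<rho> v)"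
      unfolding x(2) by (rule eval[OF cbilinear_imp_balanced x(1), symmetric]) (intro lin \<rho>)
    finally show "tensor_sum (\<lambda>v\<^sub>0 h. sw (\<lambda>h\<^sub>1 h\<^sub>2. v\<^sub>0 \<otimes> h\<^sub>1 \<otimes> h\<^sub>2) h) (\<rho> v) =
        tensor_sum (\<lambda>w h\<^sub>2. tensor_sum (\<lambda>v\<^sub>0 h\<^sub>1. v\<^sub>0 \<otimes> h\<^sub>1 \<otimes> h\<^sub>2) (\<rho> w)) (\<rho> v)" .
    have "tensor_sum (\<lambda>v\<^sub>0 h. counit H h *\<^sub>C v\<^sub>0) (\<rho> v) = sw (\<lambda>a h. counit H h *\<^sub>C j a) x"
      unfolding x(2) by (rule eval[OF cbilinear_imp_balanced x(1)]) (intro lin)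
    then show "tensor_sum (\<lambda>v\<^sub>0 h. counit H h *\<^sub>C v\<^sub>0) (\<rho> v) = v"
      by (simp add: sweedler2_counit_right[OF j] x(2))
  qed
  then obtain ip where ip: "invariant_inner_product_on H (j ` W) \<rho> ip"
    using cqg[unfolded compact_quantum_group_def] by blast
  note ip1 = ip[unfolded invariant_inner_product_on_def, THEN conjunct1]
  note ip2 = ip[unfolded invariant_inner_product_on_def, THEN conjunct2, rule_format]
  note D = inner_product_onD[OF ip1]
  note ips = sesquilinear_simps[OF D(1,2)]
  have ipl: "clinear (\<lambda>u. ip u v)" and ipc: "conjugate_linear (ip v)" for v
    using D(1,2) by blast+
  have inj: "j u \<noteq> 0" if "u \<in> W" "u \<noteq> 0" for u
    using that kj clinear_0[OF k] by metis
  have "inner_product_on W (\<lambda>u v. ip (j u) (j v))"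
    unfolding inner_product_on_def
  proof (intro conjI allI ballI impI)
    show "clinear (\<lambda>u. ip (j u) (j v))" for v
      by (rule clinear_compose[OF ipl j])
    show "conjugate_linear (\<lambda>v. ip (j u) (j v))" for u
      using ipc j by (simp add: conjugate_linear_def clinear_iff)
    show "ip (j u) (j v) = cnj (ip (j v) (j u))" if "u \<in> W" "v \<in> W" for u v
      by (rule D(3)) (use that in auto)
    show "ip (j u) (j u) > 0" if "u \<in> W" "u \<noteq> 0" for u
      by (rule D(4)) (use that inj in auto)
  qed
  moreover have "sw (\<lambda>a b. ip (j a) (j v) *\<^sub>C \<S> b) u = sw (\<lambda>a b. ip (j u) (j a) *\<^sub>C b\<^bold>*) v"
    if "u \<in> W" "v \<in> W" for u v
  proof -
    have "sw (\<lambda>a b. ip (j a) (j v) *\<^sub>C \<S> b) u = tensor_sum (\<lambda>a b. ip a (j v) *\<^sub>C \<S> b) (\<rho> (j u))"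
      by (rule eval[OF cbilinear_imp_balanced that(1), symmetric]) (intro lin ipl)
    also have "\<dots> = tensor_sum (\<lambda>a b. ip (j u) a *\<^sub>C b\<^bold>*) (\<rho> (j v))"
      by (rule ip2) (use that in auto)
    also have "\<dots> = sw (\<lambda>a b. ip (j u) (j a) *\<^sub>C b\<^bold>*) v"
      by (rule eval[OF _ that(2)], rule conjugate_bilinear_imp_balanced)
        (simp_all add: conjugate_linear_def star_add star_scaleC ips scaleC_add_left scaleC_add_right
          scaleC_scaleC mult.commute)
    finally show ?thesis .
  qed
  ultimately show ?thesis
    by (intro exI[of _ "\<lambda>u v. ip (j u) (j v)"] conjI ballI)
qed

end

section \<open>Positivity of the integral\<close>

context integral_star_hopf_algebra begin

lemma subcomodule_right_translate:
  assumes W: "subcomodule H W" and x: "x \<in> W" and f: "clinear f"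
  shows "sw (\<lambda>a b. f b *\<^sub>C a) x \<in> W"
proof -
  have sub: "csubspace W"
    using W by (simp add: subcomodule_def)
  have bil: "cbilinear (\<lambda>a b. f b *\<^sub>C a)"
    by (intro lin f)
  have "tensor_sum (\<lambda>a b. f b *\<^sub>C a) t \<in> W"
    if "t \<in> cspan {w \<otimes> h | w h. w \<in> W}" for t
    using that
  proof (induction t rule: complex_vector.span_induct_alt)
    case base
    then show ?case
      by (simp add: clinear_0[OF clinear_tensor_sum[OF bil]] complex_vector.subspace_0[OF sub])
  next
    case (step c x y)
    then obtain w h where "x = w \<otimes> h" "w \<in> W"
      by blast
    then show ?case
      using step(2)
      by (simp add: clinear_add[OF clinear_tensor_sum[OF bil]]
          clinear_scaleC[OF clinear_tensor_sum[OF bil]] tensor_universal_property(2)[OF bil]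
          complex_vector.subspace_add[OF sub] complex_vector.subspace_scale[OF sub])
  qed
  then show ?thesis
    using W x by (simp add: subcomodule_def sweedler2_def)
qed

text \<open>
  The form $\varphi(y^* x)$ is also invariant with respect to the left legs, and the antipode exchanges left and
  right legs.
\<close>

lemma antipode_form_invariant:
  "sw (\<lambda>a b. form (\<S> a) (\<S> y) *\<^sub>C \<S> b) x = sw (\<lambda>a b. form (\<S> x) (\<S> a) *\<^sub>C b\<^bold>*) y"
proof -
  have "sw (\<lambda>a b. form (\<S> a) (\<S> y) *\<^sub>C \<S> b) x =
      sw (\<lambda>a b. \<phi> ((\<S> y)\<^bold>* \<cdot> b) *\<^sub>C a) (\<S> x)"
    by (subst sweedler2_antipode) (intro lin | simp add: form_def)+
  also have "\<dots> = sw (\<lambda>a b. \<phi> (b \<cdot> \<S> x) *\<^sub>C \<S> a) ((\<S> y)\<^bold>*)"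
    by (rule integral_move_left')
  also have "\<dots> = sw (\<lambda>a b. \<phi> (b\<^bold>* \<cdot> \<S> x) *\<^sub>C \<S> (a\<^bold>*)) (\<S> y)"
    by (rule sweedler2_star) (intro lin)
  also have "\<dots> = (sw (\<lambda>a b. form b (\<S> x) *\<^sub>C (\<S> (a\<^bold>*))\<^bold>*) (\<S> y))\<^bold>*"
    by (simp only: form_def[symmetric] star_sweedler2 star_scaleC form_hermitian[symmetric] star_star)
  also have "sw (\<lambda>a b. form b (\<S> x) *\<^sub>C (\<S> (a\<^bold>*))\<^bold>*) (\<S> y) =
      sw (\<lambda>a b. form (\<S> a) (\<S> x) *\<^sub>C (\<S> ((\<S> b)\<^bold>*))\<^bold>*) y"
    by (rule sweedler2_antipode) (intro lin clinear_star_star)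
  also have "\<dots>\<^bold>* = sw (\<lambda>a b. form (\<S> x) (\<S> a) *\<^sub>C b\<^bold>*) y"
    by (simp only: star_sweedler2 star_scaleC form_hermitian[symmetric] antipode_star_star star_star)
  finally show ?thesis .
qed

text \<open>
  In terms of matrix coefficients, the elements $y_e = \sum \langle x_1, e \rangle x_2$ form a column of a
  multiple of a unitary matrix. By invariance $y_e^* = \sum \langle e_1, x \rangle S(e_2)$ is linear in $e$, so that the
  sum of all $y_e^* y_e$ collapses to $\sum \langle x_1, x \rangle S(x_2) x_3$.
\<close>

lemma sum_form_translates:
  assumes W: "subcomodule H W" and ip: "inner_product_on W ip"
    and inv: "\<And>u v. u \<in> W \<Longrightarrow> v \<in> W \<Longrightarrow>
      sw (\<lambda>a b. ip a v *\<^sub>C \<S> b) u = sw (\<lambda>a b. ip u a *\<^sub>C b\<^bold>*) v"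
    and E: "E \<subseteq> W" "\<And>u. u \<in> W \<Longrightarrow> u = (\<Sum>e\<in>E. ip u e *\<^sub>C e)"
    and x: "x \<in> W"
  shows "(\<Sum>e\<in>E. form (sw (\<lambda>a b. ip a e *\<^sub>C b) x) (sw (\<lambda>a b. ip a e *\<^sub>C b) x)) = ip x x"
proof -
  let ?y = "\<lambda>e. sw (\<lambda>a b. ip a e *\<^sub>C b) x"
  note D = inner_product_onD[OF ip]
  have ipl: "clinear (\<lambda>u. ip u v)" for v
    using D(1) by blast
  note il = lin clinear_compose[OF ipl]
  define g where "g a = sw (\<lambda>p q. ip p x *\<^sub>C \<S> q) a" for a
  have g: "clinear g"
    unfolding g_def[abs_def] by (intro il)
  have star_y: "(?y e)\<^bold>* = g e" if e: "e \<in> E" for e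
  proof -
    have eW: "e \<in> W"
      using e E(1) by blast
    have "(?y e)\<^bold>* = sw (\<lambda>a b. cnj (ip a e) *\<^sub>C b\<^bold>*) x"
      by (simp only: star_sweedler2 star_scaleC)
    also have "\<dots> = sw (\<lambda>a b. ip e a *\<^sub>C b\<^bold>*) x"
    proof (rule sweedler2_eq_on_subcomodule[OF W x])
      show "balanced (\<lambda>a b. cnj (ip a e) *\<^sub>C b\<^bold>*)"
        by (rule conjugate_bilinear_balanced[OF ipl star_conjugate_linear])
      show "balanced (\<lambda>a b. ip e a *\<^sub>C b\<^bold>*)"
        by (rule conjugate_bilinear_imp_balanced)
          (simp_all add: conjugate_linear_def star_add star_scaleC sesquilinear_simps[OF D(1,2)]
            scaleC_add_left scaleC_add_right scaleC_scaleC mult.commute)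
      show "cnj (ip w e) *\<^sub>C h\<^bold>* = ip e w *\<^sub>C h\<^bold>*" if "w \<in> W" for w h
        using D(3)[OF eW that] by (rule arg_cong[OF HOL.sym])
    qed
    also have "\<dots> = g e"
      unfolding g_def by (rule inv[OF eW x, symmetric])
    finally show ?thesis .
  qed
  have "(\<Sum>e\<in>E. (?y e)\<^bold>* \<cdot> ?y e) = (\<Sum>e\<in>E. sw (\<lambda>a b. (ip a e *\<^sub>C g e) \<cdot> b) x)"
    by (rule sum.cong[OF HOL.refl])
      (simp only: star_y sweedler2_mult_right mult_scaleC_left mult_scaleC_right)
  also have "\<dots> = sw (\<lambda>a b. g (\<Sum>e\<in>E. ip a e *\<^sub>C e) \<cdot> b) x"
  proof -
    have "(\<Sum>e\<in>E. (ip a e *\<^sub>C g e) \<cdot> b) = g (\<Sum>e\<in>E. ip a e *\<^sub>C e) \<cdot> b" for a b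
      by (simp only: clinear_sum[OF g] clinear_scaleC[OF g]
          clinear_sum[OF lin_mult_left[OF clinear_id]])
    then show ?thesis
      unfolding sweedler2_def sum_tensor_sum_swap by simp
  qed
  also have "\<dots> = sw (\<lambda>a b. g a \<cdot> b) x"
  proof (rule sweedler2_eq_on_subcomodule[OF W x])
    show "balanced (\<lambda>a b. g (\<Sum>e\<in>E. ip a e *\<^sub>C e) \<cdot> b)" "balanced (\<lambda>a b. g a \<cdot> b)"
      by (rule cbilinear_imp_balanced, intro il clinear_compose[OF g])+
    show "g (\<Sum>e\<in>E. ip w e *\<^sub>C e) \<cdot> h = g w \<cdot> h" if "w \<in> W" for w h
      by (rule arg_cong[OF E(2)[OF that, symmetric]])
  qed
  also have "\<dots> = sw (\<lambda>a b. sw (\<lambda>p q. (ip p x *\<^sub>C \<S> q) \<cdot> b) a) x"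
    by (simp only: g_def sweedler2_mult_left)
  also have "\<dots> = sw (\<lambda>p u. sw (\<lambda>q b. (ip p x *\<^sub>C \<S> q) \<cdot> b) u) x"
    by (rule sweedler2_assoc) (intro il)+
  also have "\<dots> = sw (\<lambda>p u. counit H u *\<^sub>C (ip p x *\<^sub>C hunit H)) x"
    by (simp only: mult_scaleC_left sweedler2_scaleC_right[symmetric] antipode_left scaleC_scaleC mult.commute)
  also have "\<dots> = ip x x *\<^sub>C hunit H"
    by (rule sweedler2_counit_right) (intro il)
  finally have "(\<Sum>e\<in>E. (?y e)\<^bold>* \<cdot> ?y e) = ip x x *\<^sub>C hunit H" .
  from arg_cong[OF this, of \<phi>] show ?thesis
    by (simp add: form_def clinear_sum[OF integral_linear] clinear_scaleC[OF integral_linear]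
        integral_unit complex_scaleC_def)
qed

text \<open>
  Suppose that the form transported by the antipode has an eigenvector $x$ with eigenvalue $c \le 0$ relative
  to an invariant inner product. Right translation preserves the eigenspace, so all
  $\varphi(y_e^* y_e)$ in \<open>sum_form_translates\<close>, applied to $S x$, are nonpositive; but their sum is positive.
\<close>

lemma compact_quantum_group_imp_form_positive:
  assumes inf: "\<not> (\<exists>B :: 'v::complex_vector set. finite B \<and> cspan B = UNIV)"
    and cqg: "compact_quantum_group TYPE('v) H" and z0: "z0 \<noteq> 0"
  shows "form z0 z0 > 0"
proof (rule ccontr)
  assume neg: "\<not> form z0 z0 > 0"
  have real: "Im (form u u) = 0" for u
    using arg_cong[OF form_hermitian[of u u], of Im] by simp
  define z where "z = coantipode z0"
  have Sz: "\<S> z = z0"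
    by (simp add: z_def antipode_coantipode)
  have z: "z \<noteq> 0"
    using Sz z0 clinear_0[OF antipode_linear] by auto
  obtain B where B: "finite B" "z \<in> cspan B" "subcomodule H (cspan B)"
    using finite_subcomodule[of z] by blast
  define W where "W = cspan B"
  have W: "subcomodule H W" "z \<in> W"
    using B by (simp_all add: W_def)
  obtain ip where ip: "inner_product_on W ip" and inv: "\<forall>u\<in>W. \<forall>v\<in>W.
      sw (\<lambda>a b. ip a v *\<^sub>C \<S> b) u = sw (\<lambda>a b. ip u a *\<^sub>C b\<^bold>*) v"
    using subcomodule_invariant_form[OF inf cqg B(1) W_def W(1)] by (elim exE conjE)
  note D = inner_product_onD[OF ip]
  note ips = sesquilinear_simps[OF D(1,2)]
  have ipl: "clinear (\<lambda>u. ip u v)" for v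
    using D(1) by blast
  define h where "h u v = form (\<S> u) (\<S> v)" for u v
  have hl: "clinear (\<lambda>u. h u v)" for v
    unfolding h_def by (intro lin)
  have hherm: "h u v = cnj (h v u)" for u v
    unfolding h_def by (rule form_hermitian)
  have hc: "conjugate_linear (h u)" for u
    using form_conjugate_linear antipode_linear
    by (simp add: h_def[abs_def] conjugate_linear_def clinear_iff)
  have hz: "Re (h z z) \<le> 0"
    using neg real[of z0] by (simp add: h_def Sz less_complex_def)
  obtain x c where x: "x \<in> W" "x \<noteq> 0" and c: "c \<le> 0" and eig: "\<forall>y\<in>W. h x y = of_real c * ip x y"
    using nonpositive_eigenvector[OF B(1) W_def ip allI[OF hl] allI[OF hc] hherm W(2) z hz]
    by (elim bexE exE conjE)
  \<comment> \<open>The right translates of \<open>x\<close> are eigenvectors with the same eigenvalue.\<close>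
  have translate: "Re (form (\<S> u) (\<S> u)) \<le> 0"
    if u: "u = sw (\<lambda>a b. f b *\<^sub>C a) x" and f: "clinear f" for u f
  proof -
    have uW: "u \<in> W"
      unfolding u by (rule subcomodule_right_translate[OF W(1) x(1) f])
    define k where "k y = f (coantipode y)" for y
    have k: "clinear k"
      unfolding k_def[abs_def] by (intro lin clinear_compose[OF f])
    have fk: "f b = k (\<S> b)" for b
      by (simp add: k_def coantipode_antipode)
    have move: "h u y = of_real c * ip u y" if y: "y \<in> W" for y
    proof -
      have kstar: "conjugate_linear (\<lambda>b. k (b\<^bold>*))"
        using k by (simp add: conjugate_linear_def clinear_iff star_add star_scaleC)
      \<comment> \<open>Invariance moves the translation by \<open>f\<close> to the other argument.\<close>
      have push: "F u y = sw (\<lambda>a b. F x a *\<^sub>C k (b\<^bold>*)) y"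
        if F: "clinear (\<lambda>u. F u y)" and Finv: "sw (\<lambda>a b. F a y *\<^sub>C \<S> b) x = sw (\<lambda>a b. F x a *\<^sub>C b\<^bold>*) y"
        for F :: "'a \<Rightarrow> 'a \<Rightarrow> complex"
      proof -
        have "F u y = sw (\<lambda>a b. F a y *\<^sub>C k (\<S> b)) x"
          unfolding u sweedler2_linear[OF F]
          by (simp add: clinear_scaleC[OF F] fk complex_scaleC_def mult.commute)
        also have "\<dots> = k (sw (\<lambda>a b. F a y *\<^sub>C \<S> b) x)"
          by (simp only: sweedler2_linear[OF k] clinear_scaleC[OF k])
        also have "\<dots> = sw (\<lambda>a b. F x a *\<^sub>C k (b\<^bold>*)) y"
          by (simp only: Finv sweedler2_linear[OF k] clinear_scaleC[OF k])
        finally show ?thesis .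
      qed
      have "h u y = sw (\<lambda>a b. h x a *\<^sub>C k (b\<^bold>*)) y"
        by (rule push[OF hl]) (simp only: h_def antipode_form_invariant)
      also have "\<dots> = sw (\<lambda>a b. (of_real c * ip x a) *\<^sub>C k (b\<^bold>*)) y"
      proof (rule sweedler2_eq_on_subcomodule[OF W(1) y])
        show "balanced (\<lambda>a b. h x a *\<^sub>C k (b\<^bold>*))"
          by (rule conjugate_bilinear_imp_balanced)
            (use hc kstar in \<open>simp_all add: conjugate_linear_def scaleC_add_left scaleC_add_right
              complex_scaleC_def algebra_simps\<close>)
        show "balanced (\<lambda>a b. (of_real c * ip x a) *\<^sub>C k (b\<^bold>*))"
          by (rule conjugate_bilinear_imp_balanced)
            (use kstar in \<open>simp_all add: conjugate_linear_def scaleC_add_left scaleC_add_right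
              complex_scaleC_def algebra_simps ips\<close>)
        show "h x w *\<^sub>C k (b\<^bold>*) = (of_real c * ip x w) *\<^sub>C k (b\<^bold>*)" if "w \<in> W" for w b
          using eig that by simp
      qed
      also have "\<dots> = of_real c * sw (\<lambda>a b. ip x a *\<^sub>C k (b\<^bold>*)) y"
        by (simp only: sweedler2_complex_right complex_scaleC_def mult.assoc)
      also have "\<dots> = of_real c * ip u y"
        by (subst push[OF ipl]) (use inv x(1) y in simp_all)
      finally show ?thesis .
    qed
    have "Re (ip u u) \<ge> 0"
      using D(4)[OF uW] by (cases "u = 0") (auto simp: ips less_complex_def)
    then show ?thesis
      using move[OF uW] c by (simp add: h_def mult_nonpos_nonneg)
  qed
  define X where "X = \<S> x"
  have "x = coantipode X"
    by (simp add: X_def coantipode_antipode)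
  then have X: "X \<noteq> 0"
    using x(2) clinear_0[OF coantipode_linear] by auto
  obtain C where C: "finite C" "X \<in> cspan C" "subcomodule H (cspan C)"
    using finite_subcomodule[of X] by blast
  define U where "U = cspan C"
  have U: "subcomodule H U" "X \<in> U" "csubspace U" "C \<subseteq> U"
    using C by (simp_all add: U_def complex_vector.span_superset)
  obtain ip2 where ip2: "inner_product_on U ip2" and inv2: "\<forall>u\<in>U. \<forall>v\<in>U.
      sw (\<lambda>a b. ip2 a v *\<^sub>C \<S> b) u = sw (\<lambda>a b. ip2 u a *\<^sub>C b\<^bold>*) v"
    using subcomodule_invariant_form[OF inf cqg C(1) U_def U(1)] by (elim exE conjE)
  have ip2l: "clinear (\<lambda>u. ip2 u v)" for v
    using inner_product_onD(1)[OF ip2] by blast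
  from orthonormal_basis[OF U(3) ip2 C(1) U(4), folded U_def]
  obtain E where E: "finite E" "E \<subseteq> U" "\<And>u. u \<in> U \<Longrightarrow> u = (\<Sum>e\<in>E. ip2 u e *\<^sub>C e)"
    by (elim exE conjE) (rule that; (assumption | drule (1) bspec)+)
  have "ip2 X X = (\<Sum>e\<in>E. form (sw (\<lambda>a b. ip2 a e *\<^sub>C b) X) (sw (\<lambda>a b. ip2 a e *\<^sub>C b) X))"
    by (rule sum_form_translates[OF U(1) ip2 _ E(2,3) U(2), symmetric]) (use inv2 in blast)
  also have "Re \<dots> \<le> 0"
    unfolding Re_sum
  proof (rule sum_nonpos)
    fix e
    let ?f = "\<lambda>b. ip2 (\<S> b) e"
    have f: "clinear ?f"
      by (intro lin clinear_compose[OF ip2l])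
    have "sw (\<lambda>a b. ip2 a e *\<^sub>C b) X = sw (\<lambda>a b. ?f b *\<^sub>C \<S> a) x"
      unfolding X_def by (rule sweedler2_antipode) (intro lin ip2l)
    also have "\<dots> = \<S> (sw (\<lambda>a b. ?f b *\<^sub>C a) x)"
      by (simp only: sweedler2_linear[OF antipode_linear] clinear_scaleC[OF antipode_linear])
    finally show "Re (form (sw (\<lambda>a b. ip2 a e *\<^sub>C b) X) (sw (\<lambda>a b. ip2 a e *\<^sub>C b) X)) \<le> 0"
      using translate[OF HOL.refl f] by simp
  qed
  finally have "Re (ip2 X X) \<le> 0"
    by simp
  then show False
    using inner_product_onD(4)[OF ip2 U(2) X] by (simp add: less_complex_def)
qed

theorem compact_quantum_group_iff_form_positive:
  assumes "\<not> (\<exists>B :: 'v::complex_vector set. finite B \<and> cspan B = UNIV)"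
  shows "compact_quantum_group TYPE('v) H \<longleftrightarrow> (\<forall>x. x \<noteq> 0 \<longrightarrow> form x x > 0)"
proof
  assume "compact_quantum_group TYPE('v) H"
  then show "\<forall>x. x \<noteq> 0 \<longrightarrow> form x x > 0"
    using compact_quantum_group_imp_form_positive[OF assms] by blast
next
  assume pos: "\<forall>x. x \<noteq> 0 \<longrightarrow> form x x > 0"
  show "compact_quantum_group TYPE('v) H"
    unfolding compact_quantum_group_def
  proof (intro conjI allI impI)
    show "star_hopf_algebra H" ..
    show "\<exists>ip. invariant_inner_product_on H V \<rho> ip" if "right_comodule H V \<rho>" for V :: "'v set" and \<rho>
      by (rule invariant_inner_product_exists[OF _ that]) (use pos in blast)
  qed
qed

end

section \<open>The tensor cube of a Hopf algebra\<close>

lemma tensor_ext3: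
  assumes f: "clinear f" and g: "clinear g" and "\<And>x y z. f (x \<otimes> y \<otimes> z) = g (x \<otimes> y \<otimes> z)"
  shows "f t = g t"
proof (rule tensor_ext[OF f g])
  fix x s
  show "f (x \<otimes> s) = g (x \<otimes> s)"
    by (rule tensor_ext[where t = s])
      (intro clinear_compose[OF f] clinear_compose[OF g] lin | rule assms)+
qed

context hopf_algebra begin

abbreviation "comult2 \<equiv> tensor_comult (comult H) (comult H)"
abbreviation "counit2 \<equiv> tensor_counit (counit H) (counit H)"
abbreviation "comult3 \<equiv> tensor_comult (comult H) comult2"
abbreviation "counit3 \<equiv> tensor_counit (counit H) counit2"
abbreviation "M \<equiv> tensor_sum (hmult H)"

lemma mult_tensor_linear: "clinear M"
  and mult_tensor_pure: "M (x \<otimes> y) = x \<cdot> y"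
  by (rule tensor_universal_property(1,2)[OF mult_bilinear])+

lemma lin_comult2 [lin]: "clinear f \<Longrightarrow> clinear (\<lambda>x. comult2 (f x))"
  by (rule clinear_compose[OF pair.linear_tensor_comult])

lemma sum_comult2:
  assumes "cbilinear B"
  shows "tensor_sum B (comult2 (x \<otimes> y)) =
    sw (\<lambda>a b. sw (\<lambda>c d. B (a \<otimes> c) (b \<otimes> d)) y) x"
  unfolding sweedler2_def by (rule pair.tensor_comult_sum[OF assms])

lemma comult2_pure:
  "comult2 (x \<otimes> y) = sw (\<lambda>a b. sw (\<lambda>c d. (a \<otimes> c) \<otimes> (b \<otimes> d)) y) x"
  using sum_comult2[OF cbilinear_pure_tensor, of x y] by (simp add: tensor_sum_pure_tensor)

lemma convolution2_pure:
  assumes m: "cbilinear m" and f: "clinear f" and g: "clinear g"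
  shows "convolution comult2 m f g (x \<otimes> y) =
    sw (\<lambda>a b. sw (\<lambda>c d. m (f (a \<otimes> c)) (g (b \<otimes> d))) y) x"
  unfolding convolution_def
  by (rule sum_comult2)
    (intro cbilinearI cbilinear_left[OF m] cbilinear_right[OF m] f g)

end

sublocale hopf_algebra \<subseteq> pair3: coalgebra_pair "comult H" "counit H"
    "tensor_comult (comult H) (comult H)" "tensor_counit (counit H) (counit H)" ..

sublocale hopf_algebra \<subseteq> cube: coalgebra "tensor_comult (comult H) (tensor_comult (comult H) (comult H))"
    "tensor_counit (counit H) (tensor_counit (counit H) (counit H))"
  by (rule pair3.coalgebra_tensor)

context hopf_algebra begin

lemma sum_comult3:
  assumes B: "cbilinear B"
  shows "tensor_sum B (comult3 (x \<otimes> y \<otimes> z)) =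
    sw (\<lambda>a b. sw (\<lambda>c d. sw (\<lambda>e f.
      B (a \<otimes> c \<otimes> e) (b \<otimes> d \<otimes> f)) z) y) x"
proof -
  have "tensor_sum (\<lambda>s t. B (a \<otimes> s) (b \<otimes> t)) (comult2 (y \<otimes> z)) =
      sw (\<lambda>c d. sw (\<lambda>e f. B (a \<otimes> c \<otimes> e) (b \<otimes> d \<otimes> f)) z) y" for a b
    by (rule sum_comult2) (intro cbilinearI cbilinear_left[OF B] cbilinear_right[OF B] lin)
  then show ?thesis
    by (simp add: pair3.tensor_comult_sum[OF B] sweedler2_def)
qed

lemma convolution3_pure:
  assumes m: "cbilinear m" and f: "clinear f" and g: "clinear g"
  shows "convolution comult3 m f g (x \<otimes> y \<otimes> z) =
    sw (\<lambda>a b. sw (\<lambda>c d. sw (\<lambda>e h.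
      m (f (a \<otimes> c \<otimes> e)) (g (b \<otimes> d \<otimes> h))) z) y) x"
  unfolding convolution_def
  by (rule sum_comult3)
    (intro cbilinearI cbilinear_left[OF m] cbilinear_right[OF m] f g)

text \<open>
  The coalgebra maps from the tensor cube to the tensor square along which a cocycle is pulled back:
  multiply the first two factors or the last two, or discard the last factor or the first one by the counit.
\<close>

definition "mult_left = tensor_sum (\<lambda>x s. tensor_sum (\<lambda>y z. (x \<cdot> y) \<otimes> z) s)"
definition "mult_right = tensor_sum (\<lambda>x s. x \<otimes> M s)"
definition "front = tensor_sum (\<lambda>x s. tensor_sum (\<lambda>y z. counit H z *\<^sub>C (x \<otimes> y)) s)"
definition rear :: "('a, ('a, 'a) tensor) tensor \<Rightarrow> ('a, 'a) tensor"
  where "rear = tensor_sum (\<lambda>x s. counit H x *\<^sub>C s)"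

lemma
  shows mult_left_linear: "clinear mult_left" and mult_left_pure: "mult_left (x \<otimes> y \<otimes> z) = (x \<cdot> y) \<otimes> z"
    and mult_right_linear: "clinear mult_right" and mult_right_pure: "mult_right (x \<otimes> y \<otimes> z) = x \<otimes> (y \<cdot> z)"
    and front_linear: "clinear front" and front_pure: "front (x \<otimes> y \<otimes> z) = counit H z *\<^sub>C (x \<otimes> y)"
    and rear_linear: "clinear rear" and rear_pure: "rear (x \<otimes> s) = counit H x *\<^sub>C s"
proof -
  have l: "cbilinear (\<lambda>x s. tensor_sum (\<lambda>y z. (x \<cdot> y) \<otimes> z) s)" "\<And>x. cbilinear (\<lambda>y z. (x \<cdot> y) \<otimes> z)"
    by (intro lin clinear_tensor_sum)+
  have r: "cbilinear (\<lambda>x s. x \<otimes> M s)"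
    by (intro lin clinear_compose[OF mult_tensor_linear])
  have f: "cbilinear (\<lambda>x s. tensor_sum (\<lambda>y z. counit H z *\<^sub>C (x \<otimes> y)) s)"
    "\<And>x. cbilinear (\<lambda>y z. counit H z *\<^sub>C (x \<otimes> y))"
    by (intro lin clinear_tensor_sum)+
  have b: "cbilinear (\<lambda>x (s::('a, 'a) tensor). counit H x *\<^sub>C s)"
    by (intro lin)
  show "clinear mult_left" "clinear mult_right" "clinear front" "clinear rear"
    unfolding mult_left_def mult_right_def front_def rear_def
    by (intro clinear_tensor_sum l r f b)+
  show "mult_left (x \<otimes> y \<otimes> z) = (x \<cdot> y) \<otimes> z" "mult_right (x \<otimes> y \<otimes> z) = x \<otimes> (y \<cdot> z)"
    "front (x \<otimes> y \<otimes> z) = counit H z *\<^sub>C (x \<otimes> y)" "rear (x \<otimes> s) = counit H x *\<^sub>C s"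
    unfolding mult_left_def mult_right_def front_def rear_def
    by (simp_all add: tensor_universal_property(2) l r f b mult_tensor_pure)
qed

lemma sweedler2_counit_counit: "sw (\<lambda>a b. counit H a * counit H b) x = counit H x"
  using sweedler2_counit_left[OF counit_linear, of x] by (simp add: complex_scaleC_def)

lemma coalgebra_map3I:
  assumes \<theta>: "clinear \<theta>"
    and "\<And>x y z. comult2 (\<theta> (x \<otimes> y \<otimes> z)) = sw (\<lambda>a b. sw (\<lambda>c d. sw (\<lambda>e f.
      \<theta> (a \<otimes> c \<otimes> e) \<otimes> \<theta> (b \<otimes> d \<otimes> f)) z) y) x"
    and "\<And>x y z. counit2 (\<theta> (x \<otimes> y \<otimes> z)) = counit H x * counit H y * counit H z"
  shows "coalgebra_map comult3 counit3 comult2 counit2 \<theta>"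
  unfolding coalgebra_map_def
proof (intro conjI allI \<theta>)
  note l = lin clinear_compose[OF \<theta>] pair.linear_tensor_comult pair3.linear_tensor_comult
    pair.linear_tensor_counit pair3.linear_tensor_counit
  have bil: "cbilinear (\<lambda>a b. \<theta> a \<otimes> \<theta> b)"
    by (intro l)
  show "comult2 (\<theta> t) = tensor_sum (\<lambda>a b. \<theta> a \<otimes> \<theta> b) (comult3 t)" for t
    by (rule tensor_ext3[where t = t])
      (intro l clinear_compose[OF pair.linear_tensor_comult] | simp only: assms(2) sum_comult3[OF bil])+
  show "counit2 (\<theta> t) = counit3 t" for t
    by (rule tensor_ext3[where t = t])
      (intro l clinear_compose[OF pair.linear_tensor_counit] |
        simp add: assms(3) pair3.tensor_counit_pure pair.tensor_counit_pure)+
qed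

lemma coalgebra_map_mult_left: "coalgebra_map comult3 counit3 comult2 counit2 mult_left"
proof (rule coalgebra_map3I[OF mult_left_linear])
  show "comult2 (mult_left (x \<otimes> y \<otimes> z)) = sw (\<lambda>a b. sw (\<lambda>c d. sw (\<lambda>e f.
      mult_left (a \<otimes> c \<otimes> e) \<otimes> mult_left (b \<otimes> d \<otimes> f)) z) y) x" for x y z
    unfolding mult_left_pure comult2_pure by (rule sweedler2_mult) (intro lin)
qed (simp add: mult_left_pure pair.tensor_counit_pure counit_mult)

lemma coalgebra_map_mult_right: "coalgebra_map comult3 counit3 comult2 counit2 mult_right"
proof (rule coalgebra_map3I[OF mult_right_linear])
  show "comult2 (mult_right (x \<otimes> y \<otimes> z)) = sw (\<lambda>a b. sw (\<lambda>c d. sw (\<lambda>e f.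
      mult_right (a \<otimes> c \<otimes> e) \<otimes> mult_right (b \<otimes> d \<otimes> f)) z) y) x" for x y z
    unfolding mult_right_pure comult2_pure
    by (rule sweedler2_cong, rule sweedler2_mult) (intro lin)
qed (simp add: mult_right_pure pair.tensor_counit_pure counit_mult)

lemma pure_scaleC:
  "(c *\<^sub>C x) \<otimes> y = c *\<^sub>C (x \<otimes> y)" "x \<otimes> (c *\<^sub>C y) = c *\<^sub>C (x \<otimes> y)"
  by (rule clinear_scaleC, intro lin)+

lemma coalgebra_map_front: "coalgebra_map comult3 counit3 comult2 counit2 front"
proof (rule coalgebra_map3I[OF front_linear])
  fix x y z
  have "sw (\<lambda>a b. sw (\<lambda>c d. sw (\<lambda>e f.
      front (a \<otimes> c \<otimes> e) \<otimes> front (b \<otimes> d \<otimes> f)) z) y) x =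
    sw (\<lambda>a b. sw (\<lambda>c d. sw (\<lambda>e f. counit H e * counit H f) z *\<^sub>C
      ((a \<otimes> c) \<otimes> (b \<otimes> d))) y) x"
    by (simp only: front_pure pure_scaleC scaleC_scaleC sweedler2_scaleC_left mult.commute)
  then show "comult2 (front (x \<otimes> y \<otimes> z)) = sw (\<lambda>a b. sw (\<lambda>c d. sw (\<lambda>e f.
      front (a \<otimes> c \<otimes> e) \<otimes> front (b \<otimes> d \<otimes> f)) z) y) x"
    by (simp only: front_pure clinear_scaleC[OF pair.linear_tensor_comult] comult2_pure
        sweedler2_counit_counit sweedler2_scaleC_right)
qed (simp add: front_pure clinear_scaleC[OF pair.linear_tensor_counit] pair.tensor_counit_pure
    complex_scaleC_def)

lemma coalgebra_map_rear: "coalgebra_map comult3 counit3 comult2 counit2 rear"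
proof (rule coalgebra_map3I[OF rear_linear])
  fix x y z
  have "sw (\<lambda>a b. sw (\<lambda>c d. sw (\<lambda>e f.
      rear (a \<otimes> c \<otimes> e) \<otimes> rear (b \<otimes> d \<otimes> f)) z) y) x =
    sw (\<lambda>a b. (counit H a * counit H b) *\<^sub>C sw (\<lambda>c d. sw (\<lambda>e f.
      (c \<otimes> e) \<otimes> (d \<otimes> f)) z) y) x"
    by (simp only: rear_pure pure_scaleC scaleC_scaleC sweedler2_scaleC_right mult.commute)
  also have "\<dots> = sw (\<lambda>a b. counit H a * counit H b) x *\<^sub>C comult2 (y \<otimes> z)"
    by (simp only: sweedler2_scaleC_left comult2_pure)
  finally show "comult2 (rear (x \<otimes> y \<otimes> z)) = sw (\<lambda>a b. sw (\<lambda>c d. sw (\<lambda>e f.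
      rear (a \<otimes> c \<otimes> e) \<otimes> rear (b \<otimes> d \<otimes> f)) z) y) x"
    by (simp only: rear_pure clinear_scaleC[OF pair.linear_tensor_comult] sweedler2_counit_counit)
qed (simp add: rear_pure clinear_scaleC[OF pair.linear_tensor_counit] pair.tensor_counit_pure
    complex_scaleC_def)

lemma convolution_inverses_iff:
  assumes "clinear f" and "clinear g"
  shows "convolution_inverses H f g \<longleftrightarrow> square.inverses f g"
proof -
  have *: "(\<forall>x y. sw (\<lambda>x\<^sub>1 x\<^sub>2. sw (\<lambda>y\<^sub>1 y\<^sub>2. f (x\<^sub>1 \<otimes> y\<^sub>1) * g (x\<^sub>2 \<otimes> y\<^sub>2)) y) x
      = counit H x * counit H y) \<longleftrightarrow> square.left_convolution f g = counit2"
    if f: "clinear f" and g: "clinear g" for f g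
  proof -
    have "square.left_convolution f g (x \<otimes> y) =
        sw (\<lambda>x\<^sub>1 x\<^sub>2. sw (\<lambda>y\<^sub>1 y\<^sub>2. f (x\<^sub>1 \<otimes> y\<^sub>1) * g (x\<^sub>2 \<otimes> y\<^sub>2)) y) x" for x y
    proof -
      have "square.left_convolution f g (x \<otimes> y) =
          sw (\<lambda>x\<^sub>1 x\<^sub>2. sw (\<lambda>y\<^sub>1 y\<^sub>2. f (x\<^sub>1 \<otimes> y\<^sub>1) *\<^sub>C g (x\<^sub>2 \<otimes> y\<^sub>2)) y) x"
        by (rule convolution2_pure[OF cbilinear_scaleC f g])
      then show ?thesis
        by (simp only: complex_scaleC_def[symmetric])
    qed
    moreover have "square.left_convolution f g = counit2 \<longleftrightarrow>
        (\<forall>x y. square.left_convolution f g (x \<otimes> y) = counit2 (x \<otimes> y))"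
      using tensor_ext[OF square.left_convolution_linear[OF f g] pair.linear_tensor_counit] by auto
    ultimately show ?thesis
      by (simp add: pair.tensor_counit_pure)
  qed
  show ?thesis
    using assms by (simp add: convolution_inverses_def square.inverses_def *)
qed

end

section \<open>Twisting by a cocycle\<close>

locale hopf_cocycle = hopf_algebra H
  for H :: "'a::complex_vector star_hopf_data" +
  fixes \<chi> :: "('a, 'a) tensor \<Rightarrow> complex"
  assumes cocycle: "cocycle H \<chi>"
begin

abbreviation "\<psi> \<equiv> convolution_inverse H \<chi>"

lemma cocycle_linear: "clinear \<chi>"
  and cocycle_identity:
    "sw (\<lambda>x\<^sub>1 x\<^sub>2. sw (\<lambda>y\<^sub>1 y\<^sub>2. \<chi> (x\<^sub>1 \<otimes> y\<^sub>1) * \<chi> ((x\<^sub>2 \<cdot> y\<^sub>2) \<otimes> z)) y) x =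
     sw (\<lambda>y\<^sub>1 y\<^sub>2. sw (\<lambda>z\<^sub>1 z\<^sub>2. \<chi> (y\<^sub>1 \<otimes> z\<^sub>1) * \<chi> (x \<otimes> (y\<^sub>2 \<cdot> z\<^sub>2))) z) y"
  and cocycle_unit: "\<chi> (hunit H \<otimes> x) = counit H x" "\<chi> (x \<otimes> hunit H) = counit H x"
  using cocycle unfolding cocycle_def by blast+

lemma cocycle_inverses: "square.inverses \<chi> \<psi>"
proof -
  obtain f where f: "clinear f" "convolution_inverses H \<chi> f"
    using cocycle unfolding cocycle_def by blast
  have "\<exists>!f. clinear f \<and> convolution_inverses H \<chi> f"
  proof (rule ex1I)
    show "clinear f \<and> convolution_inverses H \<chi> f"
      using f by blast
    show "g = f" if "clinear g \<and> convolution_inverses H \<chi> g" for g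
      using that f convolution_inverses_iff[OF cocycle_linear] square.inverses_unique by metis
  qed
  from theI'[OF this] have "clinear \<psi> \<and> convolution_inverses H \<chi> \<psi>"
    unfolding convolution_inverse_def .
  then show ?thesis
    using convolution_inverses_iff[OF cocycle_linear] by blast
qed

lemma inverse_linear: "clinear \<psi>"
  using cocycle_inverses by (simp add: square.inverses_def)

lemma lin_cocycle [lin]: "clinear f \<Longrightarrow> clinear (\<lambda>x. \<chi> (f x))"
  by (rule clinear_compose[OF cocycle_linear])

lemma lin_inverse [lin]: "clinear f \<Longrightarrow> clinear (\<lambda>x. \<psi> (f x))"
  by (rule clinear_compose[OF inverse_linear])

lemma inverse_cocycle:
  "sw (\<lambda>a b. sw (\<lambda>c d. \<psi> (a \<otimes> c) * \<chi> (b \<otimes> d)) y) x = counit H x * counit H y"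
  and cocycle_inverse:
  "sw (\<lambda>a b. sw (\<lambda>c d. \<chi> (a \<otimes> c) * \<psi> (b \<otimes> d)) y) x = counit H x * counit H y"
  using cocycle_inverses convolution_inverses_iff[OF cocycle_linear inverse_linear]
  by (auto simp: convolution_inverses_def)

lemma inverse_unit: "\<psi> (hunit H \<otimes> x) = counit H x" "\<psi> (x \<otimes> hunit H) = counit H x"
proof -
  have "counit H x = sw (\<lambda>c d. counit H c *\<^sub>C \<psi> (hunit H \<otimes> d)) x"
    using cocycle_inverse[of x "hunit H"]
    by (subst (asm) sweedler2_unit) (intro lin | simp add: cocycle_unit counit_unit complex_scaleC_def)+
  also have "\<dots> = \<psi> (hunit H \<otimes> x)"
    by (rule sweedler2_counit_left) (intro lin)
  finally show "\<psi> (hunit H \<otimes> x) = counit H x"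
    by (rule HOL.sym)
  have "counit H x = sw (\<lambda>a b. counit H a *\<^sub>C \<psi> (b \<otimes> hunit H)) x"
  proof -
    have "sw (\<lambda>c d. \<chi> (a \<otimes> c) * \<psi> (b \<otimes> d)) (hunit H) = counit H a *\<^sub>C \<psi> (b \<otimes> hunit H)" for a b
      by (subst sweedler2_unit) (intro lin | simp add: cocycle_unit complex_scaleC_def)+
    then show ?thesis
      using cocycle_inverse[of "hunit H" x] by (simp add: counit_unit)
  qed
  also have "\<dots> = \<psi> (x \<otimes> hunit H)"
    by (rule sweedler2_counit_left) (intro lin)
  finally show "\<psi> (x \<otimes> hunit H) = counit H x"
    by (rule HOL.sym)
qed

definition twisted_mult :: "'a \<Rightarrow> 'a \<Rightarrow> 'a" (infixl "\<bullet>" 73)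
  where "x \<bullet> y = square.conjugated \<chi> \<psi> M (x \<otimes> y)"

lemma twisted_mult_linear: "clinear (square.conjugated \<chi> \<psi> M)"
  by (intro square.conjugated_linear cocycle_linear inverse_linear mult_tensor_linear)

lemma twisted_mult_bilinear: "cbilinear (\<bullet>)"
  unfolding twisted_mult_def[abs_def] by (intro lin clinear_compose[OF twisted_mult_linear])

lemma lin_twisted_left [lin]: "clinear f \<Longrightarrow> clinear (\<lambda>x. f x \<bullet> y)"
  by (rule cbilinear_left[OF twisted_mult_bilinear])

lemma lin_twisted_right [lin]: "clinear f \<Longrightarrow> clinear (\<lambda>x. y \<bullet> f x)"
  by (rule cbilinear_right[OF twisted_mult_bilinear])

text \<open>
  The two ways of splitting the conjugation of the multiplication in two steps.
\<close>

definition right_twist :: "'a \<Rightarrow> 'a \<Rightarrow> 'a"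
  where "right_twist x y = sw (\<lambda>a b. sw (\<lambda>c d. \<psi> (b \<otimes> d) *\<^sub>C (a \<cdot> c)) y) x"

definition left_twist :: "'a \<Rightarrow> 'a \<Rightarrow> 'a"
  where "left_twist x y = sw (\<lambda>a b. sw (\<lambda>c d. \<chi> (a \<otimes> c) *\<^sub>C (b \<cdot> d)) y) x"

lemma lin_right_twist [lin]:
  "clinear f \<Longrightarrow> clinear (\<lambda>x. right_twist (f x) y)" 
  unfolding right_twist_def by (intro lin)

lemma lin_right_twist' [lin]:
  "clinear f \<Longrightarrow> clinear (\<lambda>x. right_twist y (f x))" 
  unfolding right_twist_def by (intro lin)

lemma lin_left_twist [lin]:
  "clinear f \<Longrightarrow> clinear (\<lambda>x. left_twist (f x) y)" 
  unfolding left_twist_def by (intro lin)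

lemma lin_left_twist' [lin]:
  "clinear f \<Longrightarrow> clinear (\<lambda>x. left_twist y (f x))" 
  unfolding left_twist_def by (intro lin)

lemma twisted_mult_right_twist:
  "x \<bullet> y = sw (\<lambda>a b. sw (\<lambda>c d. \<chi> (a \<otimes> c) *\<^sub>C right_twist b d) y) x"
proof -
  have r: "right_twist b d = square.right_convolution M \<psi> (b \<otimes> d)" for b d
    using convolution2_pure[OF cbilinear_scaleC_flip mult_tensor_linear inverse_linear, of b d]
    by (simp add: right_twist_def mult_tensor_pure)
  show ?thesis
    unfolding twisted_mult_def square.conjugated_def r
    by (rule convolution2_pure[OF cbilinear_scaleC cocycle_linear])
      (intro square.right_convolution_linear mult_tensor_linear inverse_linear)
qed

lemma twisted_mult_left_twist:
  "x \<bullet> y = sw (\<lambda>a b. sw (\<lambda>c d. \<psi> (b \<otimes> d) *\<^sub>C left_twist a c) y) x"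
proof -
  have l: "left_twist b d = square.left_convolution \<chi> M (b \<otimes> d)" for b d
    using convolution2_pure[OF cbilinear_scaleC cocycle_linear mult_tensor_linear, of b d]
    by (simp add: left_twist_def mult_tensor_pure)
  have "x \<bullet> y = square.right_convolution (square.left_convolution \<chi> M) \<psi> (x \<otimes> y)"
    unfolding twisted_mult_def square.conjugated_def
    by (simp only: square.left_right_assoc[OF cocycle_linear mult_tensor_linear inverse_linear])
  also have "\<dots> = sw (\<lambda>a b. sw (\<lambda>c d. \<psi> (b \<otimes> d) *\<^sub>C left_twist a c) y) x"
    unfolding l
    by (rule convolution2_pure[OF cbilinear_scaleC_flip _ inverse_linear])
      (intro square.left_convolution_linear mult_tensor_linear cocycle_linear)
  finally show ?thesis .
qed

lemma twisted_mult_sweedler3: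
  "x \<bullet> y = sw3 (\<lambda>x\<^sub>1 x\<^sub>2 x\<^sub>3. sw3 (\<lambda>y\<^sub>1 y\<^sub>2 y\<^sub>3.
    (\<chi> (x\<^sub>1 \<otimes> y\<^sub>1) * \<psi> (x\<^sub>3 \<otimes> y\<^sub>3)) *\<^sub>C (x\<^sub>2 \<cdot> y\<^sub>2)) y) x"
proof -
  have "x \<bullet> y = sw (\<lambda>a b. sw (\<lambda>c d. sw (\<lambda>p q. sw (\<lambda>r s.
      (\<chi> (a \<otimes> c) * \<psi> (q \<otimes> s)) *\<^sub>C (p \<cdot> r)) d) b) y) x"
    by (simp only: twisted_mult_right_twist right_twist_def sweedler2_scaleC_right scaleC_scaleC)
  also have "\<dots> = sw (\<lambda>a b. sw (\<lambda>p q. sw (\<lambda>c d. sw (\<lambda>r s.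
      (\<chi> (a \<otimes> c) * \<psi> (q \<otimes> s)) *\<^sub>C (p \<cdot> r)) d) y) b) x"
    by (rule sweedler2_cong, rule sweedler2_swap)
  finally show ?thesis
    by (simp only: sweedler3_def)
qed

lemma twisted_coalgebra_map:
  "coalgebra_map comult2 counit2 (comult H) (counit H) (square.conjugated \<chi> \<psi> M)"
  by (rule coalgebra_map_conjugated[OF square.coalgebra_axioms coalgebra_axioms
        tensor_sum_mult_coalgebra_map cocycle_inverses])

lemma comult_twisted_mult:
  "comult H (x \<bullet> y) = sw (\<lambda>x\<^sub>1 x\<^sub>2. sw (\<lambda>y\<^sub>1 y\<^sub>2. (x\<^sub>1 \<bullet> y\<^sub>1) \<otimes> (x\<^sub>2 \<bullet> y\<^sub>2)) y) x"
proof -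
  have "comult H (x \<bullet> y) = convolution comult2 (\<otimes>) (square.conjugated \<chi> \<psi> M) (square.conjugated \<chi> \<psi> M) (x \<otimes> y)"
    using twisted_coalgebra_map by (simp add: coalgebra_map_def twisted_mult_def convolution_def)
  then show ?thesis
    by (simp add: twisted_mult_def convolution2_pure[OF cbilinear_pure_tensor twisted_mult_linear twisted_mult_linear])
qed

lemma counit_twisted_mult: "counit H (x \<bullet> y) = counit H x * counit H y"
  using twisted_coalgebra_map
  by (simp add: coalgebra_map_def twisted_mult_def pair.tensor_counit_pure)

lemma right_twist_unit: "right_twist (hunit H) x = x" "right_twist x (hunit H) = x"
proof -
  show "right_twist (hunit H) x = x"
    unfolding right_twist_def
    by (subst sweedler2_unit, intro lin) (simp add: inverse_unit unit_mult counit_right)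
  have "sw (\<lambda>c d. \<psi> (b \<otimes> d) *\<^sub>C (a \<cdot> c)) (hunit H) = counit H b *\<^sub>C a" for a b
    by (subst sweedler2_unit) (intro lin | simp add: inverse_unit mult_unit)+
  then show "right_twist x (hunit H) = x"
    by (simp add: right_twist_def counit_right)
qed

lemma unit_twisted_mult: "hunit H \<bullet> x = x"
  unfolding twisted_mult_right_twist
  by (subst sweedler2_unit, intro lin) (simp add: cocycle_unit right_twist_unit counit_left)

lemma twisted_mult_unit: "x \<bullet> hunit H = x"
proof -
  have "sw (\<lambda>c d. \<chi> (a \<otimes> c) *\<^sub>C right_twist b d) (hunit H) = counit H a *\<^sub>C b" for a b
    by (subst sweedler2_unit) (intro lin | simp add: cocycle_unit right_twist_unit)+
  then show ?thesis
    by (simp add: twisted_mult_right_twist counit_left)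
qed

end

section \<open>Associativity and antipode of the twisted product\<close>

context hopf_cocycle begin

lemma conjugated_front:
  "cube.conjugated (\<lambda>t. \<chi> (front t)) (\<lambda>t. \<psi> (front t)) mult_left (x \<otimes> y \<otimes> z) = (x \<bullet> y) \<otimes> z"
proof -
  note l = lin clinear_compose[OF front_linear]
  have inner: "cube.right_convolution mult_left (\<lambda>t. \<psi> (front t)) (b \<otimes> d \<otimes> h) = right_twist b d \<otimes> h"
    for b d h
  proof -
    have "cube.right_convolution mult_left (\<lambda>t. \<psi> (front t)) (b \<otimes> d \<otimes> h) =
        sw (\<lambda>p q. sw (\<lambda>r s. sw (\<lambda>u v.
          \<psi> (front (q \<otimes> s \<otimes> v)) *\<^sub>C mult_left (p \<otimes> r \<otimes> u)) h) d) b"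
      by (rule convolution3_pure[OF cbilinear_scaleC_flip mult_left_linear]) (intro l)
    also have "\<dots> = sw (\<lambda>p q. sw (\<lambda>r s. sw (\<lambda>u v.
          counit H v *\<^sub>C (\<psi> (q \<otimes> s) *\<^sub>C ((p \<cdot> r) \<otimes> u))) h) d) b"
      by (simp only: front_pure mult_left_pure clinear_scaleC[OF inverse_linear] complex_scaleC_def scaleC_scaleC)
    also have "\<dots> = sw (\<lambda>p q. sw (\<lambda>r s. \<psi> (q \<otimes> s) *\<^sub>C ((p \<cdot> r) \<otimes> h)) d) b"
      by (rule sweedler2_cong, rule sweedler2_cong, rule sweedler2_counit_right) (intro lin)
    also have "\<dots> = right_twist b d \<otimes> h"
      by (simp only: right_twist_def sweedler2_linear[OF clinear_pure_left[OF clinear_id]] pure_scaleC)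
    finally show ?thesis .
  qed
  have "cube.conjugated (\<lambda>t. \<chi> (front t)) (\<lambda>t. \<psi> (front t)) mult_left (x \<otimes> y \<otimes> z) =
      sw (\<lambda>a b. sw (\<lambda>c d. sw (\<lambda>e h.
        \<chi> (front (a \<otimes> c \<otimes> e)) *\<^sub>C (right_twist b d \<otimes> h)) z) y) x"
    unfolding cube.conjugated_def inner[symmetric]
    by (rule convolution3_pure[OF cbilinear_scaleC])
      (intro l cube.right_convolution_linear mult_left_linear)+
  also have "\<dots> = sw (\<lambda>a b. sw (\<lambda>c d. sw (\<lambda>e h.
        counit H e *\<^sub>C (\<chi> (a \<otimes> c) *\<^sub>C (right_twist b d \<otimes> h))) z) y) x"
    by (simp only: front_pure clinear_scaleC[OF cocycle_linear] complex_scaleC_def scaleC_scaleC)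
  also have "\<dots> = sw (\<lambda>a b. sw (\<lambda>c d. \<chi> (a \<otimes> c) *\<^sub>C (right_twist b d \<otimes> z)) y) x"
    by (rule sweedler2_cong, rule sweedler2_cong, rule sweedler2_counit_left) (intro lin)
  also have "\<dots> = (x \<bullet> y) \<otimes> z"
    by (simp only: twisted_mult_right_twist sweedler2_linear[OF clinear_pure_left[OF clinear_id]] pure_scaleC)
  finally show ?thesis .
qed

lemma conjugated_rear:
  "cube.conjugated (\<lambda>t. \<chi> (rear t)) (\<lambda>t. \<psi> (rear t)) mult_right (x \<otimes> y \<otimes> z) = x \<otimes> (y \<bullet> z)"
proof -
  note l = lin clinear_compose[OF rear_linear]
  have inner: "cube.right_convolution mult_right (\<lambda>t. \<psi> (rear t)) (b \<otimes> d \<otimes> h) = b \<otimes> right_twist d h"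
    for b d h
  proof -
    have "cube.right_convolution mult_right (\<lambda>t. \<psi> (rear t)) (b \<otimes> d \<otimes> h) =
        sw (\<lambda>p q. sw (\<lambda>r s. sw (\<lambda>u v.
          \<psi> (rear (q \<otimes> s \<otimes> v)) *\<^sub>C mult_right (p \<otimes> r \<otimes> u)) h) d) b"
      by (rule convolution3_pure[OF cbilinear_scaleC_flip mult_right_linear]) (intro l)
    also have "\<dots> = sw (\<lambda>p q. counit H q *\<^sub>C (p \<otimes> right_twist d h)) b"
      by (simp only: rear_pure mult_right_pure clinear_scaleC[OF inverse_linear] complex_scaleC_def
          right_twist_def sweedler2_linear[OF clinear_pure_right[OF clinear_id]] pure_scaleC
          sweedler2_scaleC_right scaleC_scaleC)
    also have "\<dots> = b \<otimes> right_twist d h"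
      by (rule sweedler2_counit_right) (intro lin)
    finally show ?thesis .
  qed
  have "cube.conjugated (\<lambda>t. \<chi> (rear t)) (\<lambda>t. \<psi> (rear t)) mult_right (x \<otimes> y \<otimes> z) =
      sw (\<lambda>a b. sw (\<lambda>c d. sw (\<lambda>e h.
        \<chi> (rear (a \<otimes> c \<otimes> e)) *\<^sub>C (b \<otimes> right_twist d h)) z) y) x"
    unfolding cube.conjugated_def inner[symmetric]
    by (rule convolution3_pure[OF cbilinear_scaleC])
      (intro l cube.right_convolution_linear mult_right_linear)+
  also have "\<dots> = sw (\<lambda>a b. counit H a *\<^sub>C (b \<otimes> (y \<bullet> z))) x"
    by (simp only: rear_pure clinear_scaleC[OF cocycle_linear] complex_scaleC_def
        twisted_mult_right_twist sweedler2_linear[OF clinear_pure_right[OF clinear_id]] pure_scaleC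
        sweedler2_scaleC_right scaleC_scaleC)
  also have "\<dots> = x \<otimes> (y \<bullet> z)"
    by (rule sweedler2_counit_left) (intro lin)
  finally show ?thesis .
qed

text \<open>
  Both sides are conjugates of the triple product, one by the pull-backs of the cocycle along \<open>front\<close> and
  \<open>mult_left\<close>, the other by those along \<open>rear\<close> and \<open>mult_right\<close>. The cocycle identity says that the
  two convolution products agree, and then so do their inverses.
\<close>

lemma twisted_mult_assoc: "(x \<bullet> y) \<bullet> z = x \<bullet> (y \<bullet> z)"
proof -
  let ?t = "x \<otimes> y \<otimes> z"
  note l = lin clinear_compose[OF front_linear] clinear_compose[OF rear_linear]
    clinear_compose[OF mult_left_linear] clinear_compose[OF mult_right_linear]
  let ?F = "cube.left_convolution (\<lambda>t. \<chi> (front t)) (\<lambda>t. \<chi> (mult_left t))"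
  let ?F' = "cube.left_convolution (\<lambda>t. \<psi> (mult_left t)) (\<lambda>t. \<psi> (front t))"
  let ?R = "cube.left_convolution (\<lambda>t. \<chi> (rear t)) (\<lambda>t. \<chi> (mult_right t))"
  let ?R' = "cube.left_convolution (\<lambda>t. \<psi> (mult_right t)) (\<lambda>t. \<psi> (rear t))"
  note pull = inverses_coalgebra_map[OF cube.coalgebra_axioms square.coalgebra_axioms _ cocycle_inverses]
  have inv: "cube.inverses ?F ?F'" "cube.inverses ?R ?R'"
    by (intro cube.inverses_convolution pull coalgebra_map_front coalgebra_map_rear
        coalgebra_map_mult_left coalgebra_map_mult_right)+
  have "?F t = ?R t" for t
  proof (rule tensor_ext3[where t = t])
    show "clinear ?F" "clinear ?R"
      using inv by (simp_all add: cube.inverses_def)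
    fix x y z
    have "?F (x \<otimes> y \<otimes> z) = sw (\<lambda>a b. sw (\<lambda>c d. sw (\<lambda>e h.
        \<chi> (front (a \<otimes> c \<otimes> e)) *\<^sub>C \<chi> (mult_left (b \<otimes> d \<otimes> h))) z) y) x"
      by (rule convolution3_pure[OF cbilinear_scaleC]) (intro l)+
    also have "\<dots> = sw (\<lambda>a b. sw (\<lambda>c d. sw (\<lambda>e h.
        counit H e *\<^sub>C (\<chi> (a \<otimes> c) * \<chi> ((b \<cdot> d) \<otimes> h))) z) y) x"
      by (simp only: front_pure mult_left_pure clinear_scaleC[OF cocycle_linear] complex_scaleC_def mult.assoc)
    also have "\<dots> = sw (\<lambda>a b. sw (\<lambda>c d. \<chi> (a \<otimes> c) * \<chi> ((b \<cdot> d) \<otimes> z)) y) x"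
      by (rule sweedler2_cong, rule sweedler2_cong, rule sweedler2_counit_left) (intro lin)
    also have "\<dots> = sw (\<lambda>c d. sw (\<lambda>e h. \<chi> (c \<otimes> e) * \<chi> (x \<otimes> (d \<cdot> h))) z) y"
      by (rule cocycle_identity)
    also have "\<dots> = sw (\<lambda>a b. counit H a *\<^sub>C
        sw (\<lambda>c d. sw (\<lambda>e h. \<chi> (c \<otimes> e) * \<chi> (b \<otimes> (d \<cdot> h))) z) y) x"
      by (rule sweedler2_counit_left[symmetric]) (intro lin)
    also have "\<dots> = sw (\<lambda>a b. sw (\<lambda>c d. sw (\<lambda>e h.
        \<chi> (rear (a \<otimes> c \<otimes> e)) *\<^sub>C \<chi> (mult_right (b \<otimes> d \<otimes> h))) z) y) x"
      by (simp only: rear_pure mult_right_pure clinear_scaleC[OF cocycle_linear] complex_scaleC_def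
          sweedler2_complex_right mult.assoc)
    also have "\<dots> = ?R (x \<otimes> y \<otimes> z)"
      by (rule convolution3_pure[OF cbilinear_scaleC, symmetric]) (intro l)+
    finally show "?F (x \<otimes> y \<otimes> z) = ?R (x \<otimes> y \<otimes> z)" .
  qed
  then have FR: "?F = ?R"
    by (rule ext)
  with inv have FR': "?F' = ?R'"
    using cube.inverses_unique by simp
  have assoc: "M (mult_left t) = M (mult_right t)" for t
    by (rule tensor_ext3[where t = t])
      (intro clinear_compose[OF mult_tensor_linear] l |
        simp add: mult_left_pure mult_right_pure mult_tensor_pure mult_assoc)+
  note compose = conjugated_compose[OF cube.coalgebra_axioms square.coalgebra_axioms _
      cocycle_linear inverse_linear _ _ mult_tensor_linear]
  have "(x \<bullet> y) \<bullet> z = cube.conjugated ?F ?F' (\<lambda>t. M (mult_left t)) ?t"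
    unfolding twisted_mult_def[of "x \<bullet> y"] conjugated_front[symmetric]
    by (rule compose[OF coalgebra_map_mult_left]) (intro l)+
  also have "\<dots> = cube.conjugated ?R ?R' (\<lambda>t. M (mult_right t)) ?t"
    by (simp only: FR FR' assoc)
  also have "\<dots> = x \<bullet> (y \<bullet> z)"
    unfolding twisted_mult_def[of x "y \<bullet> z"] conjugated_rear[symmetric]
    by (rule compose[OF coalgebra_map_mult_right, symmetric]) (intro l)+
  finally show ?thesis .
qed

abbreviation "\<kappa> \<equiv> kappa H \<chi>"
abbreviation "\<kappa>' \<equiv> kappa_inv H \<chi>"

lemma kappa_eq: "\<kappa> x = sw (\<lambda>a b. \<chi> (a \<otimes> \<S> b)) x"
  and kappa_inv_eq: "\<kappa>' x = sw (\<lambda>a b. \<psi> (\<S> a \<otimes> b)) x"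
  by (simp_all add: kappa_def kappa_inv_def)

lemma lin_kappa [lin]: "clinear f \<Longrightarrow> clinear (\<lambda>x. \<kappa> (f x))"
  unfolding kappa_eq by (intro lin)

lemma lin_kappa_inv [lin]: "clinear f \<Longrightarrow> clinear (\<lambda>x. \<kappa>' (f x))"
  unfolding kappa_inv_eq by (intro lin)

lemma lin_sweedler3 [lin]:
  "(\<And>a b c. clinear (\<lambda>x. F x a b c)) \<Longrightarrow> clinear (\<lambda>x. sw3 (\<lambda>a b c. F x a b c) y)"
  unfolding sweedler3_def by (intro lin)

lemma lin_sweedler3' [lin]:
  assumes "\<And>b c. clinear (\<lambda>a. F a b c)" "\<And>a c. clinear (\<lambda>b. F a b c)" "\<And>a b. clinear (\<lambda>c. F a b c)"
    and "clinear f"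
  shows "clinear (\<lambda>x. sw3 (\<lambda>a b c. F a b c) (f x))"
  unfolding sweedler3_def by (intro lin assms)

lemma sweedler3_counit_mid:
  assumes F: "cbilinear (\<lambda>a b. F a b :: 'b::complex_vector)"
  shows "sw3 (\<lambda>p y s. counit H y *\<^sub>C F p s) x = sw F x"
  unfolding sweedler3_def
  by (rule sweedler2_cong, rule sweedler2_counit_left) (intro cbilinear_right[OF F] lin)

lemma sweedler3_scaleC_left:
  fixes v :: "'b::complex_vector"
  shows "sw3 F x *\<^sub>C v = sw3 (\<lambda>a b c. F a b c *\<^sub>C v) x"
  by (simp only: sweedler3_def sweedler2_scaleC_left)

lemma sweedler3_scaleC_right:
  fixes F :: "'a \<Rightarrow> 'a \<Rightarrow> 'a \<Rightarrow> 'b::complex_vector"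
  shows "v *\<^sub>C sw3 F x = sw3 (\<lambda>a b c. v *\<^sub>C F a b c) x"
  by (simp only: sweedler3_def sweedler2_scaleC_right)

text \<open>
  This is $\chi^{-1} \star \chi = \varepsilon$ evaluated at $(S x_1, x_2)$; the antipode reverses the legs, so that
  the value of $\chi^{-1}$ stands inside.
\<close>

lemma kappa_inv_cocycle: "sw3 (\<lambda>q c r. \<kappa>' c *\<^sub>C \<chi> (\<S> q \<otimes> r)) x = counit H x"
proof -
  have "sw (\<lambda>p q. sw (\<lambda>r s. \<psi> (\<S> q \<otimes> r) * \<chi> (\<S> p \<otimes> s)) b) a =
      counit H a * counit H b" for a b
    using inverse_cocycle[of b "\<S> a"]
    by (subst (asm) sweedler2_antipode) (intro lin | simp add: counit_antipode)+
  then have "counit H x = sw (\<lambda>a b. sw (\<lambda>p q. sw (\<lambda>r s.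
      \<psi> (\<S> q \<otimes> r) * \<chi> (\<S> p \<otimes> s)) b) a) x"
    by (simp add: sweedler2_counit_counit)
  also have "\<dots> = sw (\<lambda>p y. sw (\<lambda>z s. sw (\<lambda>q r.
      \<psi> (\<S> q \<otimes> r) * \<chi> (\<S> p \<otimes> s)) z) y) x"
    by (rule sweedler2_sandwich) (intro lin)+
  finally show ?thesis
    by (simp only: sweedler3_def kappa_inv_eq sweedler2_complex_left complex_scaleC_def)
qed

text \<open>
  The same with $(x_1, S x_2)$; now the value of $\chi$ stands inside.
\<close>

lemma kappa_cocycle_inverse: "sw3 (\<lambda>q c r. \<kappa> c *\<^sub>C \<psi> (q \<otimes> \<S> r)) x = counit H x"
proof -
  have "sw (\<lambda>p q. sw (\<lambda>r s. \<psi> (p \<otimes> \<S> s) * \<chi> (q \<otimes> \<S> r)) b) a =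
      counit H a * counit H b" for a b
  proof -
    have "sw (\<lambda>c d. \<psi> (p \<otimes> c) * \<chi> (q \<otimes> d)) (\<S> b) =
        sw (\<lambda>r s. \<psi> (p \<otimes> \<S> s) * \<chi> (q \<otimes> \<S> r)) b" for p q
      by (rule sweedler2_antipode) (intro lin)
    then show ?thesis
      using inverse_cocycle[of "\<S> b" a] by (simp add: counit_antipode)
  qed
  then have "counit H x = sw (\<lambda>a b. sw (\<lambda>p q. sw (\<lambda>r s.
      \<psi> (p \<otimes> \<S> s) * \<chi> (q \<otimes> \<S> r)) b) a) x"
    by (simp add: sweedler2_counit_counit)
  also have "\<dots> = sw (\<lambda>p y. sw (\<lambda>z s. sw (\<lambda>q r.
      \<psi> (p \<otimes> \<S> s) * \<chi> (q \<otimes> \<S> r)) z) y) x"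
    by (rule sweedler2_sandwich) (intro lin)+
  also have "\<dots> = sw (\<lambda>p y. sw (\<lambda>z s. sw (\<lambda>q r.
      \<chi> (q \<otimes> \<S> r) * \<psi> (p \<otimes> \<S> s)) z) y) x"
    by (simp only: mult.commute)
  also have "\<dots> = sw3 (\<lambda>p z s. \<kappa> z *\<^sub>C \<psi> (p \<otimes> \<S> s)) x"
    by (simp only: sweedler3_def kappa_eq sweedler2_complex_left complex_scaleC_def)
  finally show ?thesis
    by (rule HOL.sym)
qed

text \<open>
  Solved for its last factor, the cocycle identity reads
  $\chi(x, y z) = \sum \chi^{-1}(y_1, z_1)\, \chi(x_1, y_2)\, \chi(x_2 y_3, z_2)$.
  At $(x_1, S x_2, x_3)$ the left-hand side is $\varepsilon(x)$, and on the right-hand side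
  $x_2 y_3$ reduces to a scalar, so that $\kappa$ and $\kappa^{-1}$ remain.
\<close>

lemma kappa_kappa_inv: "sw (\<lambda>u v. \<kappa> u * \<kappa>' v) x = counit H x"
proof -
  define E where "E x y z = sw (\<lambda>x\<^sub>1 x\<^sub>2. sw (\<lambda>y\<^sub>1 y\<^sub>2.
    \<chi> (x\<^sub>1 \<otimes> y\<^sub>1) * \<chi> ((x\<^sub>2 \<cdot> y\<^sub>2) \<otimes> z)) y) x" for x y z
  have El: "clinear f \<Longrightarrow> clinear (\<lambda>x. E (f x) y z)" "clinear f \<Longrightarrow> clinear (\<lambda>x. E y (f x) z)"
    "clinear f \<Longrightarrow> clinear (\<lambda>x. E y z (f x))" for f :: "'a \<Rightarrow> 'a" and y z
    unfolding E_def by (intro lin; assumption)+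
  \<comment> \<open>The product of a leg with the antipode of the next one collapses.\<close>
  have E1: "sw (\<lambda>a p. E a (\<S> p) s) u = \<kappa> u * counit H s" for u s
  proof -
    have "E a (\<S> b) s = sw (\<lambda>p q. sw (\<lambda>r t.
        \<chi> (p \<otimes> \<S> t) * \<chi> ((q \<cdot> \<S> r) \<otimes> s)) b) a" for a b
      unfolding E_def by (rule sweedler2_cong, rule sweedler2_antipode) (intro lin)
    then have "sw (\<lambda>a p. E a (\<S> p) s) u = sw (\<lambda>a b. sw (\<lambda>p q.
        sw (\<lambda>r t. \<chi> (p \<otimes> \<S> t) * \<chi> ((q \<cdot> \<S> r) \<otimes> s)) b) a) u"
      by simp
    also have "\<dots> = sw (\<lambda>p y. sw (\<lambda>z t. sw (\<lambda>q r.
        \<chi> (p \<otimes> \<S> t) * \<chi> ((q \<cdot> \<S> r) \<otimes> s)) z) y) u"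
      by (rule sweedler2_sandwich) (intro lin)+
    also have "\<dots> = sw (\<lambda>p y. sw (\<lambda>z t.
        counit H z *\<^sub>C (\<chi> (p \<otimes> \<S> t) * counit H s)) y) u"
    proof -
      have "sw (\<lambda>q r. \<chi> ((q \<cdot> \<S> r) \<otimes> s)) z = counit H z * counit H s" for z
      proof -
        have L: "clinear (\<lambda>w. \<chi> (w \<otimes> s))"
          by (intro lin)
        show ?thesis
          using sweedler2_linear[OF L, of "\<lambda>q r. q \<cdot> \<S> r" z]
          by (simp add: antipode_right clinear_scaleC[OF L] cocycle_unit complex_scaleC_def)
      qed
      then show ?thesis
        by (simp only: sweedler2_complex_right[symmetric] complex_scaleC_def mult.left_commute)
    qed
    also have "\<dots> = sw (\<lambda>p y. \<chi> (p \<otimes> \<S> y) * counit H s) u"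
      by (rule sweedler2_cong, rule sweedler2_counit_left) (intro lin)
    finally show ?thesis
      by (simp only: kappa_eq sweedler2_complex_left)
  qed
  \<comment> \<open>The cocycle identity, convolved with the inverse of the cocycle.\<close>
  have E2: "\<chi> (a \<otimes> (y \<cdot> z)) = sw (\<lambda>p q. sw (\<lambda>r s. \<psi> (p \<otimes> r) * E a q s) z) y" for a y z
  proof -
    define g where "g t = \<chi> (a \<otimes> M t)" for t
    have g: "clinear g"
      unfolding g_def[abs_def] by (intro lin mult_tensor_linear)
    have Eg: "E a q s = square.left_convolution \<chi> g (q \<otimes> s)" for q s
    proof -
      have "square.left_convolution \<chi> g (q \<otimes> s) =
          sw (\<lambda>b c. sw (\<lambda>d e. \<chi> (b \<otimes> d) *\<^sub>C g (c \<otimes> e)) s) q"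
        by (rule convolution2_pure[OF cbilinear_scaleC cocycle_linear g])
      then show ?thesis
        by (simp only: E_def cocycle_identity complex_scaleC_def g_def mult_tensor_pure)
    qed
    have "sw (\<lambda>p q. sw (\<lambda>r s. \<psi> (p \<otimes> r) * E a q s) z) y =
        square.left_convolution \<psi> (square.left_convolution \<chi> g) (y \<otimes> z)"
      unfolding Eg complex_scaleC_def[symmetric]
      by (rule convolution2_pure[OF cbilinear_scaleC inverse_linear, symmetric])
        (intro square.left_convolution_linear cocycle_linear g)
    also have "\<dots> = square.left_convolution (square.left_convolution \<psi> \<chi>) g (y \<otimes> z)"
      by (simp only: square.left_left_assoc[OF inverse_linear cocycle_linear g])
    also have "\<dots> = g (y \<otimes> z)"
      using cocycle_inverses by (simp add: square.inverses_def square.counit_convolution[OF g])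
    finally show ?thesis
      by (simp add: g_def mult_tensor_pure)
  qed
  have "counit H x = sw (\<lambda>a u. counit H u *\<^sub>C counit H a) x"
    by (rule sweedler2_counit_right[symmetric]) (rule counit_linear)
  also have "\<dots> = sw (\<lambda>a u. sw (\<lambda>b c. \<chi> (a \<otimes> (\<S> b \<cdot> c))) u) x"
  proof -
    have "sw (\<lambda>b c. \<chi> (a \<otimes> (\<S> b \<cdot> c))) u = counit H u *\<^sub>C counit H a" for a u
    proof -
      have L: "clinear (\<lambda>w. \<chi> (a \<otimes> w))"
        by (intro lin)
      show ?thesis
        using sweedler2_linear[OF L, of "\<lambda>q r. \<S> q \<cdot> r" u]
        by (simp add: antipode_left clinear_scaleC[OF L] cocycle_unit)
    qed
    then show ?thesis
      by simp
  qed
  also have "\<dots> = sw (\<lambda>a u. sw (\<lambda>b c. sw (\<lambda>p q. sw (\<lambda>r s.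
      \<psi> (\<S> q \<otimes> r) * E a (\<S> p) s) c) b) u) x"
    unfolding E2
    by (rule sweedler2_cong, rule sweedler2_cong, rule sweedler2_antipode) (intro lin El)
  also have "\<dots> = sw (\<lambda>a u. sw (\<lambda>p y. sw (\<lambda>z s. sw (\<lambda>q r.
      \<psi> (\<S> q \<otimes> r) * E a (\<S> p) s) z) y) u) x"
    by (rule sweedler2_cong, rule sweedler2_sandwich) (intro lin El)+
  also have "\<dots> = sw (\<lambda>a u. sw (\<lambda>p y. sw (\<lambda>z s. \<kappa>' z * E a (\<S> p) s) y) u) x"
    by (simp only: kappa_inv_eq sweedler2_complex_left)
  also have "\<dots> = sw (\<lambda>v y. sw (\<lambda>a p. sw (\<lambda>z s. \<kappa>' z * E a (\<S> p) s) y) v) x"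
    by (rule sweedler2_assoc[symmetric]) (intro lin El)+
  also have "\<dots> = sw (\<lambda>v y. sw (\<lambda>z s. sw (\<lambda>a p. \<kappa>' z * E a (\<S> p) s) v) y) x"
    by (rule sweedler2_cong, rule sweedler2_swap)
  also have "\<dots> = sw (\<lambda>v y. sw (\<lambda>z s. counit H s *\<^sub>C (\<kappa> v * \<kappa>' z)) y) x"
    by (simp only: sweedler2_complex_right[symmetric] E1 complex_scaleC_def mult_ac)
  also have "\<dots> = sw (\<lambda>v y. \<kappa> v * \<kappa>' y) x"
    by (rule sweedler2_cong, rule sweedler2_counit_right) (intro lin)
  finally show ?thesis
    by (rule HOL.sym)
qed

definition twisted_antipode :: "'a \<Rightarrow> 'a"
  where "twisted_antipode = convolve_operator H \<kappa> \<S> \<kappa>'"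

lemma twisted_antipode_eq:
  "twisted_antipode x = sw3 (\<lambda>a b c. (\<kappa> a * \<kappa>' c) *\<^sub>C \<S> b) x"
  by (simp add: twisted_antipode_def convolve_operator_def)

lemma twisted_antipode_linear: "clinear twisted_antipode"
  unfolding twisted_antipode_eq[abs_def] by (intro lin)

text \<open>
  Expand the twisted product around the inner factor: the value of $\chi$ cancels against $\kappa^{-1}$ by
  \<open>kappa_inv_cocycle\<close>, then $S$ against the identity, and what remains of $\chi^{-1}$ is $\kappa^{-1}$.
\<close>

lemma left_cancellation:
  "sw3 (\<lambda>b c d. \<kappa>' c *\<^sub>C (\<S> b \<bullet> d)) w = \<kappa>' w *\<^sub>C hunit H"
proof -
  have N: "sw3 (\<lambda>q c r. \<kappa>' c *\<^sub>C left_twist (\<S> q) r) y = counit H y *\<^sub>C hunit H" for y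
  proof -
    have "left_twist (\<S> q) r = sw (\<lambda>p q'. sw (\<lambda>r' s. \<chi> (\<S> q' \<otimes> r') *\<^sub>C (\<S> p \<cdot> s)) r) q"
      for q r
      unfolding left_twist_def by (rule sweedler2_antipode) (intro lin)
    then have "sw3 (\<lambda>q c r. \<kappa>' c *\<^sub>C left_twist (\<S> q) r) y =
        sw3 (\<lambda>q c r. sw (\<lambda>p q'. sw (\<lambda>r' s.
          (\<kappa>' c *\<^sub>C \<chi> (\<S> q' \<otimes> r')) *\<^sub>C (\<S> p \<cdot> s)) r) q) y"
      by (simp only: sweedler2_scaleC_right scaleC_scaleC complex_scaleC_def)
    also have "\<dots> = sw3 (\<lambda>p z s. sw3 (\<lambda>q' c r'.
          (\<kappa>' c *\<^sub>C \<chi> (\<S> q' \<otimes> r')) *\<^sub>C (\<S> p \<cdot> s)) z) y"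
      by (rule sweedler3_sandwich) (intro lin)+
    also have "\<dots> = sw3 (\<lambda>p z s. counit H z *\<^sub>C (\<S> p \<cdot> s)) y"
      by (simp only: sweedler3_scaleC_left[symmetric] kappa_inv_cocycle)
    also have "\<dots> = sw (\<lambda>p s. \<S> p \<cdot> s) y"
      by (rule sweedler3_counit_mid) (intro lin)
    finally show ?thesis
      by (simp only: antipode_left)
  qed
  have "\<S> b \<bullet> d = sw (\<lambda>p q. sw (\<lambda>r s. \<psi> (\<S> p \<otimes> s) *\<^sub>C left_twist (\<S> q) r) d) b" for b d
    unfolding twisted_mult_left_twist by (rule sweedler2_antipode) (intro lin)
  then have "sw3 (\<lambda>b c d. \<kappa>' c *\<^sub>C (\<S> b \<bullet> d)) w =
      sw3 (\<lambda>b c d. sw (\<lambda>p q. sw (\<lambda>r s.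
        \<psi> (\<S> p \<otimes> s) *\<^sub>C (\<kappa>' c *\<^sub>C left_twist (\<S> q) r)) d) b) w"
    by (simp only: sweedler2_scaleC_right scaleC_scaleC mult.commute)
  also have "\<dots> = sw3 (\<lambda>p y s. sw3 (\<lambda>q c r.
        \<psi> (\<S> p \<otimes> s) *\<^sub>C (\<kappa>' c *\<^sub>C left_twist (\<S> q) r)) y) w"
    by (rule sweedler3_sandwich) (intro lin)+
  also have "\<dots> = sw3 (\<lambda>p y s. \<psi> (\<S> p \<otimes> s) *\<^sub>C (counit H y *\<^sub>C hunit H)) w"
    by (simp only: sweedler3_scaleC_right[symmetric] N)
  also have "\<dots> = sw3 (\<lambda>p y s. counit H y *\<^sub>C (\<psi> (\<S> p \<otimes> s) *\<^sub>C hunit H)) w"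
    by (simp only: scaleC_scaleC mult.commute)
  also have "\<dots> = sw (\<lambda>p s. \<psi> (\<S> p \<otimes> s) *\<^sub>C hunit H) w"
    by (rule sweedler3_counit_mid) (intro lin)
  finally show ?thesis
    by (simp only: kappa_inv_eq sweedler2_scaleC_left)
qed

text \<open>
  The mirror image: the value of $\chi^{-1}$ cancels against $\kappa$, and what remains of $\chi$ is $\kappa$.
\<close>

lemma right_cancellation:
  "sw3 (\<lambda>a b c. \<kappa> b *\<^sub>C (a \<bullet> \<S> c)) u = \<kappa> u *\<^sub>C hunit H"
proof -
  have N: "sw3 (\<lambda>q b r. \<kappa> b *\<^sub>C right_twist q (\<S> r)) y = counit H y *\<^sub>C hunit H" for y
  proof -
    have "right_twist q (\<S> r) = sw (\<lambda>p q'. sw (\<lambda>r' s. \<psi> (q' \<otimes> \<S> r') *\<^sub>C (p \<cdot> \<S> s)) r) q"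
      for q r
      unfolding right_twist_def by (rule sweedler2_cong, rule sweedler2_antipode) (intro lin)
    then have "sw3 (\<lambda>q b r. \<kappa> b *\<^sub>C right_twist q (\<S> r)) y =
        sw3 (\<lambda>q b r. sw (\<lambda>p q'. sw (\<lambda>r' s.
          (\<kappa> b *\<^sub>C \<psi> (q' \<otimes> \<S> r')) *\<^sub>C (p \<cdot> \<S> s)) r) q) y"
      by (simp only: sweedler2_scaleC_right scaleC_scaleC complex_scaleC_def)
    also have "\<dots> = sw3 (\<lambda>p z s. sw3 (\<lambda>q' b r'.
          (\<kappa> b *\<^sub>C \<psi> (q' \<otimes> \<S> r')) *\<^sub>C (p \<cdot> \<S> s)) z) y"
      by (rule sweedler3_sandwich) (intro lin)+
    also have "\<dots> = sw3 (\<lambda>p z s. counit H z *\<^sub>C (p \<cdot> \<S> s)) y"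
      by (simp only: sweedler3_scaleC_left[symmetric] kappa_cocycle_inverse)
    also have "\<dots> = sw (\<lambda>p s. p \<cdot> \<S> s) y"
      by (rule sweedler3_counit_mid) (intro lin)
    finally show ?thesis
      by (simp only: antipode_right)
  qed
  have "a \<bullet> \<S> c = sw (\<lambda>p q. sw (\<lambda>r s. \<chi> (p \<otimes> \<S> s) *\<^sub>C right_twist q (\<S> r)) c) a" for a c
    unfolding twisted_mult_right_twist by (rule sweedler2_cong, rule sweedler2_antipode) (intro lin)
  then have "sw3 (\<lambda>a b c. \<kappa> b *\<^sub>C (a \<bullet> \<S> c)) u =
      sw3 (\<lambda>a b c. sw (\<lambda>p q. sw (\<lambda>r s.
        \<chi> (p \<otimes> \<S> s) *\<^sub>C (\<kappa> b *\<^sub>C right_twist q (\<S> r))) c) a) u"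
    by (simp only: sweedler2_scaleC_right scaleC_scaleC mult.commute)
  also have "\<dots> = sw3 (\<lambda>p y s. sw3 (\<lambda>q b r.
        \<chi> (p \<otimes> \<S> s) *\<^sub>C (\<kappa> b *\<^sub>C right_twist q (\<S> r))) y) u"
    by (rule sweedler3_sandwich) (intro lin)+
  also have "\<dots> = sw3 (\<lambda>p y s. \<chi> (p \<otimes> \<S> s) *\<^sub>C (counit H y *\<^sub>C hunit H)) u"
    by (simp only: sweedler3_scaleC_right[symmetric] N)
  also have "\<dots> = sw3 (\<lambda>p y s. counit H y *\<^sub>C (\<chi> (p \<otimes> \<S> s) *\<^sub>C hunit H)) u"
    by (simp only: scaleC_scaleC mult.commute)
  also have "\<dots> = sw (\<lambda>p s. \<chi> (p \<otimes> \<S> s) *\<^sub>C hunit H) u"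
    by (rule sweedler3_counit_mid) (intro lin)
  finally show ?thesis
    by (simp only: kappa_eq sweedler2_scaleC_left)
qed

lemma sweedler2_twisted_left:
  "sw F x \<bullet> y = sw (\<lambda>a b. F a b \<bullet> y) x"
  by (rule sweedler2_linear) (intro lin)

lemma sweedler2_twisted_right:
  "y \<bullet> sw F x = sw (\<lambda>a b. y \<bullet> F a b) x"
  by (rule sweedler2_linear) (intro lin)

lemma twisted_scaleC: "(c *\<^sub>C x) \<bullet> y = c *\<^sub>C (x \<bullet> y)" "x \<bullet> (c *\<^sub>C y) = c *\<^sub>C (x \<bullet> y)"
  by (rule clinear_scaleC, intro lin)+

lemma twisted_antipode_left:
  "sw (\<lambda>a b. twisted_antipode a \<bullet> b) x = counit H x *\<^sub>C hunit H"
proof -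
  have "sw (\<lambda>a b. twisted_antipode a \<bullet> b) x =
      sw (\<lambda>y d. sw (\<lambda>a u. sw (\<lambda>b c. (\<kappa> a * \<kappa>' c) *\<^sub>C (\<S> b \<bullet> d)) u) y) x"
    by (simp only: twisted_antipode_eq sweedler3_def sweedler2_twisted_left twisted_scaleC)
  also have "\<dots> = sw (\<lambda>a w. sw (\<lambda>u d. sw (\<lambda>b c. (\<kappa> a * \<kappa>' c) *\<^sub>C (\<S> b \<bullet> d)) u) w) x"
    by (rule sweedler2_assoc) (intro lin)+
  also have "\<dots> = sw (\<lambda>a w. sw (\<lambda>b v. sw (\<lambda>c d. (\<kappa> a * \<kappa>' c) *\<^sub>C (\<S> b \<bullet> d)) v) w) x"
    by (rule sweedler2_cong, rule sweedler2_assoc) (intro lin)+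
  also have "\<dots> = sw (\<lambda>a w. \<kappa> a *\<^sub>C sw3 (\<lambda>b c d. \<kappa>' c *\<^sub>C (\<S> b \<bullet> d)) w) x"
    by (simp only: sweedler3_def sweedler2_scaleC_right scaleC_scaleC)
  also have "\<dots> = sw (\<lambda>a w. \<kappa> a * \<kappa>' w) x *\<^sub>C hunit H"
    by (simp only: left_cancellation sweedler2_scaleC_left scaleC_scaleC)
  finally show ?thesis
    by (simp only: kappa_kappa_inv)
qed

lemma twisted_antipode_right:
  "sw (\<lambda>a b. a \<bullet> twisted_antipode b) x = counit H x *\<^sub>C hunit H"
proof -
  have "sw (\<lambda>a b. a \<bullet> twisted_antipode b) x =
      sw (\<lambda>a w. sw (\<lambda>b v. sw (\<lambda>c d. (\<kappa> b * \<kappa>' d) *\<^sub>C (a \<bullet> \<S> c)) v) w) x"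
    by (simp only: twisted_antipode_eq sweedler3_def sweedler2_twisted_right twisted_scaleC)
  also have "\<dots> = sw (\<lambda>a w. sw (\<lambda>v d. sw (\<lambda>b c. (\<kappa> b * \<kappa>' d) *\<^sub>C (a \<bullet> \<S> c)) v) w) x"
    by (rule sweedler2_cong, rule sweedler2_assoc[symmetric]) (intro lin)+
  also have "\<dots> = sw (\<lambda>u d. sw (\<lambda>a v. sw (\<lambda>b c. (\<kappa> b * \<kappa>' d) *\<^sub>C (a \<bullet> \<S> c)) v) u) x"
    by (rule sweedler2_assoc[symmetric]) (intro lin)+
  also have "\<dots> = sw (\<lambda>u d. \<kappa>' d *\<^sub>C sw3 (\<lambda>a b c. \<kappa> b *\<^sub>C (a \<bullet> \<S> c)) u) x"
    by (simp only: sweedler3_def sweedler2_scaleC_right scaleC_scaleC mult.commute)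
  also have "\<dots> = sw (\<lambda>u d. \<kappa> u * \<kappa>' d) x *\<^sub>C hunit H"
    by (simp only: right_cancellation sweedler2_scaleC_left scaleC_scaleC mult.commute)
  finally show ?thesis
    by (simp only: kappa_kappa_inv)
qed

lemma twisted_hopf_algebra_eq:
  "twisted_hopf_algebra H \<chi> = H\<lparr>hmult := (\<bullet>), antipode := twisted_antipode\<rparr>"
  by (simp add: twisted_hopf_algebra_def twisted_antipode_def twisted_mult_sweedler3[abs_def])

lemma sweedler2_twisted_hopf: "sweedler2 (twisted_hopf_algebra H \<chi>) = sw"
  by (intro ext) (simp add: sweedler2_def twisted_hopf_algebra_def)

lemma hopf_algebra_twisted: "hopf_algebra (twisted_hopf_algebra H \<chi>)"
  unfolding hopf_algebra_def sweedler2_twisted_hopf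
  unfolding twisted_hopf_algebra_eq
  by (simp add: twisted_mult_bilinear twisted_mult_assoc unit_twisted_mult twisted_mult_unit
      comult_linear counit_linear coassoc counit_left counit_right comult_twisted_mult comult_unit
      counit_twisted_mult counit_unit twisted_antipode_linear twisted_antipode_left twisted_antipode_right)

end

section \<open>Star cocycles\<close>

locale star_hopf_cocycle = star_hopf_algebra H + hopf_cocycle H \<chi>
  for H :: "'a::complex_vector star_hopf_data" and \<chi> +
  assumes cocycle_star: "\<chi> (x\<^bold>* \<otimes> y\<^bold>*) = cnj (\<chi> (y \<otimes> x))"
begin

lemma sweedler2_star_star:
  assumes "\<And>b c d. clinear (\<lambda>a. B a b c d)" "\<And>a c d. clinear (\<lambda>b. B a b c d)"
    "\<And>a b d. clinear (\<lambda>c. B a b c d)" "\<And>a b c. clinear (\<lambda>d. B a b c d)"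
  shows "sw (\<lambda>a b. sw (\<lambda>c d. B a b c d) (y\<^bold>*)) (x\<^bold>*) =
    sw (\<lambda>a b. sw (\<lambda>c d. B (a\<^bold>*) (b\<^bold>*) (c\<^bold>*) (d\<^bold>*)) y) x"
proof -
  have "sw (\<lambda>a b. sw (\<lambda>c d. B a b c d) (y\<^bold>*)) (x\<^bold>*) =
      sw (\<lambda>a b. sw (\<lambda>c d. B (a\<^bold>*) (b\<^bold>*) c d) (y\<^bold>*)) x"
    by (rule sweedler2_star) (intro lin assms)
  also have "\<dots> = sw (\<lambda>a b. sw (\<lambda>c d. B (a\<^bold>*) (b\<^bold>*) (c\<^bold>*) (d\<^bold>*)) y) x"
    by (rule sweedler2_cong, rule sweedler2_star) (intro lin assms)
  finally show ?thesis .
qed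

text \<open>
  The functional obtained from the inverse by the star and conjugation is also an inverse of the cocycle.
\<close>

lemma inverse_star: "\<psi> (x\<^bold>* \<otimes> y\<^bold>*) = cnj (\<psi> (y \<otimes> x))"
proof -
  define g where "g = tensor_sum (\<lambda>x y. cnj (\<psi> (y\<^bold>* \<otimes> x\<^bold>*)))"
  have bil: "cbilinear (\<lambda>x y. cnj (\<psi> (y\<^bold>* \<otimes> x\<^bold>*)))"
    by (intro cbilinearI clinear_cnj_star[where f = "\<lambda>u. \<psi> (u \<otimes> v)" for v]
        clinear_cnj_star[where f = "\<lambda>u. \<psi> (v \<otimes> u)" for v] lin)
  have g: "clinear g" and pure: "g (x \<otimes> y) = cnj (\<psi> (y\<^bold>* \<otimes> x\<^bold>*))" for x y
    unfolding g_def using bil by (simp_all add: clinear_tensor_sum tensor_universal_property(2))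
  have "convolution_inverses H \<chi> g"
    unfolding convolution_inverses_def
  proof (intro conjI allI)
    fix x y
    have "sw (\<lambda>a b. sw (\<lambda>c d. \<chi> (a \<otimes> c) * g (b \<otimes> d)) y) x =
        cnj (sw (\<lambda>c d. sw (\<lambda>a b. \<chi> (c\<^bold>* \<otimes> a\<^bold>*) * \<psi> (d\<^bold>* \<otimes> b\<^bold>*)) x) y)"
      by (subst sweedler2_swap) (simp only: cocycle_star pure cnj_sweedler2 complex_cnj_mult complex_cnj_cnj)
    also have "sw (\<lambda>c d. sw (\<lambda>a b. \<chi> (c\<^bold>* \<otimes> a\<^bold>*) * \<psi> (d\<^bold>* \<otimes> b\<^bold>*)) x) y =
        sw (\<lambda>c d. sw (\<lambda>a b. \<chi> (c \<otimes> a) * \<psi> (d \<otimes> b)) (x\<^bold>*)) (y\<^bold>*)"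
      by (rule sweedler2_star_star[symmetric]) (intro lin)+
    finally show "sw (\<lambda>a b. sw (\<lambda>c d. \<chi> (a \<otimes> c) * g (b \<otimes> d)) y) x =
        counit H x * counit H y"
      by (simp add: cocycle_inverse counit_star)
    have "sw (\<lambda>a b. sw (\<lambda>c d. g (a \<otimes> c) * \<chi> (b \<otimes> d)) y) x =
        cnj (sw (\<lambda>c d. sw (\<lambda>a b. \<psi> (c\<^bold>* \<otimes> a\<^bold>*) * \<chi> (d\<^bold>* \<otimes> b\<^bold>*)) x) y)"
      by (subst sweedler2_swap) (simp only: cocycle_star pure cnj_sweedler2 complex_cnj_mult complex_cnj_cnj)
    also have "sw (\<lambda>c d. sw (\<lambda>a b. \<psi> (c\<^bold>* \<otimes> a\<^bold>*) * \<chi> (d\<^bold>* \<otimes> b\<^bold>*)) x) y =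
        sw (\<lambda>c d. sw (\<lambda>a b. \<psi> (c \<otimes> a) * \<chi> (d \<otimes> b)) (x\<^bold>*)) (y\<^bold>*)"
      by (rule sweedler2_star_star[symmetric]) (intro lin)+
    finally show "sw (\<lambda>a b. sw (\<lambda>c d. g (a \<otimes> c) * \<chi> (b \<otimes> d)) y) x =
        counit H x * counit H y"
      by (simp add: inverse_cocycle counit_star)
  qed
  then have "g = \<psi>"
    using convolution_inverses_iff[OF cocycle_linear g] cocycle_inverses square.inverses_unique by blast
  then show ?thesis
    using pure[of "y" "x"] by simp
qed

lemma star_right_twist: "right_twist (y\<^bold>*) (x\<^bold>*) = (right_twist x y)\<^bold>*"
proof -
  have "right_twist (y\<^bold>*) (x\<^bold>*) = sw (\<lambda>a b. sw (\<lambda>c d. \<psi> (b\<^bold>* \<otimes> d\<^bold>*) *\<^sub>C (a\<^bold>* \<cdot> c\<^bold>*)) x) y"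
    unfolding right_twist_def by (rule sweedler2_star_star) (intro lin)+
  also have "\<dots> = sw (\<lambda>c d. sw (\<lambda>a b. \<psi> (b\<^bold>* \<otimes> d\<^bold>*) *\<^sub>C (a\<^bold>* \<cdot> c\<^bold>*)) y) x"
    by (rule sweedler2_swap)
  finally show ?thesis
    by (simp only: right_twist_def star_sweedler2 star_scaleC star_mult inverse_star)
qed

lemma star_twisted_mult: "(x \<bullet> y)\<^bold>* = y\<^bold>* \<bullet> x\<^bold>*"
proof -
  have "y\<^bold>* \<bullet> x\<^bold>* = sw (\<lambda>a b. sw (\<lambda>c d. \<chi> (a\<^bold>* \<otimes> c\<^bold>*) *\<^sub>C right_twist (b\<^bold>*) (d\<^bold>*)) x) y"
    unfolding twisted_mult_right_twist by (rule sweedler2_star_star) (intro lin)+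
  also have "\<dots> = sw (\<lambda>c d. sw (\<lambda>a b. \<chi> (a\<^bold>* \<otimes> c\<^bold>*) *\<^sub>C right_twist (b\<^bold>*) (d\<^bold>*)) y) x"
    by (rule sweedler2_swap)
  finally show ?thesis
    by (simp only: twisted_mult_right_twist star_sweedler2 star_scaleC cocycle_star star_right_twist)
qed

lemma star_hopf_algebra_twisted: "star_hopf_algebra (twisted_hopf_algebra H \<chi>)"
proof (intro star_hopf_algebra.intro star_hopf_algebra_axioms.intro)
  show "hopf_algebra (twisted_hopf_algebra H \<chi>)"
    by (rule hopf_algebra_twisted)
qed (simp_all only: sweedler2_twisted_hopf, simp_all add: twisted_hopf_algebra_eq
    star_conjugate_linear star_star star_twisted_mult comult_star)

lemma twist_Phi_eq:
  "twist_Phi H \<chi> x = sw3 (\<lambda>a b c. (\<kappa> (coantipode a) * \<kappa>' c) *\<^sub>C b) x"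
  by (simp add: twist_Phi_def convolve_operator_def inv_antipode)

end

section \<open>The integral of the twisted algebra\<close>

locale integral_star_hopf_cocycle =
  integral_star_hopf_algebra H \<phi> + star_hopf_cocycle H \<chi>
  for H :: "'a::complex_vector star_hopf_data" and \<phi> \<chi>
begin

text \<open>
  The last leg of \<open>y\<close> is moved to \<open>x\<close> by \<open>integral_move_right\<close>, which turns $\chi^{-1}$ into $\kappa^{-1}$.
\<close>

lemma integral_right_twist: "\<phi> (right_twist y x) = \<phi> (y \<cdot> sw (\<lambda>p u. \<kappa>' u *\<^sub>C p) x)"
proof -
  have move: "sw (\<lambda>a b. \<phi> (a \<cdot> c) * \<psi> (b \<otimes> d)) y =
      sw (\<lambda>p q. \<phi> (y \<cdot> p) * \<psi> (\<S> q \<otimes> d)) c" for c d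
  proof -
    have L: "clinear (\<lambda>u. \<psi> (u \<otimes> d))"
      by (intro lin)
    show ?thesis
      using arg_cong[OF integral_move_right[of y c], of "\<lambda>u. \<psi> (u \<otimes> d)"]
      by (simp add: sweedler2_linear[OF L] clinear_scaleC[OF L] complex_scaleC_def)
  qed
  have "\<phi> (right_twist y x) = sw (\<lambda>a b. sw (\<lambda>c d. \<phi> (a \<cdot> c) * \<psi> (b \<otimes> d)) x) y"
    by (simp only: right_twist_def sweedler2_linear[OF integral_linear] clinear_scaleC[OF integral_linear]
        complex_scaleC_def mult.commute)
  also have "\<dots> = sw (\<lambda>c d. sw (\<lambda>a b. \<phi> (a \<cdot> c) * \<psi> (b \<otimes> d)) y) x"
    by (rule sweedler2_swap)
  also have "\<dots> = sw (\<lambda>c d. sw (\<lambda>p q. \<phi> (y \<cdot> p) * \<psi> (\<S> q \<otimes> d)) c) x"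
    by (simp only: move)
  also have "\<dots> = sw (\<lambda>p u. sw (\<lambda>q d. \<phi> (y \<cdot> p) * \<psi> (\<S> q \<otimes> d)) u) x"
    by (rule sweedler2_assoc) (intro lin)+
  also have "\<dots> = sw (\<lambda>p u. \<kappa>' u * \<phi> (y \<cdot> p)) x"
    by (simp only: sweedler2_complex_right[symmetric] kappa_inv_eq[symmetric] mult.commute)
  finally show ?thesis
    by (simp only: sweedler2_mult_right mult_scaleC_right sweedler2_linear[OF integral_linear]
        clinear_scaleC[OF integral_linear] complex_scaleC_def)
qed

text \<open>
  After \<open>integral_right_twist\<close>, the first leg of \<open>y\<close> is moved to \<open>x\<close> by \<open>integral_move_left\<close>, which
  turns $\chi$ into $\kappa \circ S^{-1}$. Hence $\Phi$ represents the integral of the twisted product.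
\<close>

lemma integral_twisted_mult: "\<phi> (y \<bullet> x) = \<phi> (y \<cdot> twist_Phi H \<chi> x)"
proof -
  define K where "K z = sw (\<lambda>p u. \<kappa>' u *\<^sub>C p) z" for z
  have K: "clinear K"
    unfolding K_def[abs_def] by (intro lin)
  note Kl = lin clinear_compose[OF K]
  \<comment> \<open>The map \<open>K\<close> acts on the last leg only.\<close>
  have comult_K: "sw (\<lambda>a b. B a b) (K z) = sw (\<lambda>a b. B a (K b)) z"
    if B: "cbilinear B" for B :: "'a \<Rightarrow> 'a \<Rightarrow> complex" and z
  proof -
    note Bl = cbilinear_left[OF B] cbilinear_right[OF B]
    have L: "clinear (sw (\<lambda>a b. B a b))"
      by (intro lin Bl)
    have "sw (\<lambda>a b. B a b) (K z) =
        sw (\<lambda>p u. sw (\<lambda>a b. \<kappa>' u *\<^sub>C B a b) p) z"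
      by (simp only: K_def sweedler2_linear[OF L] clinear_scaleC[OF L] sweedler2_scaleC_right)
    also have "\<dots> = sw (\<lambda>a y. sw (\<lambda>b u. \<kappa>' u *\<^sub>C B a b) y) z"
      by (rule sweedler2_assoc) (intro lin Bl)+
    finally show ?thesis
      by (simp only: K_def sweedler2_linear[OF Bl(2)[OF clinear_id]] clinear_scaleC[OF Bl(2)[OF clinear_id]])
  qed
  have move: "sw (\<lambda>c d. \<chi> (c \<otimes> a) *\<^sub>C \<phi> (d \<cdot> K b)) y =
      sw (\<lambda>p q. \<chi> (coantipode p \<otimes> a) *\<^sub>C \<phi> (y \<cdot> K q)) b" for a b
  proof -
    have L: "clinear (\<lambda>u. \<chi> (u \<otimes> a))"
      by (intro lin)
    have "sw (\<lambda>c d. \<chi> (c \<otimes> a) *\<^sub>C \<phi> (d \<cdot> K b)) y =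
        sw (\<lambda>p q. \<chi> (coantipode p \<otimes> a) *\<^sub>C \<phi> (y \<cdot> q)) (K b)"
      using arg_cong[OF integral_move_left[of y "K b"], of "\<lambda>u. \<chi> (u \<otimes> a)"]
      by (simp add: sweedler2_linear[OF L] clinear_scaleC[OF L] complex_scaleC_def mult.commute)
    also have "\<dots> = sw (\<lambda>p q. \<chi> (coantipode p \<otimes> a) *\<^sub>C \<phi> (y \<cdot> K q)) b"
      by (rule comult_K) (intro lin)
    finally show ?thesis .
  qed
  have kappa_coantipode: "\<kappa> (coantipode v) = sw (\<lambda>a p. \<chi> (coantipode p \<otimes> a)) v" for v
  proof -
    have "\<kappa> (coantipode v) = sw (\<lambda>a b. \<chi> (coantipode b \<otimes> \<S> (coantipode a))) v"
      unfolding kappa_eq by (rule sweedler2_coantipode) (intro lin)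
    then show ?thesis
      by (simp only: antipode_coantipode)
  qed
  have "\<phi> (y \<bullet> x) = sw (\<lambda>c d. sw (\<lambda>a b. \<chi> (c \<otimes> a) *\<^sub>C \<phi> (d \<cdot> K b)) x) y"
    by (simp only: twisted_mult_right_twist sweedler2_linear[OF integral_linear]
        clinear_scaleC[OF integral_linear] integral_right_twist K_def)
  also have "\<dots> = sw (\<lambda>a b. sw (\<lambda>c d. \<chi> (c \<otimes> a) *\<^sub>C \<phi> (d \<cdot> K b)) y) x"
    by (rule sweedler2_swap)
  also have "\<dots> = sw (\<lambda>a b. sw (\<lambda>p q. \<chi> (coantipode p \<otimes> a) *\<^sub>C \<phi> (y \<cdot> K q)) b) x"
    by (simp only: move)
  also have "\<dots> = sw (\<lambda>v q. sw (\<lambda>a p. \<chi> (coantipode p \<otimes> a) *\<^sub>C \<phi> (y \<cdot> K q)) v) x"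
    by (rule sweedler2_assoc[symmetric]) (intro Kl)+
  also have "\<dots> = sw (\<lambda>v q. \<kappa> (coantipode v) *\<^sub>C \<phi> (y \<cdot> K q)) x"
    by (simp only: kappa_coantipode sweedler2_scaleC_left)
  also have "\<dots> = \<phi> (y \<cdot> sw (\<lambda>v q. \<kappa> (coantipode v) *\<^sub>C K q) x)"
    by (simp only: sweedler2_mult_right mult_scaleC_right sweedler2_linear[OF integral_linear]
        clinear_scaleC[OF integral_linear])
  also have "sw (\<lambda>v q. \<kappa> (coantipode v) *\<^sub>C K q) x = twist_Phi H \<chi> x"
    by (simp only: twist_Phi_eq K_def sweedler3_def sweedler2_scaleC_right scaleC_scaleC)
  finally show ?thesis .
qed

lemma twisted_integral: "integral_star_hopf_algebra (twisted_hopf_algebra H \<chi>) \<phi>"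
proof (intro integral_star_hopf_algebra.intro integral_star_hopf_algebra_axioms.intro)
  show "star_hopf_algebra (twisted_hopf_algebra H \<chi>)"
    by (rule star_hopf_algebra_twisted)
  show "normal_integral (twisted_hopf_algebra H \<chi>) \<phi>"
    using integral unfolding normal_integral_def sweedler2_twisted_hopf
    by (simp add: twisted_hopf_algebra_eq)
qed

lemma twisted_form: "integral_inner (twisted_hopf_algebra H \<chi>) \<phi> x y = form (twist_Phi H \<chi> x) y"
  by (simp add: integral_inner_def twisted_hopf_algebra_eq integral_twisted_mult)

end

theorem theorem3p5:
  fixes H :: "'a::complex_vector star_hopf_data"
    and \<phi> :: "'a \<Rightarrow> complex"
    and \<chi> :: "('a, 'a) tensor \<Rightarrow> complex"
  assumes infinite_dimensional: "\<not> (\<exists>B :: 'v::complex_vector set. finite B \<and> complex_vector.span B = UNIV)"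
    and cqg: "compact_quantum_group TYPE('v) H"
    and integral: "normal_integral H \<phi>"
    and cocycle: "star_cocycle H \<chi>"
  shows "(\<forall>x y. integral_inner H \<phi> (twist_Phi H \<chi> x) y = integral_inner H \<phi> x (twist_Phi H \<chi> y)) \<and>
    (compact_quantum_group TYPE('v) (twisted_hopf_algebra H \<chi>) \<longleftrightarrow>
      (\<forall>x. x \<noteq> 0 \<longrightarrow> integral_inner H \<phi> (twist_Phi H \<chi> x) x > 0))"
proof -
  interpret star_hopf_algebra H
    using cqg by (simp add: compact_quantum_group_def)
  interpret integral_star_hopf_algebra H \<phi>
    by unfold_locales (rule integral)
  interpret integral_star_hopf_cocycle H \<phi> \<chi>
    using cocycle by unfold_locales (simp_all add: star_cocycle_def)
  interpret twisted: integral_star_hopf_algebra "twisted_hopf_algebra H \<chi>" \<phi>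
    by (rule twisted_integral)
  show ?thesis
  proof (intro conjI allI)
    fix x y
    have "form (twist_Phi H \<chi> x) y = cnj (form (twist_Phi H \<chi> y) x)"
      unfolding twisted_form[symmetric] by (rule twisted.form_hermitian)
    also have "\<dots> = form x (twist_Phi H \<chi> y)"
      by (rule form_hermitian[symmetric])
    finally show "form (twist_Phi H \<chi> x) y = form x (twist_Phi H \<chi> y)" .
  next
    show "compact_quantum_group TYPE('v) (twisted_hopf_algebra H \<chi>) \<longleftrightarrow>
        (\<forall>x. x \<noteq> 0 \<longrightarrow> form (twist_Phi H \<chi> x) x > 0)"
      using twisted.compact_quantum_group_iff_form_positive[OF infinite_dimensional]
      by (simp add: twisted_form)
  qed
qed

end
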